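(* Let $0<p<\infty$. (a) There is a constant $C$ such that for all $y\in\mathbb{R}^n$ and all $f\in H^p(\mathbb{R}^n)$, $$\Big\Vert\sup_{k\in\mathbb{Z}}\big|(\phi_k)^y*f\big|\Big\Vert_{L^p(\mathbb{R}^n)}\le C\big(\ln(e+|y|)\big)^{1/p}\Vert f\Vert_{H^p(\mathbb{R}^n)}.$$ (b) The exponent $1/p$ is optimal: if $r\ge0$ and there is a constant $C$ such that $\Vert\sup_{k}|(\phi_k)^y*f|\Vert_{L^p}\le C(\ln(e+|y|))^{r}\Vert f\Vert_{H^p}$ for all $y\in\mathbb{R}^n$ and all $f\in H^p(\mathbb{R}^n)$, then $r\ge 1/p$.
   Context: Fourier transform $\widehat f(\xi)=\int f(x)e^{-2\pi i\langle x,\xi\rangle}dx$ (any standard normalization). Fix a Schwartz function $\phi$ on $\mathbb{R}^n$ with $\mathrm{supp}(\widehat\phi)\subset\{|\xi|\le2\}$ and $\widehat\phi(\xi)=1$ for $|\xi|\le1$; let $\phi_k:=2^{kn}\phi(2^k\cdot)$ for $k\in\mathbb{Z}$. The Hardy space $H^p(\mathbb{R}^n)$ consists of tempered distributions $f$ with $\Vert f\Vert_{H^p}:=\Vert\sup_{k\in\mathbb{Z}}|\phi_k*f|\Vert_{L^p(\mathbb{R}^n)}<\infty$. For $y\in\mathbb{R}^n$, $(\phi_k)^y:=\phi_k(\cdot-2^{-k}y)=2^{kn}\phi(2^k\cdot-y)$. *)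

theory Defs
  imports "HOL-Analysis.Analysis"
begin

type_synonym 'n cfun = "real^'n \<Rightarrow> complex"

text \<open>Partial derivative in the i-th coordinate direction, and iterated partial derivatives
  (a multi-index is given as a list of coordinate directions).\<close>
definition partial :: "'n::finite \<Rightarrow> 'n cfun \<Rightarrow> 'n cfun" where
  "partial i f x = vector_derivative (\<lambda>t. f (x + t *\<^sub>R axis i 1)) (at 0)"

fun pderivs :: "'n::finite list \<Rightarrow> 'n cfun \<Rightarrow> 'n cfun" where
  "pderivs [] f = f"
| "pderivs (i # is) f = partial i (pderivs is f)"

definition schwartz :: "'n::finite cfun set" where
  "schwartz = {f. \<forall>is. continuous_on UNIV (pderivs is f)
      \<and> (\<forall>x i. (\<lambda>t. pderivs is f (x + t *\<^sub>R axis i 1)) differentiable (at 0))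
      \<and> (\<forall>m::nat. bounded (range (\<lambda>x. (1 + norm x) ^ m * norm (pderivs is f x))))}"

definition sch_seminorm :: "nat \<Rightarrow> 'n::finite cfun \<Rightarrow> real" where
  "sch_seminorm N f = (SUP (x, is) \<in> UNIV \<times> {is. length is \<le> N}.
      (1 + norm x) ^ N * norm (pderivs is f x))"

definition tempered :: "('n::finite cfun \<Rightarrow> complex) set" where
  "tempered = {u. (\<forall>f\<in>schwartz. \<forall>g\<in>schwartz. \<forall>a b. u (\<lambda>x. a * f x + b * g x) = a * u f + b * u g)
      \<and> (\<exists>C N. \<forall>f\<in>schwartz. norm (u f) \<le> C * sch_seminorm N f)}"

definition conv :: "'n::finite cfun \<Rightarrow> ('n cfun \<Rightarrow> complex) \<Rightarrow> 'n cfun" where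
  "conv \<psi> u x = u (\<lambda>t. \<psi> (x - t))"

definition fourier :: "'n::finite cfun \<Rightarrow> 'n cfun" where
  "fourier f \<xi> = (LINT x|lborel. f x * cis (- 2 * pi * (x \<bullet> \<xi>)))"

definition dil :: "'n::finite cfun \<Rightarrow> int \<Rightarrow> 'n cfun" where
  "dil \<phi> k x = of_real (2 powr (real_of_int k * real CARD('n))) * \<phi> ((2 powr real_of_int k) *\<^sub>R x)"

definition dil_shift :: "'n::finite cfun \<Rightarrow> int \<Rightarrow> real^'n \<Rightarrow> 'n cfun" where
  "dil_shift \<phi> k y x = of_real (2 powr (real_of_int k * real CARD('n))) * \<phi> ((2 powr real_of_int k) *\<^sub>R x - y)"

definition Lp_norm :: "real \<Rightarrow> (real^'n::finite \<Rightarrow> ennreal) \<Rightarrow> ennreal" where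
  "Lp_norm p g = (let I = (\<integral>\<^sup>+ x. (if g x = \<infinity> then \<infinity> else ennreal (enn2real (g x) powr p)) \<partial>lborel) in
     if I = \<infinity> then \<infinity> else ennreal (enn2real I powr (1 / p)))"

definition maxfun :: "(int \<Rightarrow> 'n::finite cfun) \<Rightarrow> ('n cfun \<Rightarrow> complex) \<Rightarrow> real^'n \<Rightarrow> ennreal" where
  "maxfun \<Psi> f x = (SUP k. ennreal (norm (conv (\<Psi> k) f x)))"

definition Hp_norm :: "real \<Rightarrow> 'n::finite cfun \<Rightarrow> ('n cfun \<Rightarrow> complex) \<Rightarrow> ennreal" where
  "Hp_norm p \<phi> f = Lp_norm p (maxfun (dil \<phi>) f)"

definition Hp :: "real \<Rightarrow> 'n::finite cfun \<Rightarrow> ('n cfun \<Rightarrow> complex) set" where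
  "Hp p \<phi> = {f \<in> tempered. Hp_norm p \<phi> f < \<infinity>}"

end

(*
  Write f_k for phi_k * f, so that (phi_k)^y * f (x) = f_k (x - 2^-k y).

  Upper bound.  Since phi_{k+1} * phi_k = phi_k (compare Fourier transforms), f_k reproduces
  itself, f_k = phi_{k+1} * f_k, and Peetre's argument bounds |f_k(z)|^r, for r < 1, by an average
  of |f_k|^r against a rapidly decaying kernel at scale 2^-k.  Splitting this average over the
  dyadic cubes of side 2^-k bounds |f_k(x - 2^-k y)|^r by the supremum over lattice points m of
  (1+|m+y|)^-M S_m(F^r)(x), where F = sup_k |f_k| and S_m takes averages over the dyadic cubes
  translated by m times their side length.  The weak type bound of S_m loses a factor of order
  log(e+|m|): the points whose m-th neighbour of generation k lies in a maximal bad cube Q of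
  generation j <= k are translates of Q, and as soon as 2^(k-j) exceeds |m| these translates all lie
  in the neighbours of Q.  With q = p+2 and r = p/q the L^q bound of S_m gives the claim.

  Sharpness.  For f = phi_0 - phi_{-2} we have phi_k * f = f for k >= 1 and phi_k * f = 0 for
  k <= -3, so f lies in H^p.  If |y| is about 2^L, the functions f(. - 2^-k y), 1 <= k <= L, are
  bounded below on L disjoint balls of equal radius, so the left hand side is at least of order
  L^(1/p).
*)

theory Submission
  imports Defs "HOL-Probability.Probability"
begin

text \<open>The power of the logarithm is decided by a truncation in the weak type estimate. There
  \<open>H\<close> counts only where it exceeds the level, so the estimate is already interpolated
  with the lossless supremum bound, and for every q the logarithm enters the integral of S_m(H)^q
  exactly once. With H = F^r and q r = p that integral is compared with the integral of F^p, and the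
  p-th root turns one logarithm into the power 1/p. The supremum over m is replaced by a sum; decay
  in m + y makes it converge and trades log(e+|m|) for log(e+|y|).

  Constants must not depend on k or f. Rescaling by 2^k turns the reproducing kernel into
  \<open>dil \<phi> 1\<close> for every k, and the polynomial growth of f_k, whose order depends on
  f, may be used only qualitatively.

  For sharpness, subtracting phi_{-2} removes the low frequencies. For phi_0 alone the terms with
  very negative k would be the functions phi_k themselves, whose supremum decays only like |x|^-n,
  too slowly for p <= 1.\<close>

section \<open>Powers of extended nonnegative reals and integrals over Euclidean space\<close>

text \<open>The integrand and the outer root of \<open>Lp_norm\<close> in one function. The case
  split is needed because \<open>enn2real\<close> maps \<infinity> to 0; with it the map is
  multiplicative and composes like real powers, so that L^p estimates need no finiteness
  hypotheses.\<close>

definition epowr :: "real \<Rightarrow> ennreal \<Rightarrow> ennreal" where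
  "epowr p x = (if x = \<infinity> then \<infinity> else ennreal (enn2real x powr p))"

lemma Lp_norm_epowr: "Lp_norm p g = epowr (1 / p) (\<integral>\<^sup>+ x. epowr p (g x) \<partial>lborel)"
  by (simp add: Lp_norm_def epowr_def Let_def)

lemma epowr_top [simp]: "epowr p \<top> = \<top>"
  by (simp add: epowr_def)

lemma epowr_ennreal: "0 \<le> a \<Longrightarrow> epowr p (ennreal a) = ennreal (a powr p)"
  by (simp add: epowr_def)

lemma epowr_0 [simp]: "epowr p 0 = 0"
  using epowr_ennreal[of 0 p] by simp

lemma epowr_1 [simp]: "epowr 1 x = x"
  by (cases x) (auto simp: epowr_ennreal)

lemma epowr_mono: "x \<le> y \<Longrightarrow> 0 \<le> p \<Longrightarrow> epowr p x \<le> epowr p y"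
  by (cases x; cases y) (auto simp: epowr_ennreal top_unique powr_mono2)

lemma epowr_epowr: "epowr p (epowr q x) = epowr (p * q) x"
  by (cases x) (auto simp: epowr_ennreal powr_powr mult.commute)

lemma epowr_mult: "epowr p (x * y) = epowr p x * epowr p y"
proof (cases "x = \<top> \<or> y = \<top>")
  case True
  have *: "epowr p (\<top> * z) = \<top> * epowr p z" for z
  proof (cases "z = 0")
    case False
    then have "epowr p z \<noteq> 0" by (cases z) (auto simp: epowr_ennreal)
    then show ?thesis using False by (simp add: ennreal_top_mult)
  qed simp
  from True show ?thesis
  proof
    assume "x = \<top>"
    then show ?thesis using *[of y] by simp
  next
    assume "y = \<top>"
    then show ?thesis using *[of x] by (simp only: mult.commute[of x] mult.commute[of "epowr p x"] epowr_top)
  qed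
next
  case False
  then show ?thesis
    by (cases x; cases y) (auto simp: epowr_ennreal ennreal_mult[symmetric] powr_mult)
qed

lemma epowr_le_iff: "0 < p \<Longrightarrow> epowr p x \<le> y \<longleftrightarrow> x \<le> epowr (1 / p) y"
  using epowr_mono[of x "epowr (1/p) y" p] epowr_mono[of "epowr p x" y "1/p"]
  by (auto simp: epowr_epowr)

lemma epowr_SUP: "0 < p \<Longrightarrow> epowr p (SUP i\<in>I. f i) = (SUP i\<in>I. epowr p (f i))"
  by (rule antisym)
    (auto simp: epowr_le_iff intro!: SUP_least epowr_mono SUP_upper2
      intro: order_trans[OF _ epowr_mono[OF SUP_upper]] simp: epowr_epowr)

lemma measurable_epowr [measurable]: "epowr p \<in> borel_measurable borel"
  unfolding epowr_def[abs_def] by measurable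

section \<open>Affine substitutions, integrable weights and the layer cake formula\<close>

lemma nn_integral_affine:
  fixes f :: "'a::euclidean_space \<Rightarrow> ennreal"
  assumes [measurable]: "f \<in> borel_measurable borel" and c: "c \<noteq> 0"
  shows "(\<integral>\<^sup>+ x. f (t + c *\<^sub>R x) \<partial>lborel) = ennreal (1 / \<bar>c\<bar> ^ DIM('a)) * (\<integral>\<^sup>+ x. f x \<partial>lborel)"
proof -
  have "(\<integral>\<^sup>+ x. f x \<partial>lborel) = ennreal (\<bar>c\<bar> ^ DIM('a)) * (\<integral>\<^sup>+ x. f (t + c *\<^sub>R x) \<partial>lborel)"
    using c by (subst lborel_affine[OF c, of t])
       (simp add: nn_integral_density nn_integral_distr nn_integral_cmult)
  then show ?thesis using c
    by (simp add: mult.assoc[symmetric] ennreal_mult[symmetric])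
qed

lemma integral_affine:
  fixes f :: "'a::euclidean_space \<Rightarrow> 'b::{banach, second_countable_topology}"
  assumes [measurable]: "f \<in> borel_measurable borel" and c: "c \<noteq> 0"
  shows "(LBINT x. f (t + c *\<^sub>R x)) = (1 / \<bar>c\<bar> ^ DIM('a)) *\<^sub>R (LBINT x. f x)"
proof -
  have "(LBINT x. f x) = (\<bar>c\<bar> ^ DIM('a)) *\<^sub>R (LBINT x. f (t + c *\<^sub>R x))"
    using c by (subst lborel_affine[OF c, of t])
       (simp add: integral_density integral_distr)
  then show ?thesis using c by simp
qed

lemma integrable_affine:
  fixes f :: "'a::euclidean_space \<Rightarrow> 'b::{banach, second_countable_topology}"
  assumes f: "integrable lborel f" and c: "c \<noteq> 0"
  shows "integrable lborel (\<lambda>x. f (t + c *\<^sub>R x))"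
proof -
  have [measurable]: "f \<in> borel_measurable borel" using f by auto
  show ?thesis using f unfolding integrable_iff_bounded
    by (auto simp: nn_integral_affine[OF _ c, where f="\<lambda>x. ennreal (norm (f x))"] ennreal_mult_less_top)
qed

text \<open>The weight is dominated by the product over coordinates of 1/(1 + x_b^2), each factor at
  the price of two powers of 1 + |x|. Hence the exponent 2 DIM, which recurs below whenever an
  integrable weight is needed.\<close>

lemma nn_integral_weight_finite:
  fixes s :: real
  assumes s: "s \<ge> 2 * DIM('a)"
  shows "(\<integral>\<^sup>+ (x::'a::euclidean_space). ennreal ((1 + norm x) powr (- s)) \<partial>lborel) < \<infinity>"
proof -
  have fin: "(\<integral>\<^sup>+ t. ennreal (inverse (1 + t^2)) \<partial>lborel) < \<infinity>"
    using integrable_inverse_1_plus_square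
    by (auto simp: set_integrable_def integrable_iff_bounded field_simps add_pos_nonneg)
  have "(\<integral>\<^sup>+ (x::'a). ennreal ((1 + norm x) powr (- s)) \<partial>lborel)
     \<le> (\<integral>\<^sup>+ (x::'a). (\<Prod>b\<in>Basis. ennreal (inverse (1 + (x \<bullet> b)^2))) \<partial>lborel)"
  proof (rule nn_integral_mono)
    fix x :: 'a
    have *: "inverse ((1 + norm x)^2) \<le> inverse (1 + (x \<bullet> b)^2)" if "b \<in> Basis" for b
    proof (rule le_imp_inverse_le)
      have "(x \<bullet> b)^2 \<le> norm x ^ 2"
        using Basis_le_norm[OF that, of x] by (metis abs_ge_zero power2_abs power_mono)
      then show "1 + (x \<bullet> b)\<^sup>2 \<le> (1 + norm x)\<^sup>2" using norm_ge_zero[of x]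
        by (simp add: power2_sum add_increasing2)
      show "0 < 1 + (x \<bullet> b)^2" by (simp add: add_pos_nonneg)
    qed
    have "(1 + norm x) powr (- s) \<le> (1 + norm x) powr (- real (2 * DIM('a)))"
      using s by (intro powr_mono) auto
    also have "\<dots> = (\<Prod>b\<in>(Basis::'a set). inverse ((1 + norm x)^2))"
      by (simp only: powr_minus powr_realpow[OF add_pos_nonneg[OF zero_less_one norm_ge_zero]])
         (simp add: power_mult power_inverse)
    also have "\<dots> \<le> (\<Prod>b\<in>(Basis::'a set). inverse (1 + (x \<bullet> b)^2))"
      by (intro prod_mono conjI *) auto
    finally show "ennreal ((1 + norm x) powr (- s)) \<le> (\<Prod>b\<in>Basis. ennreal (inverse (1 + (x \<bullet> b)^2)))"
      by (subst prod_ennreal) (auto simp: add_nonneg_nonneg intro!: ennreal_leI)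
  qed
  also have "\<dots> = (\<Prod>b\<in>(Basis::'a set). (\<integral>\<^sup>+ t. ennreal (inverse (1 + t^2)) \<partial>lborel))"
    by (rule nn_integral_lborel_prod) (auto simp: add_nonneg_nonneg)
  also have "\<dots> < \<infinity>"
    using fin by (simp add: ennreal_prod_eq_top less_top[symmetric] power_eq_top_ennreal)
  finally show ?thesis .
qed

text \<open>For finite \<open>a\<close> the integrand is the derivative of l^q, and the level set
  differs from a closed interval by two points. For infinite \<open>a\<close> the integral is at
  least n^q >= n for every n.\<close>

lemma epowr_layer_cake:
  assumes q: "q > 1"
  shows "epowr q a = (\<integral>\<^sup>+ l. ennreal (q * l powr (q - 1)) * indicator {l. 0 < l \<and> ennreal l < a} l \<partial>lborel)"
proof -
  have m: "(\<integral>\<^sup>+ l. ennreal (q * l powr (q - 1)) * indicator {0..b} l \<partial>lborel) = ennreal (b powr q)"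
    if "b \<ge> 0" for b
  proof -
    have "((\<lambda>l. l powr (q - 1)) has_integral (b powr (q - 1 + 1) / (q - 1 + 1))) {0..b}"
      using q that by (intro has_integral_powr_from_0) auto
    from has_integral_mult_right[OF this, of q]
    have "((\<lambda>l. q * l powr (q - 1)) has_integral (b powr q)) {0..b}"
      using q by simp
    from nn_integral_has_integral_lebesgue[OF _ this]
    show ?thesis using q
      by (simp add: nn_integral_completion ennreal_mult ennreal_indicator mult.commute)
  qed
  show ?thesis
  proof (cases a)
    case (real b)
    have "(\<integral>\<^sup>+ l. ennreal (q * l powr (q - 1)) * indicator {l. 0 < l \<and> ennreal l < a} l \<partial>lborel)
       = (\<integral>\<^sup>+ l. ennreal (q * l powr (q - 1)) * indicator {0..b} l \<partial>lborel)"
    proof (rule nn_integral_cong_AE)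
      show "AE l in lborel. ennreal (q * l powr (q - 1)) * indicator {l. 0 < l \<and> ennreal l < a} l
         = ennreal (q * l powr (q - 1)) * indicator {0..b} l"
        using AE_lborel_singleton[of 0] AE_lborel_singleton[of b]
      proof eventually_elim
        case (elim l)
        then show ?case using real by (auto simp: indicator_def ennreal_less_iff)
      qed
    qed
    then show ?thesis using m real by (simp add: epowr_ennreal)
  next
    case top
    have "ennreal (real n) \<le> (\<integral>\<^sup>+ l. ennreal (q * l powr (q - 1)) * indicator {l. 0 < l \<and> ennreal l < a} l \<partial>lborel)" for n
    proof -
      have "real n \<le> real n powr q"
      proof (cases "n = 0")
        case False
        then have "real n powr 1 \<le> real n powr q" using q by (intro powr_mono) auto
        then show ?thesis using False by simp
      qed simp
      then have "ennreal (real n) \<le> ennreal (real n powr q)" by (rule ennreal_leI)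
      also have "\<dots> \<le> (\<integral>\<^sup>+ l. ennreal (q * l powr (q - 1)) * indicator {l. 0 < l \<and> ennreal l < a} l \<partial>lborel)"
        unfolding m[OF of_nat_0_le_iff, symmetric] using top
        by (intro nn_integral_mono_AE) (use AE_lborel_singleton[of 0] in \<open>auto simp: indicator_def ennreal_less_top\<close>)
      finally show ?thesis .
    qed
    then have "(\<integral>\<^sup>+ l. ennreal (q * l powr (q - 1)) * indicator {l. 0 < l \<and> ennreal l < a} l \<partial>lborel) = \<top>"
      (is "?I = _")
    proof (intro ccontr[of "?I = \<top>"])
      assume le: "\<And>n. ennreal (real n) \<le> ?I" and "?I \<noteq> \<top>"
      then obtain n where "?I < of_nat n" using ennreal_Ex_less_of_nat[of ?I] by (auto simp: less_top)
      with le[of n] show False by (simp add: ennreal_of_nat_eq_real_of_nat)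
    qed
    then show ?thesis using top by simp
  qed
qed

section \<open>Dyadic cubes and shifted dyadic maximal functions\<close>

abbreviation (input) scl :: "int \<Rightarrow> real" where "scl k \<equiv> 2 powr real_of_int k"

text \<open>Indexing half-open cubes of side \<open>1 / scl k\<close> by integer vectors makes each
  generation an exact partition, a shift by \<open>m\<close> side lengths an addition
  (\<open>cell_shift\<close>) and nesting an integer division (\<open>cell_coarse\<close>).\<close>

definition cell :: "int \<Rightarrow> real^'n \<Rightarrow> int^'n" where
  "cell k x = (\<chi> i. \<lfloor>scl k * x $ i\<rfloor>)"

definition cube :: "int \<Rightarrow> int^'n \<Rightarrow> (real^'n) set" where
  "cube k l = {x. cell k x = l}"

definition ivec :: "int^'n \<Rightarrow> real^'n" where
  "ivec l = (\<chi> i. real_of_int (l $ i))"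

lemma measurable_cell [measurable]: "cell k \<in> borel \<rightarrow>\<^sub>M count_space (UNIV :: (int^'n::finite) set)"
proof -
  have "cell k -` {l} = {x::real^'n. \<forall>i. \<lfloor>scl k * x $ i\<rfloor> = l $ i}" for l
    by (auto simp: cell_def vec_eq_iff)
  moreover have "{x::real^'n. \<forall>i. \<lfloor>scl k * x $ i\<rfloor> = l $ i} \<in> sets borel" for l :: "int^'n"
    by measurable
  ultimately show ?thesis
    by (subst measurable_count_space_eq_countable) auto
qed

lemma sets_cube [measurable]: "cube k l \<in> sets (borel :: (real^'n::finite) measure)"
proof -
  have "cube k l = cell k -` {l} \<inter> space borel" by (auto simp: cube_def)
  also have "\<dots> \<in> sets borel" by (rule measurable_sets[OF measurable_cell]) auto
  finally show ?thesis .
qed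

lemma emeasure_cube:
  "emeasure lborel (cube k (l::int^'n::finite)) = ennreal ((1 / scl k) ^ CARD('n))"
proof -
  define a where "a = (\<chi> i. real_of_int (l $ i) / scl k)"
  define b where "b = (\<chi> i. (real_of_int (l $ i) + 1) / scl k)"
  have ab: "a \<bullet> i \<le> b \<bullet> i" "(b - a) \<bullet> i = 1 / scl k" if "i \<in> Basis" for i
    using that by (auto simp: Basis_vec_def a_def b_def inner_axis divide_right_mono field_simps)
  have pos: "0 < scl k" by simp
  have fi: "\<lfloor>scl k * t\<rfloor> = n \<longleftrightarrow>
      real_of_int n / scl k \<le> t \<and> t < (real_of_int n + 1) / scl k" for t n
    by (simp add: floor_eq_iff pos_divide_le_eq[OF pos] pos_less_divide_eq[OF pos] mult.commute)
  \<comment> \<open>The cube is squeezed between an open and a closed box of the same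
    volume.\<close>
  have "box a b \<subseteq> cube k l" "cube k l \<subseteq> cbox a b"
    by (auto simp: cube_def cell_def a_def b_def mem_box_cart vec_eq_iff fi less_imp_le)
  then have "emeasure lborel (box a b) \<le> emeasure lborel (cube k l)"
       "emeasure lborel (cube k l) \<le> emeasure lborel (cbox a b)"
    by (auto intro!: emeasure_mono)
  moreover have "emeasure lborel (box a b) = ennreal ((1 / scl k) ^ CARD('n))"
    "emeasure lborel (cbox a b) = ennreal ((1 / scl k) ^ CARD('n))"
    using ab by (simp_all add: emeasure_lborel_box emeasure_lborel_cbox)
  ultimately show ?thesis by simp
qed

lemma cell_shift: "cell k (x + (1 / scl k) *\<^sub>R ivec m) = cell k x + m"
  by (simp add: cell_def ivec_def vec_eq_iff algebra_simps)

lemma cell_coarse: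
  assumes "j \<le> k" "cell k x = cell k x'"
  shows "cell j x = cell j x'"
proof -
  have "\<lfloor>scl j * t\<rfloor> = \<lfloor>scl k * t\<rfloor> div 2 ^ nat (k - j)" for t :: real
  proof -
    have "scl j * t = scl k * t / real_of_int (2 ^ nat (k - j))"
      using assms(1) by (simp add: powr_realpow[symmetric] powr_diff)
    then show ?thesis by (simp only: floor_divide_real_eq_div[OF zero_le_power[OF zero_le_numeral]])
  qed
  then show ?thesis using assms(2) by (simp add: cell_def vec_eq_iff)
qed

definition cube_avg :: "(real^'n::finite \<Rightarrow> ennreal) \<Rightarrow> int \<Rightarrow> int^'n \<Rightarrow> ennreal" where
  "cube_avg H k l = ennreal ((scl k) ^ CARD('n)) * (\<integral>\<^sup>+ x. H x * indicator (cube k l) x \<partial>lborel)"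

text \<open>The S_m of the overview: the average is taken \<open>m\<close> cubes away from the cube
  of \<open>x\<close>, a distance that changes with \<open>k\<close>. For \<open>m = 0\<close> this
  is the dyadic maximal function.\<close>

definition shifted_max :: "int^'n \<Rightarrow> (real^'n::finite \<Rightarrow> ennreal) \<Rightarrow> real^'n \<Rightarrow> ennreal" where
  "shifted_max m H x = (SUP k. cube_avg H k (cell k x + m))"

lemma measurable_shifted_max [measurable]: "shifted_max m H \<in> borel_measurable borel"
proof -
  have "(\<lambda>x. cube_avg H k (cell k x + m)) \<in> borel_measurable borel" for k
    by (rule measurable_compose[OF measurable_cell]) auto
  then show ?thesis unfolding shifted_max_def[abs_def] by (intro borel_measurable_SUP) auto
qed

lemma emeasure_translate:
  fixes A :: "'a::euclidean_space set"
  assumes [measurable]: "A \<in> sets borel"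
  shows "emeasure lborel {x. x + a \<in> A} = emeasure lborel A"
proof -
  have [measurable]: "{x. x + a \<in> A} \<in> sets borel" by measurable
  have "emeasure lborel {x. x + a \<in> A} = (\<integral>\<^sup>+ x. indicator {x. x + a \<in> A} x \<partial>lborel)"
    by (subst nn_integral_indicator) auto
  also have "\<dots> = (\<integral>\<^sup>+ x. indicator A (a + 1 *\<^sub>R x) \<partial>lborel)"
    by (intro nn_integral_cong) (auto simp: indicator_def add.commute)
  also have "\<dots> = emeasure lborel A"
    by (subst nn_integral_affine) auto
  finally show ?thesis .
qed

section \<open>Weak and strong type bounds for the shifted maximal function\<close>

definition neighbours :: "(int^'n) set" where "neighbours = {e. \<forall>i. e $ i \<in> {-1,0,1}}"

lemma finite_neighbours: "finite (neighbours :: (int^'n::finite) set)"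
proof -
  have "neighbours \<subseteq> vec_lambda ` (PiE (UNIV::'n set) (\<lambda>_. {-1,0,1::int}))"
  proof
    fix e :: "int^'n" assume "e \<in> neighbours"
    then have "(\<lambda>i. e $ i) \<in> PiE UNIV (\<lambda>_. {-1,0,1::int})" by (auto simp: neighbours_def)
    moreover have "e = vec_lambda (\<lambda>i. e $ i)" by (simp add: vec_eq_iff)
    ultimately show "e \<in> vec_lambda ` (PiE (UNIV::'n set) (\<lambda>_. {-1,0,1::int}))" by blast
  qed
  then show ?thesis by (rule finite_subset) (auto intro!: finite_PiE)
qed

text \<open>Where \<open>H\<close> is at most \<open>l\<close> it contributes at most
  \<open>l\<close> times the volume to an integral that exceeds twice that, so the part of
  \<open>H\<close> above \<open>l\<close> carries the rest. The factor 2 in the level sets below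
  comes from here.\<close>

lemma bad_cube:
  fixes H :: "real^'n::finite \<Rightarrow> ennreal"
  assumes [measurable]: "H \<in> borel_measurable borel" and l: "0 < l" and bad: "cube_avg H k m > ennreal (2 * l)"
  shows "ennreal l * emeasure lborel (cube k m)
     \<le> (\<integral>\<^sup>+ x. H x * indicator {x. H x > ennreal l} x * indicator (cube k m) x \<partial>lborel)" (is "_ \<le> ?J")
proof -
  define e where "e = (1 / scl k) ^ CARD('n)"
  have e: "0 < e" "emeasure lborel (cube k m) = ennreal e" by (auto simp: e_def emeasure_cube)
  let ?I = "\<integral>\<^sup>+ x. H x * indicator (cube k m) x \<partial>lborel"
  have "ennreal (2 * l) * ennreal e \<le> cube_avg H k m * ennreal e"
    using bad by (intro mult_right_mono) auto
  also have "cube_avg H k m * ennreal e = ennreal ((scl k) ^ CARD('n)) * ennreal e * ?I"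
    unfolding cube_avg_def by (simp only: mult.assoc mult.commute[of ?I])
  also have "ennreal ((scl k) ^ CARD('n)) * ennreal e = 1"
    by (simp add: e_def ennreal_mult[symmetric] power_mult_distrib[symmetric])
  also have "1 * ?I \<le> (\<integral>\<^sup>+ x. ennreal l * indicator (cube k m) x
       + H x * indicator {x. H x > ennreal l} x * indicator (cube k m) x \<partial>lborel)"
    unfolding mult_1 by (intro nn_integral_mono) (auto simp: indicator_def)
  also have "\<dots> = ennreal l * ennreal e + ?J"
    by (subst nn_integral_add) (auto simp: nn_integral_cmult e(2) nn_integral_cmult_indicator)
  finally have *: "ennreal (2 * l) * ennreal e \<le> ennreal l * ennreal e + ?J" .
  show ?thesis
  proof (cases ?J)
    case (real r)
    then show ?thesis using * l e by (simp add: ennreal_mult[symmetric] ennreal_plus[symmetric] mult.commute[of e] del: ennreal_plus)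
  qed simp
qed

text \<open>The constant counts sets of equal measure: \<open>L + 1\<close> translates of the union
  of the maximal bad cubes of one generation, for the finer generations at which the shift can
  exceed one side length, and one more translate for each neighbour.\<close>

lemma shifted_max_weak_type:
  fixes H :: "real^'n::finite \<Rightarrow> ennreal" and m :: "int^'n"
  assumes [measurable]: "H \<in> borel_measurable borel" and l: "0 < l" and L: "\<And>i. \<bar>m $ i\<bar> \<le> 2 ^ L"
  shows "emeasure lborel {x. shifted_max m H x > ennreal (2 * l)}
    \<le> ennreal ((L + 1 + card (neighbours :: (int^'n) set)) / l) * (\<integral>\<^sup>+ x. H x * indicator {x. H x > ennreal l} x \<partial>lborel)"
    (is "_ \<le> ?c * ?I")
proof (cases "?I = \<top>")
  case True
  have "?c \<noteq> 0" using l by simp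
  then show ?thesis using True by (simp add: ennreal_mult_top)
next
  case False
  then obtain r where r: "?I = ennreal r" "0 \<le> r" by (cases ?I) auto
  define P where "P k n \<longleftrightarrow> cube_avg H k n > ennreal (2 * l)" for k n
  \<comment> \<open>This measure is finite in the present case, so its total mass limits the volume
    of bad cubes. The estimates for the disjoint sets \<open>N j\<close> are summed against
    it.\<close>
  define \<nu> where "\<nu> = density lborel (\<lambda>x. H x * indicator {x. H x > ennreal l} x)"
  have sets_\<nu> [simp]: "sets \<nu> = sets borel" by (simp add: \<nu>_def)
  have \<nu>: "emeasure \<nu> A = (\<integral>\<^sup>+ x. H x * indicator {x. H x > ennreal l} x * indicator A x \<partial>lborel)"
    if "A \<in> sets borel" for A
    unfolding \<nu>_def using that by (intro emeasure_density) auto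
  have \<nu>_UNIV: "emeasure \<nu> UNIV = ?I" by (subst \<nu>) auto
  \<comment> \<open>the points whose largest bad cube is of generation \<open>j\<close>; bad cubes cannot be arbitrarily large\<close>
  define N where "N j = {x. P j (cell j x) \<and> (\<forall>i<j. \<not> P i (cell i x))}" for j
  have Pm: "{x. P j (cell j x)} \<in> sets borel" for j
    using measurable_sets[OF measurable_cell, of "{n. P j n}" j] by (auto simp: vimage_def)
  have N_meas [measurable]: "N j \<in> sets borel" for j
  proof -
    have "N j = {x. P j (cell j x)} - (\<Union>i\<in>{..<j}. {x. P i (cell i x)})" by (auto simp: N_def)
    then show ?thesis using Pm by (auto intro!: sets.Diff sets.countable_UN')
  qed
  \<comment> \<open>Coarser cells are determined by \<open>cell j\<close>, so \<open>N j\<close> is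
    a union of whole cubes of generation \<open>j\<close>.\<close>
  have N_fl: "y \<in> N j" if "x \<in> N j" "cell j x = cell j y" for x y j
    using that cell_coarse[of _ j x y] by (auto simp: N_def)
  have N_UN: "N j = (\<Union>n\<in>cell j ` N j. cube j n)" for j
    using N_fl by (auto simp: cube_def)
  have disj: "disjoint_family_on (cube j) A" for j and A :: "(int^'n) set"
    by (auto simp: disjoint_family_on_def cube_def)
  let ?C = "\<lambda>j. count_space (cell j ` N j)"
  have N_le: "ennreal l * emeasure lborel (N j) \<le> emeasure \<nu> (N j)" for j
  proof -
    have cnt: "countable (cell j ` N j)" by simp
    have "ennreal l * emeasure lborel (N j) = ennreal l * (\<integral>\<^sup>+ n. emeasure lborel (cube j n) \<partial>?C j)"
      by (subst N_UN, subst emeasure_UN_countable) (auto intro: disj)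
    also have "\<dots> = (\<integral>\<^sup>+ n. ennreal l * emeasure lborel (cube j n) \<partial>?C j)"
      by (simp add: nn_integral_cmult)
    also have "\<dots> \<le> (\<integral>\<^sup>+ n. emeasure \<nu> (cube j n) \<partial>?C j)"
    proof (rule nn_integral_mono)
      fix n assume "n \<in> space (?C j)"
      then have "P j n" by (auto simp: N_def)
      then show "ennreal l * emeasure lborel (cube j n) \<le> emeasure \<nu> (cube j n)"
        using bad_cube[OF assms(1) l, of j n] by (subst \<nu>) (auto simp: P_def)
    qed
    also have "\<dots> = emeasure \<nu> (N j)"
      by (subst (2) N_UN, subst emeasure_UN_countable) (auto intro: disj)
    finally show ?thesis .
  qed
  have N_disj: "disjoint_family N"
    unfolding disjoint_family_on_def N_def by (auto, metis not_less_iff_gr_or_eq)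
  \<comment> \<open>A bad cube of generation j < 0 has volume at least -j, and \<open>l\<close>
    times its volume is at most the mass \<open>r\<close>. So generations of bad cubes are bounded
    below, and every bad cube lies in a largest one.\<close>
  have lower: "- r / l \<le> real_of_int j" if "P j n" for j n
  proof (rule ccontr)
    assume neg: "\<not> - r / l \<le> real_of_int j"
    then have j: "real_of_int j < 0" using r l by (smt (verit) divide_nonneg_pos minus_divide_left)
    have "ennreal l * ennreal ((1 / scl j) ^ CARD('n)) \<le> emeasure \<nu> (cube j n)"
      using bad_cube[OF assms(1) l, of j n] that by (subst \<nu>) (auto simp: P_def emeasure_cube)
    also have "\<dots> \<le> emeasure \<nu> UNIV" by (intro emeasure_mono) auto
    finally have "l * (1 / scl j) ^ CARD('n) \<le> r"
      using \<nu>_UNIV r l by (simp add: ennreal_mult[symmetric])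
    moreover have "- real_of_int j \<le> (1 / scl j) ^ CARD('n)"
    proof -
      have "1 \<le> 2 powr (- real_of_int j)" using j by (intro ge_one_powr_ge_zero) auto
      then have ge1: "1 \<le> 1 / scl j" by (simp add: powr_minus_divide)
      have "- real_of_int j \<le> 2 powr (- real_of_int j)"
      proof -
        have eq: "- real_of_int j = real (nat (- j))" using j by simp
        have "real (nat (- j)) \<le> 2 ^ nat (- j)" using of_nat_less_two_power by (rule less_imp_le)
        also have "\<dots> = 2 powr real (nat (- j))" by (simp only: powr_realpow zero_less_numeral)
        finally show ?thesis unfolding eq .
      qed
      also have "\<dots> = (1 / scl j) ^ 1" by (simp add: powr_minus_divide)
      also have "\<dots> \<le> (1 / scl j) ^ CARD('n)"
        using ge1 by (intro power_increasing) (auto simp: Suc_leI)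
      finally show ?thesis .
    qed
    ultimately have "l * (- real_of_int j) \<le> r" using l by (smt (verit) mult_left_mono)
    then show False using neg l by (simp add: field_simps)
  qed
  define sh where "sh k = (1 / scl k)" for k :: int
  \<comment> \<open>\<open>?T j s\<close> collects the points that the shift of generation j + s
    carries into \<open>N j\<close>, and \<open>?V j e\<close> those that a step \<open>e\<close> of
    generation \<open>j\<close> carries there.\<close>
  let ?T = "\<lambda>j s. {x. x + sh (j + int s) *\<^sub>R ivec m \<in> N j}"
  let ?V = "\<lambda>j e. {x. x + sh j *\<^sub>R ivec e \<in> N j}"
  define B where "B j = (\<Union>s\<in>{..L}. ?T j s) \<union> (\<Union>e\<in>neighbours. ?V j e)" for j
  have B_meas [measurable]: "B j \<in> sets borel" for j
    unfolding B_def using finite_neighbours by (intro sets.Un sets.finite_UN) auto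
  have cover: "{x. shifted_max m H x > ennreal (2 * l)} \<subseteq> (\<Union>j. B j)"
  proof
    fix x assume "x \<in> {x. shifted_max m H x > ennreal (2 * l)}"
    then obtain k where k: "P k (cell k x + m)" by (auto simp: shifted_max_def less_SUP_iff P_def)
    define x' where "x' = x + sh k *\<^sub>R ivec m"
    have k': "P k (cell k x')" using k by (simp add: x'_def sh_def cell_shift)
    \<comment> \<open>By \<open>lower\<close> no generation below this range can be bad, so the
      minimum of a finite set finds the largest bad cube containing \<open>x'\<close>.\<close>
    define J where "J = {j \<in> {\<lceil>- r / l\<rceil>..k}. P j (cell j x')}"
    have J: "finite J" unfolding J_def by (rule finite_subset[OF _ finite_atLeastAtMost_int]) blast
    have kJ: "k \<in> J" using k' lower[OF k'] by (auto simp: J_def ceiling_le_iff)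
    define j where "j = Min J"
    have j: "j \<in> J" "\<And>i. i \<in> J \<Longrightarrow> j \<le> i" using Min_in[OF J] Min_le[OF J] kJ by (auto simp: j_def)
    have jk: "j \<le> k" using j kJ by auto
    have x'N: "x' \<in> N j"
    proof -
      have "\<not> P i (cell i x')" if "i < j" for i
        using j(2)[of i] that jk lower[of i "cell i x'"] by (auto simp: J_def ceiling_le_iff)
      then show ?thesis using j by (auto simp: N_def J_def)
    qed
    show "x \<in> (\<Union>j. B j)"
    \<comment> \<open>If k > j + L, then 2^(k-j) exceeds every |m_i|: measured in cubes of
      generation \<open>j\<close> the shift is at most one in each coordinate, and \<open>x\<close>
      lies in a neighbour of the cube of \<open>x'\<close>.\<close>
    proof (cases "k \<le> j + int L")
      case True
      then have "x \<in> {x. x + sh (j + int (nat (k - j))) *\<^sub>R ivec m \<in> N j}" "nat (k - j) \<in> {..L}"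
        using jk x'N by (auto simp: x'_def)
      then show ?thesis unfolding B_def by blast
    next
      case False
      define e where "e = cell j x' - cell j x"
      have "cell j (x + sh j *\<^sub>R ivec e) = cell j x'" by (simp add: sh_def cell_shift e_def)
      then have 1: "x + sh j *\<^sub>R ivec e \<in> N j" using N_fl[OF x'N] by simp
      have "e $ i \<in> {-1,0,1}" for i
      proof -
        have "\<bar>scl j * (sh k * real_of_int (m $ i))\<bar> \<le> 1"
        proof -
          have "real_of_int \<bar>m $ i\<bar> \<le> 2 ^ L" using L[of i] by (metis of_int_le_iff of_int_numeral of_int_power)
          also have "\<dots> = 2 powr real L" by (simp add: powr_realpow)
          also have "\<dots> \<le> 2 powr (real_of_int k - real_of_int j)" using False by (intro powr_mono) auto
          finally show ?thesis by (simp add: sh_def abs_mult powr_diff field_simps)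
        qed
        moreover have "scl j * x' $ i = scl j * x $ i + scl j * (sh k * real_of_int (m $ i))"
          by (simp add: x'_def ivec_def algebra_simps)
        moreover have "e $ i = \<lfloor>scl j * x' $ i\<rfloor> - \<lfloor>scl j * x $ i\<rfloor>"
          by (simp add: e_def cell_def)
        ultimately have "-1 \<le> e $ i" "e $ i \<le> 1" by linarith+
        then show ?thesis by auto
      qed
      then have "e \<in> neighbours" by (simp add: neighbours_def)
      then show ?thesis using 1 unfolding B_def by blast
    qed
  qed
  have B_le: "emeasure lborel (B j) \<le> ?c * emeasure \<nu> (N j)" for j
  proof -
    have "emeasure lborel (B j) \<le> emeasure lborel (\<Union>s\<in>{..L}. ?T j s)
       + emeasure lborel (\<Union>e\<in>neighbours. ?V j e)"
      unfolding B_def using finite_neighbours by (intro emeasure_subadditive) (auto intro!: sets.finite_UN)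
    also have "\<dots> \<le> (\<Sum>s\<in>{..L}. emeasure lborel (?T j s))
       + (\<Sum>e\<in>neighbours. emeasure lborel (?V j e))"
      using finite_neighbours by (intro add_mono emeasure_subadditive_finite) auto
    also have "\<dots> = of_nat (L + 1 + card (neighbours :: (int^'n) set)) * emeasure lborel (N j)"
      by (simp add: emeasure_translate algebra_simps)
    also have "\<dots> = ?c * (ennreal l * emeasure lborel (N j))"
      using l by (simp only: mult.assoc[symmetric] ennreal_mult[symmetric] ennreal_of_nat_eq_real_of_nat
         ennreal_mult'[symmetric]) (simp add: ennreal_mult'[symmetric])
    also have "\<dots> \<le> ?c * emeasure \<nu> (N j)" by (intro mult_left_mono N_le) auto
    finally show ?thesis .
  qed
  \<comment> \<open>Countable subadditivity is about sequences; \<open>int_decode\<close> enumerates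
    the generations.\<close>
  have "emeasure lborel {x. shifted_max m H x > ennreal (2 * l)} \<le> emeasure lborel (\<Union>i. B (int_decode i))"
  proof (rule emeasure_mono)
    show "{x. shifted_max m H x > ennreal (2 * l)} \<subseteq> (\<Union>i. B (int_decode i))"
    proof
      fix x assume "x \<in> {x. shifted_max m H x > ennreal (2 * l)}"
      then obtain j where "x \<in> B j" using cover by blast
      moreover obtain i where "j = int_decode i" using surj_int_decode by (metis surjD)
      ultimately show "x \<in> (\<Union>i. B (int_decode i))" by blast
    qed
  qed auto
  also have "\<dots> \<le> (\<Sum>i. emeasure lborel (B (int_decode i)))"
    by (rule emeasure_subadditive_countably) auto
  also have "\<dots> \<le> (\<Sum>i. ?c * emeasure \<nu> (N (int_decode i)))"
    by (intro suminf_le B_le) auto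
  also have "\<dots> = ?c * (\<Sum>i. emeasure \<nu> (N (int_decode i)))" by simp
  also have "(\<Sum>i. emeasure \<nu> (N (int_decode i))) = emeasure \<nu> (\<Union>i. N (int_decode i))"
  proof (rule suminf_emeasure)
    show "disjoint_family (\<lambda>i. N (int_decode i))"
      using N_disj unfolding disjoint_family_on_def by (simp add: inj_eq[OF inj_int_decode])
  qed auto
  also have "\<dots> \<le> emeasure \<nu> UNIV" by (intro emeasure_mono) auto
  finally show ?thesis by (simp add: \<nu>_UNIV mult_left_mono)
qed

text \<open>Marcinkiewicz interpolation: layer cake, the weak type bound at each level, Fubini, and
  layer cake again with exponent q - 1, whence q > 2. In the constant, 2^q comes from the levels 2l
  and q/(q - 1) from the second layer cake.\<close>

lemma shifted_max_strong_type_aux: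
  fixes H :: "real^'n::finite \<Rightarrow> ennreal" and m :: "int^'n"
  assumes [measurable]: "H \<in> borel_measurable borel" and q: "2 < q" and L: "\<And>i. \<bar>m $ i\<bar> \<le> 2 ^ L"
  shows "(\<integral>\<^sup>+ x. epowr q (shifted_max m H x) \<partial>lborel)
     \<le> ennreal (2 powr q * q / (q - 1) * (L + 1 + card (neighbours :: (int^'n) set))) * (\<integral>\<^sup>+ x. epowr q (H x) \<partial>lborel)"
proof -
  define A where "A = real (L + 1 + card (neighbours :: (int^'n) set))"
  define w where "w l = ennreal (2 powr q * q * l powr (q - 1)) * indicator {0<..} l" for l :: real
  have [measurable]: "w \<in> borel_measurable borel" unfolding w_def[abs_def] by measurable
  let ?i = "\<lambda>x. indicator {l. ennreal (2 * l) < shifted_max m H x} :: real \<Rightarrow> ennreal"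
  let ?j = "\<lambda>x l. w l * ennreal (A / l) * H x * indicator {l. ennreal l < H x} l"
  let ?k = "\<lambda>x l. ennreal ((q - 1) * l powr (q - 1 - 1)) * indicator {l. 0 < l \<and> ennreal l < H x} l"
  let ?c = "2 powr q * q / (q - 1) * A"
  \<comment> \<open>The layer cake formula after replacing l by 2l, to match the levels of the weak
    type bound.\<close>
  have layer: "epowr q a = (\<integral>\<^sup>+ l. w l * indicator {l. ennreal (2 * l) < a} l \<partial>lborel)" for a
  proof -
    have m: "(\<lambda>l. ennreal (q * l powr (q - 1)) * indicator {l. 0 < l \<and> ennreal l < a} l) \<in> borel_measurable borel"
      by measurable
    have "epowr q a = ennreal 2 * (\<integral>\<^sup>+ l. ennreal (q * (2 * l) powr (q - 1)) * indicator {l. 0 < l \<and> ennreal l < a} (2 * l) \<partial>lborel)"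
      using q nn_integral_real_affine[OF m, of 2 0] by (subst epowr_layer_cake) auto
    also have "\<dots> = (\<integral>\<^sup>+ l. ennreal 2 * (ennreal (q * (2 * l) powr (q - 1)) * indicator {l. 0 < l \<and> ennreal l < a} (2 * l)) \<partial>lborel)"
      by (rule nn_integral_cmult[symmetric]) measurable
    also have "\<dots> = (\<integral>\<^sup>+ l. w l * indicator {l. ennreal (2 * l) < a} l \<partial>lborel)"
    proof (rule nn_integral_cong)
      fix l :: real
      have "2 * (q * (2 * l) powr (q - 1)) = 2 powr q * q * l powr (q - 1)" if "0 < l"
        using that by (simp add: powr_mult powr_diff)
      then show "ennreal 2 * (ennreal (q * (2 * l) powr (q - 1)) * indicator {l. 0 < l \<and> ennreal l < a} (2 * l))
         = w l * indicator {l. ennreal (2 * l) < a} l"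
        using q by (cases "0 < l") (simp_all add: w_def indicator_def ennreal_mult'[symmetric] del: ennreal_numeral)
    qed
    finally show ?thesis .
  qed
  have "(\<integral>\<^sup>+ x. epowr q (shifted_max m H x) \<partial>lborel)
     = (\<integral>\<^sup>+ x. (\<integral>\<^sup>+ l. w l * ?i x l \<partial>lborel) \<partial>lborel)"
    by (simp add: layer)
  also have "\<dots> = (\<integral>\<^sup>+ l. (\<integral>\<^sup>+ x. w l * ?i x l \<partial>lborel) \<partial>lborel)"
    by (rule lborel_pair.Fubini') (measurable)
  also have "\<dots> \<le> (\<integral>\<^sup>+ l. (\<integral>\<^sup>+ x. ?j x l \<partial>lborel) \<partial>lborel)"
  proof (rule nn_integral_mono)
    fix l :: real
    show "(\<integral>\<^sup>+ x. w l * ?i x l \<partial>lborel)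
      \<le> (\<integral>\<^sup>+ x. ?j x l \<partial>lborel)"
    proof (cases "0 < l")
      case True
      have "(\<integral>\<^sup>+ x. w l * ?i x l \<partial>lborel)
         = (\<integral>\<^sup>+ x. w l * indicator {x. ennreal (2 * l) < shifted_max m H x} x \<partial>lborel)"
        by (intro nn_integral_cong) (auto simp: indicator_def)
      also have "\<dots> = w l * emeasure lborel {x. shifted_max m H x > ennreal (2 * l)}"
        by (intro nn_integral_cmult_indicator) auto
      also have "\<dots> \<le> w l * (ennreal (A / l) * (\<integral>\<^sup>+ x. H x * indicator {x. H x > ennreal l} x \<partial>lborel))"
        unfolding A_def by (intro mult_left_mono shifted_max_weak_type True L) auto
      also have "\<dots> = (\<integral>\<^sup>+ x. (w l * ennreal (A / l)) * (H x * indicator {x. H x > ennreal l} x) \<partial>lborel)"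
        by (subst nn_integral_cmult) (auto simp: mult.assoc)
      also have "\<dots> = (\<integral>\<^sup>+ x. ?j x l \<partial>lborel)"
        by (intro nn_integral_cong) (auto simp: indicator_def mult.assoc)
      finally show ?thesis .
    qed (auto simp: w_def)
  qed
  also have "\<dots> = (\<integral>\<^sup>+ x. (\<integral>\<^sup>+ l. ?j x l \<partial>lborel) \<partial>lborel)"
    by (rule lborel_pair.Fubini'[symmetric]) (measurable)
  also have "\<dots> = (\<integral>\<^sup>+ x. ennreal (?c) * epowr q (H x) \<partial>lborel)"
  proof (rule nn_integral_cong)
    fix x
    have "(\<integral>\<^sup>+ l. ?j x l \<partial>lborel)
      = (\<integral>\<^sup>+ l. (ennreal (?c) * H x) *
          (?k x l) \<partial>lborel)"
    proof (rule nn_integral_cong)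
      fix l :: real
      \<comment> \<open>The factor 1/l of the weak type bound lowers the weight to the one that
        belongs to the power q - 1; the missing power is the \<open>H x\<close> in front.\<close>
      have "2 powr q * q * l powr (q - 1) * (A / l) = (?c) * ((q - 1) * l powr (q - 1 - 1))" if "0 < l"
      proof -
        have "l powr (q - 1 - 1) = l powr (q - 1) / l" using that by (simp only: powr_diff) simp
        then show ?thesis using q that by simp
      qed
      then have "w l * ennreal (A / l) = ennreal (?c) * ennreal ((q - 1) * l powr (q - 1 - 1))" if "0 < l"
        using that q by (simp add: w_def ennreal_mult'[symmetric] A_def)
      then show "?j x l
         = (ennreal (?c) * H x) *
          (?k x l)"
        by (cases "0 < l") (simp_all add: indicator_def mult_ac, simp add: w_def)
    qed
    also have "\<dots> = ennreal (?c) * H x * epowr (q - 1) (H x)"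
    proof -
      have m: "(\<lambda>l. ?k x l) \<in> borel_measurable lborel"
        by measurable
      show ?thesis using q
        by (subst epowr_layer_cake) (simp, rule nn_integral_cmult[OF m])
    qed
    also have "\<dots> = ennreal (?c) * (H x * epowr (q - 1) (H x))"
      by (rule mult.assoc)
    also have "H x * epowr (q - 1) (H x) = epowr q (H x)"
      using q by (cases "H x") (auto simp: epowr_ennreal ennreal_mult[symmetric] powr_mult_base)
    finally show "(\<integral>\<^sup>+ l. ?j x l \<partial>lborel)
       = ennreal (?c) * epowr q (H x)" by (simp add: mult.assoc)
  qed
  also have "\<dots> = ennreal (?c) * (\<integral>\<^sup>+ x. epowr q (H x) \<partial>lborel)"
    by (rule nn_integral_cmult) measurable
  finally show ?thesis by (simp add: A_def)
qed

lemma shifted_max_strong_type: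
  fixes q :: real
  assumes q: "2 < q"
  obtains C where "0 \<le> C" "\<And>(H :: real^'n::finite \<Rightarrow> ennreal) m. H \<in> borel_measurable borel \<Longrightarrow>
    (\<integral>\<^sup>+ x. epowr q (shifted_max m H x) \<partial>lborel)
     \<le> ennreal (C * ln (exp 1 + norm (ivec m))) * (\<integral>\<^sup>+ x. epowr q (H x) \<partial>lborel)"
proof
  let ?N = "card (neighbours :: (int^'n) set)" and ?D = "2 powr q * q / (q - 1)"
  \<comment> \<open>The 4 is 2 + 2: L + 1 is at most log2(1 + |m|) + 2, and log2 is at most 2 ln
    because ln 2 >= 2/3. Since ln(e + |m|) >= 1, it absorbs the additive constants.\<close>
  let ?C = "?D * (4 + ?N)"
  show "0 \<le> ?C" using q by auto
  fix H :: "real^'n \<Rightarrow> ennreal" and m :: "int^'n"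
  assume H: "H \<in> borel_measurable borel"
  define L where "L = nat \<lceil>log 2 (1 + norm (ivec m))\<rceil>"
  have lg: "0 \<le> log 2 (1 + norm (ivec m))" by (subst zero_le_log_cancel_iff) (auto simp: add_pos_nonneg)
  have L1: "real L \<le> log 2 (1 + norm (ivec m)) + 1" and L2: "log 2 (1 + norm (ivec m)) \<le> real L"
    unfolding L_def using lg by linarith+
  have "\<bar>m $ i\<bar> \<le> 2 ^ L" for i
  proof -
    have "real_of_int \<bar>m $ i\<bar> \<le> norm (ivec m)" using component_le_norm_cart[of "ivec m" i] by (simp add: ivec_def)
    also have "\<dots> \<le> 2 powr log 2 (1 + norm (ivec m))" by (simp add: add_pos_nonneg)
    also have "\<dots> \<le> 2 powr real L" using L2 by simp
    also have "\<dots> = real_of_int (2 ^ L)" by (simp add: powr_realpow)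
    finally show ?thesis by linarith
  qed
  note * = shifted_max_strong_type_aux[OF H q this]
  have e: "1 \<le> exp (1::real)" by simp
  have ln1: "1 \<le> ln (exp 1 + norm (ivec m))" by (subst ln_ge_iff) (auto simp: add_pos_nonneg)
  have "log 2 (1 + norm (ivec m)) \<le> 2 * ln (exp 1 + norm (ivec m))"
  proof -
    have "log 2 (1 + norm (ivec m)) \<le> log 2 (exp 1 + norm (ivec m))" using e by (simp add: add_pos_nonneg)
    also have "\<dots> \<le> 2 * ln (exp 1 + norm (ivec m))"
      using ln2_ge_two_thirds ln1 by (simp add: log_def field_simps)
    finally show ?thesis .
  qed
  then have "real L + 1 + ?N \<le> (2 + ?N) * 1 + 2 * ln (exp 1 + norm (ivec m))"
    using L1 by simp
  also have "\<dots> \<le> (2 + ?N) * ln (exp 1 + norm (ivec m)) + 2 * ln (exp 1 + norm (ivec m))"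
    using ln1 by (intro add_mono mult_left_mono) auto
  finally have "real L + 1 + ?N \<le> (4 + ?N) * ln (exp 1 + norm (ivec m))"
    by (simp add: algebra_simps)
  then have "?D * (real L + 1 + ?N)
       \<le> ?D * ((4 + ?N) * ln (exp 1 + norm (ivec m)))"
    using q by (intro mult_left_mono) auto
  then have "ennreal (?D * (real L + 1 + ?N))
     \<le> ennreal (?C * ln (exp 1 + norm (ivec m)))"
    by (intro ennreal_leI) (simp add: mult.assoc)
  from order_trans[OF *[unfolded of_nat_add of_nat_1] mult_right_mono[OF this]]
  show "(\<integral>\<^sup>+ x. epowr q (shifted_max m H x) \<partial>lborel)
     \<le> ennreal (?C * ln (exp 1 + norm (ivec m))) * (\<integral>\<^sup>+ x. epowr q (H x) \<partial>lborel)"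
    by simp
qed

section \<open>Peetre's inequality\<close>

lemma weight_submult: "1 + norm (a + b) \<le> (1 + norm a) * (1 + norm (b::'a::real_normed_vector))"
  using norm_triangle_ineq[of a b] by (simp add: algebra_simps) (smt (verit) mult_nonneg_nonneg norm_ge_zero)

lemma weight_submult_diff: "1 + norm (x - z) \<le> (1 + norm (x - y)) * (1 + norm (y - (z::'a::real_normed_vector)))"
  using weight_submult[of "x - y" "y - z"] by simp

text \<open>With \<open>A\<close> the supremum of g(z) (1 + |x - z|)^-N, write g = g^r g^(1-r)
  inside the reproducing integral and bound the second factor through \<open>A\<close>. This gives A
  <= C A^(1-r) I, and A^(1-r) cancels. Cancelling needs A to be finite, which \<open>bd\<close>
  supplies; \<open>B\<close> leaves no trace in the constant.\<close>

lemma peetre_bounded: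
  fixes g K :: "'a::euclidean_space \<Rightarrow> real"
  assumes [measurable]: "g \<in> borel_measurable borel" and g0: "\<And>z. 0 \<le> g z"
    and r: "0 < r" "r < 1" and N: "0 \<le> N"
    and K: "\<And>u. K u \<le> C * (1 + norm u) powr (- N)" and C: "0 < C"
    and rep: "\<And>z. ennreal (g z) \<le> (\<integral>\<^sup>+ w. ennreal (K (z - w) * g w) \<partial>lborel)"
    and bd: "\<And>z. g z \<le> B * (1 + norm (x - z)) powr N"
  shows "ennreal (g x powr r) \<le> ennreal C * (\<integral>\<^sup>+ w. ennreal (g w powr r * (1 + norm (x - w)) powr (- N * r)) \<partial>lborel)"
    (is "_ \<le> _ * ?I")
proof (cases ?I)
  case top
  then show ?thesis using C by (simp add: ennreal_mult_top)
next
  case (real i)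
  define W where "W u = 1 + norm u" for u :: 'a
  have W: "1 \<le> W u" "0 < W u" for u by (auto simp: W_def add_pos_nonneg)
  have W_norm: "1 + norm u = W u" for u by (simp add: W_def)
  define A where "A = (SUP z. g z * W (x - z) powr (- N))"
  have bdd: "bdd_above (range (\<lambda>z. g z * W (x - z) powr (- N)))"
  proof (rule bdd_aboveI2)
    fix z show "g z * W (x - z) powr (- N) \<le> B"
      using bd[of z] W[of "x - z"] by (simp add: W_norm powr_minus field_simps)
  qed
  have A: "g z * W (x - z) powr (- N) \<le> A" for z
    unfolding A_def by (rule cSUP_upper[OF _ bdd]) auto
  have A': "g z \<le> A * W (x - z) powr N" for z
    using A[of z] W[of "x - z"] by (simp add: powr_minus field_simps)
  have A0: "0 \<le> A" using A[of x] g0[of x] by (smt (verit) mult_nonneg_nonneg powr_ge_zero)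
  have "g z * W (x - z) powr (- N) \<le> C * A powr (1 - r) * i" for z
  proof -
    have "ennreal (g z * W (x - z) powr (- N)) = ennreal (W (x - z) powr (- N)) * ennreal (g z)"
      using g0 by (simp add: ennreal_mult mult.commute)
    also have "\<dots> \<le> ennreal (W (x - z) powr (- N)) * (\<integral>\<^sup>+ w. ennreal (K (z - w) * g w) \<partial>lborel)"
      by (intro mult_left_mono rep) auto
    also have "\<dots> \<le> ennreal (W (x - z) powr (- N)) * (\<integral>\<^sup>+ w. ennreal (C * W (z - w) powr (- N) * g w) \<partial>lborel)"
      using K g0 by (intro mult_left_mono nn_integral_mono ennreal_leI mult_right_mono) (auto simp: W_def)
    also have "\<dots> = (\<integral>\<^sup>+ w. ennreal (W (x - z) powr (- N)) * ennreal (C * W (z - w) powr (- N) * g w) \<partial>lborel)"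
      unfolding W_def by (rule nn_integral_cmult[symmetric]) measurable
    also have "\<dots> \<le> (\<integral>\<^sup>+ w. ennreal (C * A powr (1 - r)) * ennreal (g w powr r * W (x - w) powr (- N * r)) \<partial>lborel)"
    proof (rule nn_integral_mono)
      fix w
      \<comment> \<open>Submultiplicativity of the weight replaces the running centre z by the fixed
        centre x.\<close>
      have "W (x - z) powr (- N) * W (z - w) powr (- N) = (W (x - z) * W (z - w)) powr (- N)"
        using W by (simp add: powr_mult less_imp_le)
      also have "\<dots> \<le> W (x - w) powr (- N)"
        using N W weight_submult_diff[of x w z] by (intro powr_mono2') (auto simp: W_def)
      finally have 1: "W (x - z) powr (- N) * W (z - w) powr (- N) \<le> W (x - w) powr (- N)" .
      have "g w = g w powr r * g w powr (1 - r)"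
        using g0[of w] by (simp add: powr_add[symmetric])
      also have "\<dots> \<le> g w powr r * (A * W (x - w) powr N) powr (1 - r)"
        using g0[of w] A'[of w] r by (intro mult_left_mono powr_mono2) auto
      also have "\<dots> = g w powr r * A powr (1 - r) * W (x - w) powr (N * (1 - r))"
        using A0 W[of "x - w"] by (simp add: powr_mult powr_powr)
      finally have 2: "g w \<le> g w powr r * A powr (1 - r) * W (x - w) powr (N * (1 - r))" .
      have "W (x - z) powr (- N) * (C * W (z - w) powr (- N) * g w)
         = C * ((W (x - z) powr (- N) * W (z - w) powr (- N)) * g w)" by simp
      also have "\<dots> \<le> C * (W (x - w) powr (- N) * (g w powr r * A powr (1 - r) * W (x - w) powr (N * (1 - r))))"
        using C 1 2 g0 by (intro mult_left_mono mult_mono) auto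
      also have "\<dots> = C * A powr (1 - r) * (g w powr r * (W (x - w) powr (- N) * W (x - w) powr (N * (1 - r))))"
        by simp
      also have "W (x - w) powr (- N) * W (x - w) powr (N * (1 - r)) = W (x - w) powr (- N * r)"
        by (simp add: powr_add[symmetric] algebra_simps)
      finally have "W (x - z) powr (- N) * (C * W (z - w) powr (- N) * g w)
         \<le> C * A powr (1 - r) * (g w powr r * W (x - w) powr (- N * r))" .
      from ennreal_leI[OF this]
      show "ennreal (W (x - z) powr (- N)) * ennreal (C * W (z - w) powr (- N) * g w)
         \<le> ennreal (C * A powr (1 - r)) * ennreal (g w powr r * W (x - w) powr (- N * r))"
        using C by (simp add: ennreal_mult'[symmetric])
    qed
    also have "\<dots> = ennreal (C * A powr (1 - r)) * ?I"
      unfolding W_def by (rule nn_integral_cmult) measurable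
    finally show ?thesis
      using real C by (simp add: ennreal_mult'[symmetric])
  qed
  then have A_le: "A \<le> C * A powr (1 - r) * i" unfolding A_def by (intro cSUP_least) auto
  have "A powr r \<le> C * i"
  proof (cases "A = 0")
    case False
    then have "A powr r * A powr (1 - r) \<le> C * i * A powr (1 - r)"
      using A_le A0 by (simp add: powr_add[symmetric] mult_ac)
    then show ?thesis using False A0 by (simp add: mult_le_cancel_right)
  qed (use C real in auto)
  moreover have "g x powr r \<le> A powr r"
    using A'[of x] g0[of x] r by (intro powr_mono2) (auto simp: W_def)
  ultimately show ?thesis using real C by (simp add: ennreal_mult'[symmetric] ennreal_leI)
qed

text \<open>The growth bound on \<open>g\<close> makes the supremum in the previous proof finite for large exponents only.
  A first pass with such an exponent makes it finite for the given \<open>N\<close>, and a second pass then gives a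
  constant that does not depend on \<open>g\<close>.\<close>

lemma peetre:
  fixes K :: "'a::euclidean_space \<Rightarrow> real"
  assumes r: "0 < r" "r < 1" and N: "0 \<le> N"
    and K: "\<And>N. 0 \<le> N \<Longrightarrow> \<exists>C. \<forall>u. K u \<le> C * (1 + norm u) powr (- N)"
  obtains C where "0 < C" "\<And>g x. g \<in> borel_measurable borel \<Longrightarrow> (\<And>z. 0 \<le> g z) \<Longrightarrow>
     (\<And>z. ennreal (g z) \<le> (\<integral>\<^sup>+ w. ennreal (K (z - w) * g w) \<partial>lborel)) \<Longrightarrow>
     (\<exists>B M. \<forall>z. g z \<le> B * (1 + norm z) powr M) \<Longrightarrow>
     ennreal (g x powr r) \<le> ennreal C * (\<integral>\<^sup>+ w. ennreal (g w powr r * (1 + norm (x - w)) powr (- N * r)) \<partial>lborel)"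
proof -
  have K': "\<exists>C>0. \<forall>u. K u \<le> C * (1 + norm u) powr (- N)" if n: "0 \<le> N" for N
  proof -
    obtain C where C: "\<And>u. K u \<le> C * (1 + norm u) powr (- N)" using K[OF n] by blast
    have "K u \<le> (\<bar>C\<bar> + 1) * (1 + norm u) powr (- N)" for u
      using C[of u] by (smt (verit) mult_right_mono powr_ge_zero)
    then show ?thesis by (intro exI[of _ "\<bar>C\<bar> + 1"]) auto
  qed
  obtain C where C: "0 < C" "\<And>u. K u \<le> C * (1 + norm u) powr (- N)" using K'[OF N] by blast
  show ?thesis
  proof
    show "0 < C" by fact
    fix g :: "'a \<Rightarrow> real" and x
    assume g [measurable]: "g \<in> borel_measurable borel" and g0: "\<And>z. 0 \<le> g z"
      and rep: "\<And>z. ennreal (g z) \<le> (\<integral>\<^sup>+ w. ennreal (K (z - w) * g w) \<partial>lborel)"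
      and bd: "\<exists>B M. \<forall>z. g z \<le> B * (1 + norm z) powr M"
    obtain B M where BM: "\<And>z. g z \<le> B * (1 + norm z) powr M" using bd by blast
    let ?k = "\<lambda>z w. ennreal (g w powr r * (1 + norm (z - w)) powr (- N * r))"
    define N1 where "N1 = max N M"
    have N1: "0 \<le> N1" "N \<le> N1" using N by (auto simp: N1_def)
    obtain C1 where C1: "0 < C1" "\<And>u. K u \<le> C1 * (1 + norm u) powr (- N1)" using K'[OF N1(1)] by blast
    have W: "1 \<le> 1 + norm u" "0 < 1 + norm u" for u :: 'a by (auto simp: add_pos_nonneg)
    \<comment> \<open>The constant may depend on \<open>y\<close>: only the finiteness of the
      supremum centred at \<open>y\<close> is at stake.\<close>
    have bd1: "g z \<le> (\<bar>B\<bar> * (1 + norm y) powr N1) * (1 + norm (y - z)) powr N1" for y z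
    proof -
      have "g z \<le> B * (1 + norm z) powr M" by (rule BM)
      also have "\<dots> \<le> \<bar>B\<bar> * (1 + norm z) powr N1"
        using W by (intro mult_mono powr_mono) (auto simp: N1_def)
      also have "\<dots> \<le> \<bar>B\<bar> * ((1 + norm y) * (1 + norm (y - z))) powr N1"
        using W N1 weight_submult_diff[of 0 z y] by (intro mult_left_mono powr_mono2) (auto simp: norm_minus_commute)
      finally show ?thesis by (simp add: powr_mult mult.assoc)
    qed
    have first: "ennreal (g z powr r) \<le> ennreal C1 * (\<integral>\<^sup>+ w. ?k z w \<partial>lborel)" for z
    proof -
      have "ennreal (g z powr r) \<le> ennreal C1 * (\<integral>\<^sup>+ w. ennreal (g w powr r * (1 + norm (z - w)) powr (- N1 * r)) \<partial>lborel)"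
        by (rule peetre_bounded[OF g g0 r N1(1) C1(2) C1(1) rep bd1])
      also have "\<dots> \<le> ennreal C1 * (\<integral>\<^sup>+ w. ?k z w \<partial>lborel)"
        using N1 r by (intro mult_left_mono nn_integral_mono ennreal_leI powr_mono) (auto intro: mult_right_mono)
      finally show ?thesis .
    qed
    let ?I = "\<integral>\<^sup>+ w. ?k x w \<partial>lborel"
    show "ennreal (g x powr r) \<le> ennreal C * ?I"
    proof (cases ?I)
      case top
      then show ?thesis using C by (simp add: ennreal_mult_top)
    next
      case (real i)
      \<comment> \<open>Moving the centre from x to z costs only (1 + |x - z|)^(N r). So once the
        average at \<open>x\<close> is finite, \<open>first\<close> bounds g by a multiple of (1 +
        |x - z|)^N, which is the growth hypothesis of \<open>peetre_bounded\<close> for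
        \<open>N\<close> itself.\<close>
      have "g z \<le> ((C1 * i) powr (1 / r)) * (1 + norm (x - z)) powr N" for z
      proof -
        have "ennreal (g z powr r) \<le> ennreal C1 * (\<integral>\<^sup>+ w. ?k z w \<partial>lborel)"
          by (rule first)
        also have "\<dots> \<le> ennreal C1 * (\<integral>\<^sup>+ w. ennreal ((1 + norm (x - z)) powr (N * r)) *
            ?k x w \<partial>lborel)"
        proof (intro mult_left_mono nn_integral_mono)
          fix w
          have "(1 + norm (x - w)) powr (N * r) \<le> ((1 + norm (x - z)) * (1 + norm (z - w))) powr (N * r)"
            using N r W by (intro powr_mono2 weight_submult_diff) auto
          also have "\<dots> = (1 + norm (x - z)) powr (N * r) * (1 + norm (z - w)) powr (N * r)"
            by (rule powr_mult)
          finally have "(1 + norm (z - w)) powr (- N * r) \<le> (1 + norm (x - z)) powr (N * r) * (1 + norm (x - w)) powr (- N * r)"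
            using W[of "x-z"] W[of "x-w"] W[of "z-w"] by (simp add: powr_minus field_simps)
          then have "g w powr r * (1 + norm (z - w)) powr (- N * r)
             \<le> g w powr r * ((1 + norm (x - z)) powr (N * r) * (1 + norm (x - w)) powr (- N * r))"
            by (rule mult_left_mono) auto
          then have "g w powr r * (1 + norm (z - w)) powr (- N * r)
             \<le> (1 + norm (x - z)) powr (N * r) * (g w powr r * (1 + norm (x - w)) powr (- N * r))"
            by (simp add: mult_ac)
          from ennreal_leI[OF this]
          show "?k z w
             \<le> ennreal ((1 + norm (x - z)) powr (N * r)) * ?k x w"
            by (simp add: ennreal_mult'[symmetric])
        qed auto
        also have "\<dots> = ennreal C1 * (ennreal ((1 + norm (x - z)) powr (N * r)) * ?I)"
          by (subst nn_integral_cmult) auto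
        also have "\<dots> = ennreal (C1 * i * (1 + norm (x - z)) powr (N * r))"
          using real C1 by (simp add: ennreal_mult'[symmetric] mult_ac)
        finally have "g z powr r \<le> C1 * i * (1 + norm (x - z)) powr (N * r)"
          using C1 real by simp
        then have "(g z powr r) powr (1 / r) \<le> (C1 * i * (1 + norm (x - z)) powr (N * r)) powr (1 / r)"
          using r by (intro powr_mono2) auto
        then show ?thesis using r g0[of z] real C1 by (simp add: powr_powr powr_mult)
      qed
      from peetre_bounded[OF g g0 r N C(2) C(1) rep this]
      show ?thesis .
    qed
  qed
qed

section \<open>Schwartz functions and tempered distributions\<close>

lemma schwartz_cont: "f \<in> schwartz \<Longrightarrow> continuous_on UNIV (pderivs is f)"
  by (simp add: schwartz_def)

lemma schwartz_measurable: "f \<in> schwartz \<Longrightarrow> pderivs is f \<in> borel_measurable borel"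
  by (intro borel_measurable_continuous_onI schwartz_cont)

lemma schwartz_measurable0: "f \<in> schwartz \<Longrightarrow> f \<in> borel_measurable borel"
  using schwartz_measurable[of f "[]"] by simp

lemma schwartz_bounded:
  assumes "f \<in> schwartz"
  obtains B where "0 \<le> B" "\<And>x. (1 + norm x) ^ m * norm (pderivs is f x) \<le> B"
proof -
  have "bounded (range (\<lambda>x. (1 + norm x) ^ m * norm (pderivs is f x)))"
    using assms by (simp add: schwartz_def)
  then obtain B where "\<And>x. norm ((1 + norm x) ^ m * norm (pderivs is f x)) \<le> B" by (auto simp: bounded_iff)
  then have "\<And>x. (1 + norm x) ^ m * norm (pderivs is f x) \<le> B" by (simp add: abs_mult)
  moreover from this[of 0] have "norm (pderivs is f 0) \<le> B" by simp
  then have "0 \<le> B" by (rule order_trans[OF norm_ge_zero])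
  ultimately show ?thesis using that by blast
qed

lemma schwartz_bounded_all:
  assumes "f \<in> (schwartz :: ('n::finite) cfun set)"
  obtains B where "0 \<le> B" "\<And>x is. length is \<le> N \<Longrightarrow> (1 + norm x) ^ m * norm (pderivs is f x) \<le> B"
proof -
  let ?S = "{is :: 'n list. set is \<subseteq> UNIV \<and> length is \<le> N}"
  have fin: "finite ?S" by (rule finite_lists_length_le) simp
  have "\<forall>is. \<exists>B. 0 \<le> B \<and> (\<forall>x. (1 + norm x) ^ m * norm (pderivs is f x) \<le> B)"
    using schwartz_bounded[OF assms] by metis
  then obtain B where B: "\<And>is. 0 \<le> B is" "\<And>is x. (1 + norm x) ^ m * norm (pderivs is f x) \<le> B is" by metis
  show ?thesis
  proof (rule that[of "\<Sum>is\<in>?S. B is"])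
    fix x and "is" :: "'n list" assume "length is \<le> N"
    then have "B is \<le> (\<Sum>is\<in>?S. B is)" using B(1) fin by (intro member_le_sum) auto
    then show "(1 + norm x) ^ m * norm (pderivs is f x) \<le> (\<Sum>is\<in>?S. B is)" using B(2) order_trans by blast
  qed (use B in \<open>auto intro: sum_nonneg\<close>)
qed

lemma schwartz_decay:
  assumes "f \<in> schwartz"
  obtains C where "0 \<le> C" "\<And>x. norm (pderivs is f x) \<le> C * (1 + norm x) powr (- N)"
proof -
  obtain B where B: "0 \<le> B" "\<And>x. (1 + norm x) ^ nat \<lceil>N\<rceil> * norm (pderivs is f x) \<le> B"
    using schwartz_bounded[OF assms] by blast
  have "norm (pderivs is f x) \<le> B * (1 + norm x) powr (- N)" for x
  proof -
    have "(1 + norm x) powr N \<le> (1 + norm x) powr real (nat \<lceil>N\<rceil>)"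
      by (intro powr_mono) (auto simp: real_nat_ceiling_ge)
    also have "\<dots> = (1 + norm x) ^ nat \<lceil>N\<rceil>" by (rule powr_realpow) (simp add: add_pos_nonneg)
    finally have "(1 + norm x) powr N * norm (pderivs is f x) \<le> B"
      using B(2)[of x] by (meson mult_right_mono norm_ge_zero order_trans)
    moreover have "0 < (1 + norm x) powr N"
      using add_pos_nonneg[OF zero_less_one norm_ge_zero, of x] by (metis less_irrefl powr_gt_zero)
    ultimately show ?thesis by (simp add: powr_minus field_simps)
  qed
  then show ?thesis using that B by blast
qed

lemma integrable_bound_weight:
  fixes f :: "'a::euclidean_space \<Rightarrow> 'b::{banach, second_countable_topology}"
  assumes [measurable]: "f \<in> borel_measurable borel"
    and f: "\<And>x. norm (f x) \<le> C * (1 + norm x) powr (- real (2 * DIM('a)))"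
  shows "integrable lborel f"
proof (rule Bochner_Integration.integrable_bound)
  show "integrable lborel (\<lambda>x::'a. C * (1 + norm x) powr (- real (2 * DIM('a))))"
  proof (rule integrable_mult_right)
    show "integrable lborel (\<lambda>x::'a. (1 + norm x) powr (- real (2 * DIM('a))))"
      using nn_integral_weight_finite[where 'a='a, of "2 * DIM('a)"] by (auto simp: integrable_iff_bounded)
  qed
  show "AE x in lborel. norm (f x) \<le> norm (C * (1 + norm x) powr (- real (2 * DIM('a))))"
    by (intro AE_I2 order_trans[OF f]) (simp only: real_norm_def abs_ge_self)
qed auto

lemma schwartz_integrable_weight:
  fixes f :: "'n::finite cfun"
  assumes "f \<in> schwartz"
  shows "integrable lborel (\<lambda>x. norm (pderivs is f x) * (1 + norm x) ^ m)"
proof -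
  have [measurable]: "pderivs is f \<in> borel_measurable borel" by (rule schwartz_measurable[OF assms])
  obtain C where C: "0 \<le> C" "\<And>x. norm (pderivs is f x) \<le> C * (1 + norm x) powr (- real (2 * DIM(real^'n) + m))"
    using schwartz_decay[OF assms] by blast
  show ?thesis
  proof (rule integrable_bound_weight)
    fix x :: "real^'n"
    have p: "(1 + norm x) ^ m = (1 + norm x) powr real m"
      by (rule powr_realpow[symmetric]) (simp add: add_pos_nonneg)
    have "norm (pderivs is f x) * (1 + norm x) ^ m \<le> C * (1 + norm x) powr (- real (2 * DIM(real^'n) + m)) * (1 + norm x) ^ m"
      by (intro mult_right_mono C) auto
    also have "\<dots> = C * (1 + norm x) powr (- real (2 * DIM(real^'n)))"
      by (simp only: p mult.assoc powr_add[symmetric]) simp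
    finally show "norm (norm (pderivs is f x) * (1 + norm x) ^ m) \<le> C * (1 + norm x) powr (- real (2 * DIM(real^'n)))"
      by simp
  qed measurable
qed

lemma schwartz_integrable: "f \<in> schwartz \<Longrightarrow> integrable lborel (pderivs is f)"
  using schwartz_integrable_weight[of f "is" 0] schwartz_measurable[of f "is"]
  by (simp add: integrable_norm_iff)

lemma schwartz_integrable0: "f \<in> schwartz \<Longrightarrow> integrable lborel f"
  using schwartz_integrable[of f "[]"] by simp

text \<open>The definition of \<open>schwartz\<close> speaks of the parameter 0 only; moving the
  base point along the line gives the derivative at every \<open>s\<close>.\<close>

lemma schwartz_partial_line:
  assumes "f \<in> schwartz"
  shows "((\<lambda>t. pderivs is f (x + t *\<^sub>R axis i 1)) has_vector_derivative pderivs (i # is) f (x + s *\<^sub>R axis i 1)) (at s)"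
proof -
  have "(\<lambda>t. pderivs is f ((x + s *\<^sub>R axis i 1) + t *\<^sub>R axis i 1)) differentiable (at 0)"
    using assms by (simp add: schwartz_def)
  then have "((\<lambda>t. pderivs is f ((x + s *\<^sub>R axis i 1) + t *\<^sub>R axis i 1)) has_vector_derivative
      pderivs (i # is) f (x + s *\<^sub>R axis i 1)) (at (s - s))"
    by (simp add: partial_def vector_derivative_works)
  moreover have "((\<lambda>t. t - s) has_vector_derivative 1) (at s)"
    by (auto intro!: derivative_eq_intros simp: has_real_derivative_iff_has_vector_derivative[symmetric])
  ultimately have "((\<lambda>t. pderivs is f ((x + s *\<^sub>R axis i 1) + t *\<^sub>R axis i 1)) \<circ> (\<lambda>t. t - s) has_vector_derivative
      1 *\<^sub>R pderivs (i # is) f (x + s *\<^sub>R axis i 1)) (at s)"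
    by (intro vector_diff_chain_at)
  moreover have "(\<lambda>t. pderivs is f ((x + s *\<^sub>R axis i 1) + t *\<^sub>R axis i 1)) \<circ> (\<lambda>t. t - s)
     = (\<lambda>t. pderivs is f (x + t *\<^sub>R axis i 1))"
    by (simp add: fun_eq_iff algebra_simps)
  ultimately show ?thesis by simp
qed

lemma pderivs_affine_step:
  assumes "f \<in> schwartz"
  shows "((\<lambda>t. a * of_real (c ^ length is) * pderivs is f (c *\<^sub>R (x + t *\<^sub>R axis i 1) + b))
      has_vector_derivative a * of_real (c ^ length (i # is)) * pderivs (i # is) f (c *\<^sub>R x + b)) (at 0)"
proof -
  have 1: "((\<lambda>t::real. c * t) has_vector_derivative c) (at 0)"
    by (auto intro!: derivative_eq_intros simp: has_real_derivative_iff_has_vector_derivative[symmetric])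
  have "((\<lambda>t. pderivs is f ((c *\<^sub>R x + b) + t *\<^sub>R axis i 1)) has_vector_derivative
    pderivs (i # is) f ((c *\<^sub>R x + b) + 0 *\<^sub>R axis i 1)) (at 0)"
    by (rule schwartz_partial_line[OF assms])
  then have "((\<lambda>t. pderivs is f ((c *\<^sub>R x + b) + t *\<^sub>R axis i 1)) has_vector_derivative
    pderivs (i # is) f (c *\<^sub>R x + b)) (at (c * 0))" by simp
  from vector_diff_chain_at[OF 1 this]
  have "((\<lambda>t. pderivs is f (c *\<^sub>R (x + t *\<^sub>R axis i 1) + b)) has_vector_derivative
    c *\<^sub>R pderivs (i # is) f (c *\<^sub>R x + b)) (at 0)" by (simp add: o_def algebra_simps)
  from has_vector_derivative_mult_right[OF this, of "a * of_real (c ^ length is)"]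
  show ?thesis by (simp add: scaleR_conv_of_real mult_ac)
qed

lemma pderivs_affine:
  assumes "f \<in> schwartz"
  shows "pderivs is (\<lambda>x. a * f (c *\<^sub>R x + b)) x = a * of_real (c ^ length is) * pderivs is f (c *\<^sub>R x + b)
     \<and> (\<lambda>t. pderivs is (\<lambda>x. a * f (c *\<^sub>R x + b)) (x + t *\<^sub>R axis i 1)) differentiable (at 0)"
proof (induction "is" arbitrary: x i)
  case Nil
  show ?case using differentiableI_vector[OF pderivs_affine_step[OF assms, of a c "[]" x i b]] by simp
next
  case (Cons j "is")
  have eq: "pderivs is (\<lambda>x. a * f (c *\<^sub>R x + b)) = (\<lambda>x. a * of_real (c ^ length is) * pderivs is f (c *\<^sub>R x + b))"
    using Cons by blast
  have eq2: "pderivs (j # is) (\<lambda>x. a * f (c *\<^sub>R x + b)) x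
     = a * of_real (c ^ length (j # is)) * pderivs (j # is) f (c *\<^sub>R x + b)" for x
  proof -
    have "pderivs (j # is) (\<lambda>x. a * f (c *\<^sub>R x + b)) x
       = vector_derivative (\<lambda>t. pderivs is (\<lambda>x. a * f (c *\<^sub>R x + b)) (x + t *\<^sub>R axis j 1)) (at 0)"
      by (simp only: pderivs.simps partial_def)
    also have "\<dots> = a * of_real (c ^ length (j # is)) * pderivs (j # is) f (c *\<^sub>R x + b)"
      unfolding eq by (rule vector_derivative_at[OF pderivs_affine_step[OF assms]])
    finally show ?thesis .
  qed
  show ?case unfolding eq2 using differentiableI_vector[OF pderivs_affine_step[OF assms, of a c "j # is" x i b]] by blast
qed

lemma schwartz_affine:
  fixes f :: "'n::finite cfun"
  assumes f: "f \<in> schwartz" and c: "c \<noteq> 0"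
  shows "(\<lambda>x. a * f (c *\<^sub>R x + b)) \<in> schwartz"
proof -
  let ?g = "\<lambda>x. a * f (c *\<^sub>R x + b)"
  have eq: "pderivs is ?g = (\<lambda>x. a * of_real (c ^ length is) * pderivs is f (c *\<^sub>R x + b))" for "is"
    using pderivs_affine[OF f] by blast
  have "continuous_on UNIV (pderivs is ?g)" for "is"
    unfolding eq by (intro continuous_intros continuous_on_compose2[OF schwartz_cont[OF f]]) auto
  moreover have "bounded (range (\<lambda>x. (1 + norm x) ^ m * norm (pderivs is ?g x)))" for "is" and m :: nat
  proof -
    obtain B where B: "0 \<le> B" "\<And>x. (1 + norm x) ^ m * norm (pderivs is f x) \<le> B"
      using schwartz_bounded[OF f] by blast
    \<comment> \<open>Solving for x costs 1/|c|, and removing b costs 1 + |b|.\<close>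
    define A where "A = (1 + 1 / \<bar>c\<bar>) * (1 + norm b)"
    have A: "1 + norm x \<le> A * (1 + norm (c *\<^sub>R x + b))" for x
    proof -
      have "norm (c *\<^sub>R x) \<le> norm (c *\<^sub>R x + b) + norm b" using norm_triangle_ineq4[of "c *\<^sub>R x + b" b] by simp
      then have "norm x \<le> (1 / \<bar>c\<bar>) * (norm (c *\<^sub>R x + b) + norm b)" using c by (simp add: field_simps)
      also have "\<dots> \<le> (1 / \<bar>c\<bar>) * ((1 + norm (c *\<^sub>R x + b)) * (1 + norm b))"
        by (intro mult_left_mono) (auto simp: algebra_simps)
      finally have "1 + norm x \<le> (1 + norm (c *\<^sub>R x + b)) * (1 + norm b) + (1 / \<bar>c\<bar>) * ((1 + norm (c *\<^sub>R x + b)) * (1 + norm b))"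
        using mult_mono[of 1 "1 + norm (c *\<^sub>R x + b)" 1 "1 + norm b"] by simp
      then show ?thesis by (simp add: A_def algebra_simps add_divide_distrib)
    qed
    have "(1 + norm x) ^ m * norm (pderivs is ?g x) \<le> A ^ m * (norm a * \<bar>c\<bar> ^ length is) * B" for x
    proof -
      have "(1 + norm x) ^ m * norm (pderivs is ?g x)
         \<le> (A * (1 + norm (c *\<^sub>R x + b))) ^ m * (norm a * \<bar>c\<bar> ^ length is * norm (pderivs is f (c *\<^sub>R x + b)))"
        unfolding eq by (intro mult_mono power_mono A) (auto simp: norm_mult norm_power A_def)
      also have "\<dots> = A ^ m * (norm a * \<bar>c\<bar> ^ length is) * ((1 + norm (c *\<^sub>R x + b)) ^ m * norm (pderivs is f (c *\<^sub>R x + b)))"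
        by (simp add: power_mult_distrib)
      also have "\<dots> \<le> A ^ m * (norm a * \<bar>c\<bar> ^ length is) * B"
        by (intro mult_left_mono B) (auto simp: A_def)
      finally show ?thesis .
    qed
    then show ?thesis unfolding bounded_iff
      by (intro exI[of _ "A ^ m * (norm a * \<bar>c\<bar> ^ length is) * B"]) (auto simp: abs_mult)
  qed
  ultimately show ?thesis using pderivs_affine[OF f] unfolding schwartz_def by blast
qed

lemma pderivs_lincomb:
  assumes "f \<in> schwartz" "g \<in> schwartz"
  shows "pderivs is (\<lambda>x. a * f x + b * g x) = (\<lambda>x. a * pderivs is f x + b * pderivs is g x)"
proof (induction "is")
  case (Cons i "is")
  have "vector_derivative (\<lambda>t. a * pderivs is f (x + t *\<^sub>R axis i 1) + b * pderivs is g (x + t *\<^sub>R axis i 1)) (at 0)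
     = a * pderivs (i # is) f x + b * pderivs (i # is) g x" for x
    using schwartz_partial_line[OF assms(1), of "is" x i 0] schwartz_partial_line[OF assms(2), of "is" x i 0]
    by (intro vector_derivative_at has_vector_derivative_add has_vector_derivative_mult_right) auto
  then show ?case by (simp only: pderivs.simps partial_def Cons fun_eq_iff) simp
qed simp

lemma schwartz_lincomb:
  assumes f: "f \<in> schwartz" and g: "g \<in> schwartz"
  shows "(\<lambda>x. a * f x + b * g x) \<in> schwartz"
proof -
  have "continuous_on UNIV (pderivs is (\<lambda>x. a * f x + b * g x))" for "is"
    unfolding pderivs_lincomb[OF f g] by (intro continuous_intros schwartz_cont f g)
  moreover have "(\<lambda>t. pderivs is (\<lambda>x. a * f x + b * g x) (x + t *\<^sub>R axis i 1)) differentiable (at 0)" for "is" x i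
    unfolding pderivs_lincomb[OF f g] using schwartz_partial_line[OF f, of "is" x i 0] schwartz_partial_line[OF g, of "is" x i 0]
    by (intro derivative_intros differentiableI_vector) auto
  moreover have "bounded (range (\<lambda>x. (1 + norm x) ^ m * norm (pderivs is (\<lambda>x. a * f x + b * g x) x)))" for "is" and m :: nat
  proof -
    obtain B where B: "0 \<le> B" "\<And>x. (1 + norm x) ^ m * norm (pderivs is f x) \<le> B"
      using schwartz_bounded[OF f] by blast
    obtain D where D: "0 \<le> D" "\<And>x. (1 + norm x) ^ m * norm (pderivs is g x) \<le> D"
      using schwartz_bounded[OF g] by blast
    have "(1 + norm x) ^ m * norm (pderivs is (\<lambda>x. a * f x + b * g x) x) \<le> norm a * B + norm b * D" for x
    proof -
      have "(1 + norm x) ^ m * norm (pderivs is (\<lambda>x. a * f x + b * g x) x)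
        \<le> (1 + norm x) ^ m * (norm a * norm (pderivs is f x) + norm b * norm (pderivs is g x))"
        unfolding pderivs_lincomb[OF f g]
        by (intro mult_left_mono) (auto simp: norm_mult intro: order_trans[OF norm_triangle_ineq])
      also have "\<dots> = norm a * ((1 + norm x) ^ m * norm (pderivs is f x)) + norm b * ((1 + norm x) ^ m * norm (pderivs is g x))"
        by (simp add: algebra_simps)
      also have "\<dots> \<le> norm a * B + norm b * D" by (intro add_mono mult_left_mono B D) auto
      finally show ?thesis .
    qed
    then show ?thesis unfolding bounded_iff by (intro exI[of _ "norm a * B + norm b * D"]) (auto simp: abs_mult)
  qed
  ultimately show ?thesis unfolding schwartz_def by blast
qed

text \<open>\<open>tempered\<close> states linearity for two summands; the Riemann sums of
  \<open>tempered_conv_commute\<close> need it for finitely many, together with their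
  derivatives.\<close>

lemma schwartz_sum:
  fixes u :: "'n::finite cfun \<Rightarrow> complex"
  assumes "finite S" "S \<noteq> {}" "\<And>v. v \<in> S \<Longrightarrow> F v \<in> schwartz"
  shows "(\<lambda>x. \<Sum>v\<in>S. c v * F v x) \<in> schwartz \<and>
    pderivs is (\<lambda>x. \<Sum>v\<in>S. c v * F v x) = (\<lambda>x. \<Sum>v\<in>S. c v * pderivs is (F v) x) \<and>
    (u \<in> tempered \<longrightarrow> u (\<lambda>x. \<Sum>v\<in>S. c v * F v x) = (\<Sum>v\<in>S. c v * u (F v)))"
  using assms
proof (induction rule: finite_ne_induct)
  case (singleton v)
  then have F: "F v \<in> schwartz" by simp
  then have "u (F v) = c * u (F v)" if "False" for c using that by blast
  \<comment> \<open>A single term is padded by 0 times itself to fit the two-term form of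
    linearity.\<close>
  have "u (\<lambda>x. c v * F v x + 0 * F v x) = c v * u (F v) + 0 * u (F v)" if "u \<in> tempered"
    using that F unfolding tempered_def by blast
  then show ?case using schwartz_lincomb[OF F F, of "c v" 0] pderivs_lincomb[OF F F, of "is" "c v" 0] by simp
next
  case (insert v S)
  define G where "G = (\<lambda>x. \<Sum>v\<in>S. c v * F v x)"
  have F: "F v \<in> schwartz" and G: "G \<in> schwartz" using insert by (auto simp: G_def)
  have "u (\<lambda>x. c v * F v x + 1 * G x) = c v * u (F v) + 1 * u G" if "u \<in> tempered"
    using that F G unfolding tempered_def by blast
  moreover have "(\<lambda>x. \<Sum>v\<in>insert v S. c v * F v x) = (\<lambda>x. c v * F v x + 1 * G x)"
    using insert by (simp add: G_def)
  ultimately show ?case using schwartz_lincomb[OF F G, of "c v" 1] pderivs_lincomb[OF F G, of "is" "c v" 1] insert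
    by (simp add: G_def)
qed

text \<open>Continuity in a form that accepts any uniform bound \<open>B\<close> in place of the
  supremum in \<open>sch_seminorm\<close>, so that boundedness of the set under that supremum is
  settled once.\<close>

lemma tempered_bound:
  fixes u :: "'n::finite cfun \<Rightarrow> complex"
  assumes "u \<in> tempered"
  obtains C N where "0 \<le> C" "\<And>f B. f \<in> schwartz \<Longrightarrow>
     (\<And>is x. length is \<le> N \<Longrightarrow> (1 + norm x) ^ N * norm (pderivs is f x) \<le> B) \<Longrightarrow> norm (u f) \<le> C * B"
proof -
  obtain C N where CN: "\<And>f. f \<in> schwartz \<Longrightarrow> norm (u f) \<le> C * sch_seminorm N f"
    using assms unfolding tempered_def by blast
  show ?thesis
  proof (rule that[of "\<bar>C\<bar>" N])
    fix f :: "'n cfun" and B assume f: "f \<in> schwartz"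
      and B: "\<And>is x. length is \<le> N \<Longrightarrow> (1 + norm x) ^ N * norm (pderivs is f x) \<le> B"
    let ?F = "\<lambda>(x, is). (1 + norm x) ^ N * norm (pderivs is f x)"
    let ?S = "UNIV \<times> {is. length is \<le> N}"
    have le: "sch_seminorm N f \<le> B" unfolding sch_seminorm_def
      using B by (intro cSUP_least) (auto intro: exI[of _ "[]"])
    have "0 \<le> ?F (0, [])" by simp
    also have "\<dots> \<le> sch_seminorm N f" unfolding sch_seminorm_def
      using B by (intro cSUP_upper bdd_aboveI2[of _ _ B]) auto
    finally have "C * sch_seminorm N f \<le> \<bar>C\<bar> * B" using le by (intro mult_mono) auto
    then show "norm (u f) \<le> \<bar>C\<bar> * B" using CN[OF f] by linarith
  qed auto
qed

lemma weight_shift_le: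
  fixes s v :: "'a::real_normed_vector"
  assumes "norm v \<le> 1"
  shows "1 + norm s \<le> 2 * (1 + norm (s + v))"
  using norm_triangle_ineq4[of "s + v" v] assms norm_ge_zero[of "s + v"]
  unfolding add_diff_cancel_right' distrib_left by linarith

text \<open>On a large ball this is uniform continuity. Outside it, one more power of decay than the
  weight asks for makes the two terms small separately.\<close>

lemma schwartz_translation_one:
  assumes f: "f \<in> schwartz" and e: "0 < e"
  shows "\<exists>d>0. \<forall>v s. norm v \<le> d \<longrightarrow> (1 + norm s) ^ N * norm (pderivs is f (s + v) - pderivs is f s) \<le> e"
proof -
  let ?G = "pderivs is f"
  obtain B where B: "0 \<le> B" "\<And>x. (1 + norm x) ^ Suc N * norm (?G x) \<le> B"
    using schwartz_bounded[OF f] by blast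
  \<comment> \<open>Outside the ball of radius \<open>R\<close> the weighted terms are at most
    2^(N+1) B/(1+|s|) and B/(1+|s|), where the power of 2 comes from |v| <= 1; \<open>R\<close>
    makes their sum at most \<open>e\<close>.\<close>
  define R where "R = (2 ^ Suc N + 1) * B / e"
  have R: "0 \<le> R" using B e by (simp add: R_def)
  have "uniformly_continuous_on (cball 0 (R + 1)) ?G"
    by (intro compact_uniformly_continuous continuous_on_subset[OF schwartz_cont[OF f]]) auto
  moreover have "0 < e / (1 + R) ^ N" using e R by simp
  ultimately obtain d where d: "0 < d"
    "\<And>x y. x \<in> cball 0 (R + 1) \<Longrightarrow> y \<in> cball 0 (R + 1) \<Longrightarrow> dist y x < d \<Longrightarrow> dist (?G y) (?G x) < e / (1 + R) ^ N"
    unfolding uniformly_continuous_on_def by metis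
  have "(1 + norm s) ^ N * norm (?G (s + v) - ?G s) \<le> e" if v: "norm v \<le> min (d / 2) 1" for v s
  proof (cases "norm s \<le> R")
    case True
    have "s + v \<in> cball 0 (R + 1)" "s \<in> cball 0 (R + 1)"
      using True v norm_triangle_ineq[of s v] by auto
    then have "dist (?G (s + v)) (?G s) < e / (1 + R) ^ N"
      using d(2)[of s "s + v"] d(1) v by (auto simp: dist_norm)
    then have "norm (?G (s + v) - ?G s) \<le> e / (1 + R) ^ N" by (simp add: dist_norm)
    then have "(1 + norm s) ^ N * norm (?G (s + v) - ?G s) \<le> (1 + R) ^ N * (e / (1 + R) ^ N)"
      using True R by (intro mult_mono power_mono) auto
    then show ?thesis using R by simp
  next
    case False
    have W: "0 < 1 + norm s" "0 < 1 + norm (s + v)" by (auto simp: add_pos_nonneg)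
    have le: "1 + norm s \<le> 2 * (1 + norm (s + v))" using v by (intro weight_shift_le) auto
    have "(1 + norm s) * ((1 + norm s) ^ N * norm (?G (s + v))) = (1 + norm s) ^ Suc N * norm (?G (s + v))" by simp
    also have "\<dots> \<le> (2 * (1 + norm (s + v))) ^ Suc N * norm (?G (s + v))"
      using le by (intro mult_right_mono power_mono) auto
    also have "\<dots> = 2 ^ Suc N * ((1 + norm (s + v)) ^ Suc N * norm (?G (s + v)))" by (simp only: power_mult_distrib mult.assoc)
    also have "\<dots> \<le> 2 ^ Suc N * B" by (intro mult_left_mono B) auto
    finally have 1: "(1 + norm s) * ((1 + norm s) ^ N * norm (?G (s + v))) \<le> 2 ^ Suc N * B" .
    have 2: "(1 + norm s) * ((1 + norm s) ^ N * norm (?G s)) \<le> B" using B(2)[of s] by (simp add: mult.assoc)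
    have "(1 + norm s) * ((1 + norm s) ^ N * norm (?G (s + v) - ?G s))
      \<le> (1 + norm s) * ((1 + norm s) ^ N * (norm (?G (s + v)) + norm (?G s)))"
      using W by (intro mult_left_mono norm_triangle_ineq4) auto
    also have "\<dots> \<le> 2 ^ Suc N * B + B" using 1 2 by (simp add: algebra_simps)
    also have "\<dots> = (2 ^ Suc N + 1) * B" by (simp only: distrib_right mult_1)
    also have "\<dots> = R * e" using e by (simp only: R_def nonzero_divide_eq_eq) simp
    also have "\<dots> \<le> (1 + norm s) * e" using False e by (intro mult_right_mono) auto
    finally show ?thesis using W by simp
  qed
  then show ?thesis using d(1) by (intro exI[of _ "min (d / 2) 1"]) auto
qed

lemma schwartz_translation:
  fixes f :: "'n::finite cfun"
  assumes f: "f \<in> schwartz" and e: "0 < e"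
  obtains d where "0 < d" "\<And>v s is. norm v \<le> d \<Longrightarrow> length is \<le> N \<Longrightarrow>
    (1 + norm s) ^ N * norm (pderivs is f (s + v) - pderivs is f s) \<le> e"
proof -
  let ?S = "{is :: 'n list. set is \<subseteq> UNIV \<and> length is \<le> N}"
  have fin: "finite ?S" by (rule finite_lists_length_le) simp
  have ne: "[] \<in> ?S" by simp
  have "\<forall>is. \<exists>d>0. \<forall>v s. norm v \<le> d \<longrightarrow> (1 + norm s) ^ N * norm (pderivs is f (s + v) - pderivs is f s) \<le> e"
    using schwartz_translation_one[OF f e] by blast
  then obtain d where d: "\<And>is. 0 < d is"
    "\<And>is v s. norm v \<le> d is \<Longrightarrow> (1 + norm s) ^ N * norm (pderivs is f (s + v) - pderivs is f s) \<le> e" by metis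
  show ?thesis
  proof (rule that[of "Min (d ` ?S)"])
    show "0 < Min (d ` ?S)" 
    proof (subst Min_gr_iff)
      show "d ` ?S \<noteq> {}" using ne by blast
    qed (use fin d(1) in auto)
    fix v s :: "real^'n" and "is" :: "'n list" assume v: "norm v \<le> Min (d ` ?S)" and "length is \<le> N"
    then have "Min (d ` ?S) \<le> d is" using fin by (intro Min_le) auto
    then show "(1 + norm s) ^ N * norm (pderivs is f (s + v) - pderivs is f s) \<le> e"
      using v by (intro d(2)) auto
  qed
qed

section \<open>Growth and continuity of a distribution convolved with a Schwartz function\<close>

lemma schwartz_reflect:
  fixes g :: "'n::finite cfun"
  assumes "g \<in> schwartz"
  shows "(\<lambda>t. g (x - t)) \<in> schwartz"
  using schwartz_affine[OF assms, of "-1" 1 x] by (simp add: algebra_simps)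

lemma pderivs_reflect:
  fixes g :: "'n::finite cfun"
  assumes "g \<in> schwartz"
  shows "pderivs is (\<lambda>t. g (x - t)) t = of_real ((-1) ^ length is) * pderivs is g (x - t)"
  using pderivs_affine[OF assms, of "is" 1 "-1" x t] by (simp add: algebra_simps)

lemma weight_power_diff: "(1 + norm t) ^ N \<le> (1 + norm x) ^ N * (1 + norm (x - (t::'a::real_normed_vector))) ^ N"
proof -
  have "1 + norm t \<le> (1 + norm x) * (1 + norm (x - t))"
    using weight_submult_diff[of 0 t x] by simp
  then show ?thesis by (simp add: power_mult_distrib[symmetric] power_mono)
qed

text \<open>Moving the centre to \<open>x\<close> multiplies the seminorm that controls
  \<open>u\<close> by at most (1 + |x|)^N.\<close>

lemma conv_growth:
  fixes g :: "'n::finite cfun"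
  assumes g: "g \<in> schwartz" and u: "u \<in> tempered"
  obtains B N where "0 \<le> B" "\<And>x. norm (conv g u x) \<le> B * (1 + norm x) ^ N"
proof -
  obtain C N where C: "0 \<le> C" and CN: "\<And>f B. f \<in> schwartz \<Longrightarrow>
     (\<And>is x. length is \<le> N \<Longrightarrow> (1 + norm x) ^ N * norm (pderivs is f x) \<le> B) \<Longrightarrow> norm (u f) \<le> C * B"
    using tempered_bound[OF u] by blast
  obtain B where B: "0 \<le> B" "\<And>x is. length is \<le> N \<Longrightarrow> (1 + norm x) ^ N * norm (pderivs is g x) \<le> B"
    using schwartz_bounded_all[OF g] by blast
  have "norm (conv g u x) \<le> C * ((1 + norm x) ^ N * B)" for x
    unfolding conv_def
  proof (rule CN[OF schwartz_reflect[OF g]])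
    fix "is" :: "'n list" and t assume l: "length is \<le> N"
    have "(1 + norm t) ^ N * norm (pderivs is (\<lambda>t. g (x - t)) t) = (1 + norm t) ^ N * norm (pderivs is g (x - t))"
      by (simp add: pderivs_reflect[OF g] norm_mult norm_power)
    also have "\<dots> \<le> (1 + norm x) ^ N * (1 + norm (x - t)) ^ N * norm (pderivs is g (x - t))"
      by (intro mult_right_mono weight_power_diff) auto
    also have "\<dots> \<le> (1 + norm x) ^ N * B" using B(2)[OF l, of "x - t"]
      by (simp add: mult.assoc mult_left_mono)
    finally show "(1 + norm t) ^ N * norm (pderivs is (\<lambda>t. g (x - t)) t) \<le> (1 + norm x) ^ N * B" .
  qed
  then show ?thesis using that[of "C * B" N] B C by (simp add: mult_ac)
qed

lemma tempered_diff:
  assumes "u \<in> tempered" "f \<in> schwartz" "g \<in> schwartz"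
  shows "u f - u g = u (\<lambda>x. 1 * f x + (-1) * g x)"
proof -
  have "u (\<lambda>x. 1 * f x + (-1) * g x) = 1 * u f + (-1) * u g"
    using assms unfolding tempered_def by blast
  then show ?thesis by simp
qed

text \<open>As x' tends to x, the reflected translates of \<open>g\<close> converge in the seminorm
  that controls \<open>u\<close>.\<close>

lemma conv_continuous:
  fixes g :: "'n::finite cfun"
  assumes g: "g \<in> schwartz" and u: "u \<in> tempered"
  shows "continuous_on UNIV (conv g u)"
  unfolding continuous_on_iff
proof (intro ballI allI impI)
  fix x :: "real^'n" and e :: real assume e: "0 < e"
  obtain C N where C: "0 \<le> C" and CN: "\<And>f B. f \<in> schwartz \<Longrightarrow>
     (\<And>is x. length is \<le> N \<Longrightarrow> (1 + norm x) ^ N * norm (pderivs is f x) \<le> B) \<Longrightarrow> norm (u f) \<le> C * B"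
    using tempered_bound[OF u] by blast
  \<comment> \<open>C + 1 in place of C covers C = 0 and makes the final estimate strict.\<close>
  define e' where "e' = e / ((C + 1) * (1 + norm x) ^ N)"
  have W: "0 < (1 + norm x) ^ N" by (simp add: add_pos_nonneg)
  have e': "0 < e'" using e C W by (simp add: e'_def)
  obtain d where d: "0 < d" "\<And>v s is. norm v \<le> d \<Longrightarrow> length is \<le> N \<Longrightarrow>
    (1 + norm s) ^ N * norm (pderivs is g (s + v) - pderivs is g s) \<le> e'"
    using schwartz_translation[OF g e'] by blast
  have "dist (conv g u x') (conv g u x) < e" if x': "dist x' x < d" for x'
  proof -
    have "norm (conv g u x' - conv g u x) \<le> C * ((1 + norm x) ^ N * e')"
      unfolding conv_def tempered_diff[OF u schwartz_reflect[OF g] schwartz_reflect[OF g]]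
    proof (rule CN[OF schwartz_lincomb[OF schwartz_reflect[OF g] schwartz_reflect[OF g]]])
      fix "is" :: "'n list" and t assume l: "length is \<le> N"
      have "norm (pderivs is (\<lambda>t. 1 * g (x' - t) + (-1) * g (x - t)) t)
         = norm (of_real ((-1) ^ length is) * (pderivs is g ((x - t) + (x' - x)) - pderivs is g (x - t)))"
        unfolding pderivs_lincomb[OF schwartz_reflect[OF g] schwartz_reflect[OF g]] pderivs_reflect[OF g]
        by (simp add: algebra_simps)
      also have "\<dots> = norm (pderivs is g ((x - t) + (x' - x)) - pderivs is g (x - t))"
        by (simp add: norm_mult norm_power)
      finally have "(1 + norm t) ^ N * norm (pderivs is (\<lambda>t. 1 * g (x' - t) + (-1) * g (x - t)) t)
        \<le> (1 + norm x) ^ N * (1 + norm (x - t)) ^ N * norm (pderivs is g ((x - t) + (x' - x)) - pderivs is g (x - t))"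
        by (simp only:) (intro mult_right_mono weight_power_diff norm_ge_zero)
      also have "\<dots> \<le> (1 + norm x) ^ N * e'"
        using d(2)[OF _ l, of "x' - x" "x - t"] x' W by (simp add: mult.assoc dist_norm)
      finally show "(1 + norm t) ^ N * norm (pderivs is (\<lambda>t. 1 * g (x' - t) + (-1) * g (x - t)) t) \<le> (1 + norm x) ^ N * e'" .
    qed
    also have "\<dots> = C / (C + 1) * e" 
    proof -
      have "C * (P * (e / ((C + 1) * P))) = C / (C + 1) * e" if "0 < P" for P :: real
        using that by simp
      then show ?thesis using W unfolding e'_def by blast
    qed
    also have "\<dots> < e" using C e by (simp add: field_simps)
    finally show ?thesis by (simp add: dist_norm)
  qed
  then show "\<exists>d>0. \<forall>x'\<in>UNIV. dist x' x < d \<longrightarrow> dist (conv g u x') (conv g u x) < e" using d(1) by blast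
qed

text \<open>Riemann sums over the values of a simple function become integrals with \<rho> inserted,
  so that dominated convergence applies to them.\<close>

lemma integral_simple_compose:
  fixes h :: "'a \<Rightarrow> complex" and \<Phi> :: "'b \<Rightarrow> complex"
  assumes \<rho>: "simple_function M \<rho>" and h: "integrable M h"
  shows "(\<integral>w. h w * \<Phi> (\<rho> w) \<partial>M) = (\<Sum>v\<in>\<rho> ` space M. (\<integral>w. h w * indicator (\<rho> -` {v} \<inter> space M) w \<partial>M) * \<Phi> v)"
    and "integrable M (\<lambda>w. h w * \<Phi> (\<rho> w))"
proof -
  let ?A = "\<lambda>v. \<rho> -` {v} \<inter> space M"
  have fin: "finite (\<rho> ` space M)" and m: "\<And>v. v \<in> \<rho> ` space M \<Longrightarrow> ?A v \<in> sets M"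
    using \<rho> by (auto simp: simple_function_def)
  have eq: "h w * \<Phi> (\<rho> w) = (\<Sum>v\<in>\<rho> ` space M. h w * indicator (?A v) w * \<Phi> v)" if "w \<in> space M" for w
  proof -
    have "(\<Sum>v\<in>\<rho> ` space M. h w * indicator (?A v) w * \<Phi> v)
      = (\<Sum>v\<in>\<rho> ` space M. if v = \<rho> w then h w * \<Phi> v else 0)"
      using that by (intro sum.cong) (auto simp: indicator_def)
    also have "\<dots> = h w * \<Phi> (\<rho> w)" using fin that by (simp add: sum.delta)
    finally show ?thesis ..
  qed
  have i: "integrable M (\<lambda>w. h w * indicator (?A v) w * \<Phi> v)" if "v \<in> \<rho> ` space M" for v
    using integrable_mult_indicator[OF m[OF that] h]
  proof (intro integrable_mult_left)
    have "(\<lambda>w. indicat_real (?A v) w *\<^sub>R h w) = (\<lambda>w. h w * indicator (?A v) w)"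
      by (auto simp: fun_eq_iff indicator_def)
    then show "integrable M (\<lambda>w. h w * indicator (?A v) w)"
      using integrable_mult_indicator[OF m[OF that] h] by simp
  qed
  show "(\<integral>w. h w * \<Phi> (\<rho> w) \<partial>M) = (\<Sum>v\<in>\<rho> ` space M. (\<integral>w. h w * indicator (?A v) w \<partial>M) * \<Phi> v)"
  proof -
    have "(\<integral>w. h w * \<Phi> (\<rho> w) \<partial>M) = (\<integral>w. (\<Sum>v\<in>\<rho> ` space M. h w * indicator (?A v) w * \<Phi> v) \<partial>M)"
      by (rule Bochner_Integration.integral_cong) (auto simp: eq)
    then show ?thesis using i by (simp add: Bochner_Integration.integral_sum)
  qed
  have "integrable M (\<lambda>w. \<Sum>v\<in>\<rho> ` space M. h w * indicator (?A v) w * \<Phi> v)"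
    using i by (rule Bochner_Integration.integrable_sum)
  then show "integrable M (\<lambda>w. h w * \<Phi> (\<rho> w))"
    by (rule Bochner_Integration.integrable_cong[THEN iffD1, rotated 2]) (auto simp: eq)
qed

section \<open>Differentiation of convolution integrals and their commutation with a
  distribution\<close>

lemma has_vector_derivative_0_iff:
  fixes f :: "real \<Rightarrow> 'a::real_normed_vector"
  shows "(f has_vector_derivative D) (at 0) \<longleftrightarrow> ((\<lambda>t. (f t - f 0) /\<^sub>R t) \<longlongrightarrow> D) (at 0)"
proof -
  have eq: "norm (f (0 + h) - f 0 - h *\<^sub>R D) / norm h = norm ((f h - f 0) /\<^sub>R h - D)" if "h \<noteq> 0" for h
  proof -
    have "(f h - f 0) /\<^sub>R h - D = (f h - f 0 - h *\<^sub>R D) /\<^sub>R h" using that by (simp add: scaleR_diff_right)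
    then show ?thesis by (simp add: divide_inverse mult.commute)
  qed
  have "(f has_vector_derivative D) (at 0) \<longleftrightarrow> ((\<lambda>h. norm (f (0 + h) - f 0 - h *\<^sub>R D) / norm h) \<longlongrightarrow> 0) (at 0)"
    by (simp only: has_vector_derivative_def has_derivative_at bounded_linear_scaleR_left simp_thms)
  also have "\<dots> \<longleftrightarrow> ((\<lambda>h. norm ((f h - f 0) /\<^sub>R h - D)) \<longlongrightarrow> 0) (at 0)"
    by (intro filterlim_cong refl) (use eq in \<open>auto simp: eventually_at_filter\<close>)
  also have "\<dots> \<longleftrightarrow> ((\<lambda>t. (f t - f 0) /\<^sub>R t) \<longlongrightarrow> D) (at 0)"
    by (simp add: tendsto_norm_zero_iff LIM_zero_iff)
  finally show ?thesis .
qed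

text \<open>Supplies the majorant for the difference quotients in
  \<open>pderivs_conv\<close>.\<close>

lemma schwartz_line_lipschitz:
  assumes g: "g \<in> schwartz" and B: "\<And>x. norm (pderivs (i # is) g x) \<le> B"
  shows "norm (pderivs is g (z + t *\<^sub>R axis i 1) - pderivs is g z) \<le> B * \<bar>t\<bar>"
proof -
  have "norm (pderivs is g (z + t *\<^sub>R axis i 1) - pderivs is g (z + 0 *\<^sub>R axis i 1)) \<le> B * norm (t - 0)"
  proof (rule differentiable_bound[OF convex_UNIV])
    fix s
    show "((\<lambda>t. pderivs is g (z + t *\<^sub>R axis i 1)) has_derivative (\<lambda>r. r *\<^sub>R pderivs (i # is) g (z + s *\<^sub>R axis i 1))) (at s within UNIV)"
      using schwartz_partial_line[OF g] by (simp only: has_vector_derivative_def)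
    show "onorm (\<lambda>r. r *\<^sub>R pderivs (i # is) g (z + s *\<^sub>R axis i 1)) \<le> B"
      by (intro onorm_le) (simp only: norm_scaleR mult.commute[of B] real_norm_def, intro mult_left_mono B abs_ge_zero)
  qed auto
  then show ?thesis by simp
qed

lemma integrable_conv_pderivs:
  assumes g: "g \<in> schwartz" and h: "h \<in> schwartz"
  shows "integrable lborel (\<lambda>w. h w * pderivs is g (x - w))"
proof -
  obtain B where B: "0 \<le> B" "\<And>x. norm (pderivs is g x) \<le> B"
    using schwartz_bounded[OF g, of 0 "is"] by auto
  have [measurable]: "h \<in> borel_measurable borel" "pderivs is g \<in> borel_measurable borel"
    using schwartz_measurable0[OF h] schwartz_measurable[OF g] by auto
  show ?thesis
  proof (rule Bochner_Integration.integrable_bound)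
    show "integrable lborel (\<lambda>w. B * norm (h w))" using schwartz_integrable0[OF h] by simp
    show "AE w in lborel. norm (h w * pderivs is g (x - w)) \<le> norm (B * norm (h w))"
      using B by (intro AE_I2) (simp add: norm_mult mult.commute[of B] mult_left_mono)
  qed measurable
qed

text \<open>Differentiation under the integral sign, with all derivatives falling on
  \<open>g\<close>. The limit is taken along sequences T n -> 0 so that dominated convergence
  applies, with a multiple of |h| as majorant.\<close>

lemma pderivs_conv:
  fixes g h :: "'n::finite cfun"
  assumes g: "g \<in> schwartz" and h: "h \<in> schwartz"
  shows "pderivs is (\<lambda>x. LBINT w. h w * g (x - w)) = (\<lambda>x. LBINT w. h w * pderivs is g (x - w))"
proof (induction "is")
  case (Cons i "is")
  have [measurable]: "h \<in> borel_measurable borel" "\<And>is. pderivs is g \<in> borel_measurable borel"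
    using schwartz_measurable0[OF h] schwartz_measurable[OF g] by auto
  obtain B where B: "0 \<le> B" "\<And>x. norm (pderivs (i # is) g x) \<le> B"
    using schwartz_bounded[OF g, of 0 "i # is"] by auto
  have "((\<lambda>t. LBINT w. h w * pderivs is g (x + t *\<^sub>R axis i 1 - w)) has_vector_derivative
      (LBINT w. h w * pderivs (i # is) g (x - w))) (at 0)" for x
  proof -
    define I where "I t = (LBINT w. h w * pderivs is g (x + t *\<^sub>R axis i 1 - w))" for t
    have "((\<lambda>t. (I t - I 0) /\<^sub>R t) \<longlongrightarrow> (LBINT w. h w * pderivs (i # is) g (x - w))) (at 0)"
      unfolding tendsto_at_iff_sequentially o_def
    proof (intro allI impI)
      fix T :: "nat \<Rightarrow> real" assume T: "\<forall>n. T n \<in> UNIV - {0}" "T \<longlonglongrightarrow> 0"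
      let ?D = "\<lambda>n w. (pderivs is g ((x - w) + T n *\<^sub>R axis i 1) - pderivs is g (x - w)) /\<^sub>R T n"
      have eq: "(I (T n) - I 0) /\<^sub>R T n = (LBINT w. h w * ?D n w)" for n
      proof -
        have "I (T n) - I 0 = (LBINT w. h w * pderivs is g (x + T n *\<^sub>R axis i 1 - w) - h w * pderivs is g (x + 0 *\<^sub>R axis i 1 - w))"
          unfolding I_def by (intro Bochner_Integration.integral_diff[symmetric] integrable_conv_pderivs g h)
        then have "(I (T n) - I 0) /\<^sub>R T n = (LBINT w. (h w * pderivs is g (x + T n *\<^sub>R axis i 1 - w) - h w * pderivs is g (x - w)) /\<^sub>R T n)"
          by simp
        then show ?thesis by (simp add: algebra_simps scaleR_conv_of_real)
      qed
      have "(\<lambda>n. LBINT w. h w * ?D n w)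
        \<longlonglongrightarrow> (LBINT w. h w * pderivs (i # is) g (x - w))"
      proof (rule integral_dominated_convergence[where w="\<lambda>w. B * norm (h w)"])
        show "integrable lborel (\<lambda>w. B * norm (h w))" using schwartz_integrable0[OF h] by simp
        show "AE w in lborel. (\<lambda>n. h w * ?D n w)
            \<longlonglongrightarrow> h w * pderivs (i # is) g (x - w)"
        proof (intro AE_I2 tendsto_mult tendsto_const)
          fix w
          have "((\<lambda>t. pderivs is g ((x - w) + t *\<^sub>R axis i 1)) has_vector_derivative pderivs (i # is) g ((x - w) + 0 *\<^sub>R axis i 1)) (at 0)"
            by (rule schwartz_partial_line[OF g])
          then have "((\<lambda>t. (pderivs is g ((x - w) + t *\<^sub>R axis i 1) - pderivs is g (x - w)) /\<^sub>R t) \<longlongrightarrow> pderivs (i # is) g (x - w)) (at 0)"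
            unfolding has_vector_derivative_0_iff by simp
          then show "(\<lambda>n. ?D n w) \<longlonglongrightarrow> pderivs (i # is) g (x - w)"
            using T unfolding tendsto_at_iff_sequentially o_def by blast
        qed
        show "AE w in lborel. norm (h w * ?D n w) \<le> B * norm (h w)" for n
        proof (rule AE_I2)
          fix w
          have "T n \<noteq> 0" using T by auto
          then have "norm (?D n w) \<le> B"
          proof -
            assume T0: "T n \<noteq> 0"
            have "norm (?D n w)
              = norm (pderivs is g ((x - w) + T n *\<^sub>R axis i 1) - pderivs is g (x - w)) / \<bar>T n\<bar>"
              by (simp add: divide_inverse mult.commute)
            also have "\<dots> \<le> B"
              using T0 schwartz_line_lipschitz[OF g B(2), of "x - w" "T n"] by (simp add: pos_divide_le_eq)
            finally show ?thesis .
          qed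
          then show "norm (h w * ?D n w) \<le> B * norm (h w)"
            unfolding norm_mult by (subst mult.commute) (intro mult_right_mono norm_ge_zero)
        qed
      qed measurable
      then show "(\<lambda>n. (I (T n) - I 0) /\<^sub>R T n) \<longlonglongrightarrow> (LBINT w. h w * pderivs (i # is) g (x - w))"
        unfolding eq .
    qed
    then show ?thesis unfolding I_def[symmetric] has_vector_derivative_0_iff .
  qed
  then have d: "vector_derivative (\<lambda>t. LBINT w. h w * pderivs is g (x + t *\<^sub>R axis i 1 - w)) (at 0)
      = (LBINT w. h w * pderivs (i # is) g (x - w))" for x
    by (rule vector_derivative_at)
  show ?case
  proof
    fix x
    have "pderivs (i # is) (\<lambda>x. LBINT w. h w * g (x - w)) x
      = vector_derivative (\<lambda>t. pderivs is (\<lambda>x. LBINT w. h w * g (x - w)) (x + t *\<^sub>R axis i 1)) (at 0)"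
      by (simp only: pderivs.simps partial_def)
    then show "pderivs (i # is) (\<lambda>x. LBINT w. h w * g (x - w)) x = (LBINT w. h w * pderivs (i # is) g (x - w))"
      unfolding Cons d .
  qed
qed simp

text \<open>The convolution is approximated by Riemann sums, which converge in every Schwartz seminorm.\<close>

lemma tempered_conv_commute:
  fixes g h \<phi> :: "'n::finite cfun"
  assumes g: "g \<in> schwartz" and h: "h \<in> schwartz" and \<phi>: "\<phi> \<in> schwartz"
    and eq: "\<And>x. \<phi> x = (LBINT w. h w * g (x - w))" and u: "u \<in> tempered"
  shows "conv \<phi> u x = (LBINT w. h w * conv g u (x - w))"
proof -
  have [measurable]: "h \<in> borel_measurable borel" "\<And>is. pderivs is g \<in> borel_measurable borel"
    using schwartz_measurable0[OF h] schwartz_measurable[OF g] by auto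
  have [measurable]: "conv g u \<in> borel_measurable borel"
    by (intro borel_measurable_continuous_onI conv_continuous g u)
  have D\<phi>: "pderivs is \<phi> x = (LBINT w. h w * pderivs is g (x - w))" for "is" x
  proof -
    have "\<phi> = (\<lambda>x. LBINT w. h w * g (x - w))" using eq by blast
    then show ?thesis by (simp only: pderivs_conv[OF g h])
  qed
  have id: "(\<lambda>w::real^'n. w) \<in> borel_measurable lborel" by simp
  \<comment> \<open>Simple functions tending to the identity provide the sample points. The bound by
    2|w| keeps all majorants polynomial in w, so that the decay of \<open>h\<close> makes them
    integrable.\<close>
  obtain \<rho> :: "nat \<Rightarrow> real^'n \<Rightarrow> real^'n" where \<rho>: "\<And>i. simple_function lborel (\<rho> i)"
    "\<And>w. (\<lambda>i. \<rho> i w) \<longlonglongrightarrow> w" "\<And>i w. norm (\<rho> i w) \<le> 2 * norm w"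
    using borel_measurable_implies_sequence_metric[OF id, of 0] by (auto simp: dist_norm)
  have [measurable]: "\<rho> i \<in> borel_measurable borel" for i
    using borel_measurable_simple_function[OF \<rho>(1)] by simp
  \<comment> \<open>The weight of a sample point \<open>v\<close> is the integral of
    \<open>h\<close> over the set where \<rho> takes this value.\<close>
  define c where "c i v = (LBINT w. h w * indicator (\<rho> i -` {v} \<inter> space lborel) w)" for i v
  define S where "S i = range (\<rho> i)" for i
  have S: "finite (S i)" "S i \<noteq> {}" for i using \<rho>(1)[of i] by (auto simp: simple_function_def S_def)
  define R where "R i t = (\<Sum>v\<in>S i. c i v * g (x - v - t))" for i t
  have comp: "(LBINT w. h w * \<Phi> (\<rho> i w)) = (\<Sum>v\<in>S i. c i v * \<Phi> v)" for i \<Phi>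
    unfolding c_def S_def using integral_simple_compose(1)[OF \<rho>(1) schwartz_integrable0[OF h]] by simp
  have gr: "(\<lambda>t. g (x - v - t)) \<in> schwartz" for v by (rule schwartz_reflect[OF g])
  have R_sch: "R i \<in> schwartz" and DR: "pderivs is (R i) t = (LBINT w. h w * (of_real ((-1) ^ length is) * pderivs is g (x - \<rho> i w - t)))"
    and uR: "u (R i) = (LBINT w. h w * conv g u (x - \<rho> i w))" for i "is" t
  proof -
    have *: "(\<lambda>t. \<Sum>v\<in>S i. c i v * g (x - v - t)) = R i" by (simp add: R_def fun_eq_iff)
    note s = schwartz_sum[where F="\<lambda>v t. g (x - v - t)" and c="c i" and u=u, OF S(1)[of i] S(2)[of i] gr, unfolded *]
    show "R i \<in> schwartz" using s by blast
    show "pderivs is (R i) t = (LBINT w. h w * (of_real ((-1) ^ length is) * pderivs is g (x - \<rho> i w - t)))"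
      unfolding comp[of "\<lambda>v. of_real ((-1) ^ length is) * pderivs is g (x - v - t)"]
      using s by (simp add: pderivs_reflect[OF g])
    show "u (R i) = (LBINT w. h w * conv g u (x - \<rho> i w))"
      unfolding comp[of "\<lambda>v. conv g u (x - v)"] using s u by (simp add: conv_def)
  qed
  have \<phi>r: "(\<lambda>t. \<phi> (x - t)) \<in> schwartz" by (rule schwartz_reflect[OF \<phi>])
  have lim1: "(\<lambda>i. u (R i)) \<longlonglongrightarrow> (LBINT w. h w * conv g u (x - w))"
    unfolding uR
  proof -
    obtain B N where B: "0 \<le> B" "\<And>x. norm (conv g u x) \<le> B * (1 + norm x) ^ N"
      using conv_growth[OF g u] by blast
    show "(\<lambda>i. LBINT w. h w * conv g u (x - \<rho> i w)) \<longlonglongrightarrow> (LBINT w. h w * conv g u (x - w))"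
    proof (rule integral_dominated_convergence[where w="\<lambda>w. (B * (2 * (1 + norm x)) ^ N) * (norm (h w) * (1 + norm w) ^ N)"])
      show "integrable lborel (\<lambda>w. (B * (2 * (1 + norm x)) ^ N) * (norm (h w) * (1 + norm w) ^ N))"
        using schwartz_integrable_weight[OF h, of "[]"] by simp
      show "AE w in lborel. (\<lambda>i. h w * conv g u (x - \<rho> i w)) \<longlonglongrightarrow> h w * conv g u (x - w)"
      proof (intro AE_I2 tendsto_mult tendsto_const)
        fix w
        have "isCont (conv g u) (x - w)" using conv_continuous[OF g u] by (simp add: continuous_on_eq_continuous_at)
        then show "(\<lambda>i. conv g u (x - \<rho> i w)) \<longlonglongrightarrow> conv g u (x - w)"
          by (rule isCont_tendsto_compose) (intro tendsto_diff tendsto_const \<rho>)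
      qed
      show "AE w in lborel. norm (h w * conv g u (x - \<rho> i w)) \<le> (B * (2 * (1 + norm x)) ^ N) * (norm (h w) * (1 + norm w) ^ N)" for i
      proof (rule AE_I2)
        fix w
        have "1 + norm (x - \<rho> i w) \<le> 1 + (norm x + 2 * norm w)"
          using norm_triangle_ineq4[of x "\<rho> i w"] \<rho>(3)[of i w] by linarith
        also have "\<dots> \<le> 2 * (1 + norm x) * (1 + norm w)" by (simp add: algebra_simps)
        finally have "norm (conv g u (x - \<rho> i w)) \<le> B * (2 * (1 + norm x) * (1 + norm w)) ^ N"
          by (intro order_trans[OF B(2)] mult_left_mono power_mono B) auto
        then have "norm (h w) * norm (conv g u (x - \<rho> i w)) \<le> norm (h w) * (B * (2 * (1 + norm x) * (1 + norm w)) ^ N)"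
          by (intro mult_left_mono) auto
        then show "norm (h w * conv g u (x - \<rho> i w)) \<le> (B * (2 * (1 + norm x)) ^ N) * (norm (h w) * (1 + norm w) ^ N)"
          by (simp only: norm_mult power_mult_distrib mult_ac)
      qed
    qed measurable
  qed
  obtain C N where C: "0 \<le> C" and CN: "\<And>f B. f \<in> schwartz \<Longrightarrow>
     (\<And>is x. length is \<le> N \<Longrightarrow> (1 + norm x) ^ N * norm (pderivs is f x) \<le> B) \<Longrightarrow> norm (u f) \<le> C * B"
    using tempered_bound[OF u] by blast
  obtain B where B: "0 \<le> B" "\<And>x is. length is \<le> N \<Longrightarrow> (1 + norm x) ^ N * norm (pderivs is g x) \<le> B"
    using schwartz_bounded_all[OF g] by blast
  define J where "J = (LBINT w. norm (h w) * (1 + norm w) ^ N)"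
  have hJ: "integrable lborel (\<lambda>w. norm (h w) * (1 + norm w) ^ N)"
    using schwartz_integrable_weight[OF h, of "[]"] by simp
  have J0: "0 \<le> J" unfolding J_def by (intro integral_nonneg_AE) auto
  \<comment> \<open>The Riemann sums converge in the one seminorm that controls \<open>u\<close>.
    The integral is split according to whether the sample point is within \<open>d\<close> of
    w.\<close>
  have "(\<lambda>i. u (R i) - conv \<phi> u x) \<longlonglongrightarrow> 0"
  proof (rule LIMSEQ_I)
    fix r :: real assume r: "0 < r"
    define W where "W = (1 + norm x) ^ N"
    have W: "1 \<le> W" by (simp add: W_def)
    \<comment> \<open>\<open>e\<close> and the later \<open>e2\<close> each take half of r:
      \<open>e\<close> for the points w with a close sample point, \<open>e2\<close> for the others.
      The summands 1 avoid division by zero.\<close>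
    define e where "e = r / (2 * (C + 1) * W * (J + 1))"
    have e: "0 < e" using r C W J0 by (simp add: e_def)
    obtain d where d: "0 < d" "\<And>v s is. norm v \<le> d \<Longrightarrow> length is \<le> N \<Longrightarrow>
      (1 + norm s) ^ N * norm (pderivs is g (s + v) - pderivs is g s) \<le> e"
      using schwartz_translation[OF g e] by blast
    \<comment> \<open>Two terms, each controlled by \<open>B\<close>; the 2^N comes from sample
      points of norm up to 2|w|.\<close>
    define K where "K = 2 * B * 2 ^ N"
    have K: "0 \<le> K" using B by (simp add: K_def)
    \<comment> \<open>The weighted mass of \<open>h\<close> where the sample point is still farther
      away than \<open>d\<close>. It tends to 0 by dominated convergence.\<close>
    define b where "b i w = (norm (h w) * (1 + norm w) ^ N) * indicator {w. \<not> norm (w - \<rho> i w) \<le> d} w" for i w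
    have b_int: "integrable lborel (b i)" for i
      unfolding b_def using hJ by (intro integrable_real_mult_indicator) auto
    have "(\<lambda>i. LBINT w. b i w) \<longlonglongrightarrow> integral\<^sup>L (lborel :: (real^'n) measure) (\<lambda>w. 0)"
    proof (rule integral_dominated_convergence[OF _ _ hJ])
      show "b i \<in> borel_measurable lborel" for i using b_int by auto
      show "AE w in lborel. (\<lambda>i. b i w) \<longlonglongrightarrow> 0"
      proof (rule AE_I2)
        fix w
        have "(\<lambda>i. norm (w - \<rho> i w)) \<longlonglongrightarrow> norm (w - w)" by (intro tendsto_intros \<rho>)
        then have "\<forall>\<^sub>F i in sequentially. norm (w - \<rho> i w) < d" using d(1) by (intro order_tendstoD) auto
        then have "\<forall>\<^sub>F i in sequentially. b i w = 0" by eventually_elim (auto simp: b_def)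
        then show "(\<lambda>i. b i w) \<longlonglongrightarrow> 0" by (rule tendsto_eventually)
      qed
      show "AE w in lborel. norm (b i w) \<le> norm (h w) * (1 + norm w) ^ N" for i
        by (rule AE_I2) (auto simp: b_def indicator_def)
    qed auto
    then have b_lim: "(\<lambda>i. LBINT w. b i w) \<longlonglongrightarrow> 0" by simp
    define e2 where "e2 = r / (2 * (C + 1) * W * (K + 1))"
    have e2: "0 < e2" using r C W K by (simp add: e2_def)
    from order_tendstoD(2)[OF b_lim e2] obtain n0 where n0: "\<And>i. i \<ge> n0 \<Longrightarrow> (LBINT w. b i w) < e2"
      unfolding eventually_sequentially by blast
    have bound: "norm (u (R i) - conv \<phi> u x) \<le> C * (W * (e * J + K * (LBINT w. b i w)))" for i
      unfolding conv_def tempered_diff[OF u R_sch \<phi>r]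
    proof (rule CN[OF schwartz_lincomb[OF R_sch \<phi>r]])
      fix "is" :: "'n list" and t assume l: "length is \<le> N"
      let ?s = "of_real ((-1) ^ length is) :: complex"
      let ?G = "pderivs is g"
      let ?P = "\<lambda>w. ?G (x - \<rho> i w - t)" and ?Q = "\<lambda>w. ?G (x - w - t)"
      let ?d = "\<lambda>w. h w * (?s * ?P w) - h w * (?s * ?Q w)"
      let ?E = "pderivs is (\<lambda>t. 1 * R i t + (-1) * \<phi> (x - t)) t"
      let ?Z = "{w. \<not> norm (w - \<rho> i w) \<le> d}"
      let ?m = "\<lambda>w. e * (norm (h w) * (1 + norm w) ^ N) + K * b i w"
      have i1: "integrable lborel (\<lambda>w. h w * (?s * ?P w))"
        using integral_simple_compose(2)[OF \<rho>(1) schwartz_integrable0[OF h], of "\<lambda>v. ?s * ?G (x - v - t)"] by simp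
      have i2: "integrable lborel (\<lambda>w. h w * (?s * ?Q w))"
        using integrable_mult_right[OF integrable_conv_pderivs[OF g h, of "is" "x - t"], of ?s] by (simp add: algebra_simps)
      have "?E
         = (LBINT w. h w * (?s * ?P w)) - ?s * (LBINT w. h w * ?G (x - t - w))"
        unfolding pderivs_lincomb[OF R_sch \<phi>r] pderivs_reflect[OF \<phi>] DR D\<phi> by simp
      also have "\<dots> = (LBINT w. h w * (?s * ?P w)) - (LBINT w. h w * (?s * ?Q w))"
        by (simp only: mult.left_commute[of _ ?s] cancel_ab_semigroup_add_class.diff_right_commute[of x _ t] integral_mult_right_zero)
      also have "\<dots> = (LBINT w. ?d w)"
        using i1 i2 by (rule Bochner_Integration.integral_diff[symmetric])
      finally have Dq: "?E
        = (LBINT w. ?d w)" .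
      have "(1 + norm t) ^ N * norm (?E)
         \<le> (1 + norm t) ^ N * (LBINT w. norm (?d w))"
        unfolding Dq by (intro mult_left_mono integral_norm_bound) auto
      also have "\<dots> = (LBINT w. (1 + norm t) ^ N * norm (?d w))"
        by simp
      also have "\<dots> \<le> (LBINT w. W * (?m w))"
      proof (rule integral_mono)
        show "integrable lborel (\<lambda>w. (1 + norm t) ^ N * norm (?d w))"
          by (intro integrable_mult_right integrable_norm Bochner_Integration.integrable_diff i1 i2)
        show "integrable lborel (\<lambda>w. W * (?m w))"
          by (intro integrable_mult_right Bochner_Integration.integrable_add hJ b_int)
        fix w
        have tw: "(1 + norm t) ^ N \<le> (W * (1 + norm v) ^ N) * (1 + norm (x - v - t)) ^ N" for v
        proof -
          have "(1 + norm t) ^ N \<le> (1 + norm (x - v)) ^ N * (1 + norm (x - v - t)) ^ N" by (rule weight_power_diff)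
          also have "(1 + norm (x - v)) ^ N \<le> W * (1 + norm v) ^ N"
            unfolding W_def power_mult_distrib[symmetric] using weight_submult[of x "-v"] by (intro power_mono) auto
          finally show ?thesis by (simp add: mult_right_mono)
        qed
        have main: "(1 + norm t) ^ N * norm (?P w - ?Q w)
          \<le> W * (1 + norm w) ^ N * (e + K * indicator ?Z w)"
        proof (cases "norm (w - \<rho> i w) \<le> d")
          case True
          have "(1 + norm t) ^ N * norm (?P w - ?Q w)
            \<le> (W * (1 + norm w) ^ N) * (1 + norm (x - w - t)) ^ N * norm (?P w - ?Q w)"
            by (intro mult_right_mono tw) auto
          also have "\<dots> = (W * (1 + norm w) ^ N) * ((1 + norm (x - w - t)) ^ N * norm (?G ((x - w - t) + (w - \<rho> i w)) - ?Q w))"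
            by (simp add: algebra_simps)
          also have "\<dots> \<le> (W * (1 + norm w) ^ N) * e"
            using W by (intro mult_left_mono d(2) True l) auto
          finally show ?thesis using True by simp
        next
          case False
          have one: "(1 + norm t) ^ N * norm (?G (x - v - t)) \<le> W * (1 + norm w) ^ N * (B * 2 ^ N)" if "norm v \<le> 2 * norm w" for v
          proof -
            have "(1 + norm t) ^ N * norm (?G (x - v - t)) \<le> (W * (1 + norm v) ^ N) * (1 + norm (x - v - t)) ^ N * norm (?G (x - v - t))"
              by (intro mult_right_mono tw) auto
            also have "\<dots> = (W * (1 + norm v) ^ N) * ((1 + norm (x - v - t)) ^ N * norm (?G (x - v - t)))" by simp
            also have "\<dots> \<le> (W * (2 * (1 + norm w)) ^ N) * B"
              using W B that by (intro mult_mono power_mono B(2) l) auto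
            finally show ?thesis by (simp only: power_mult_distrib mult_ac)
          qed
          have "(1 + norm t) ^ N * norm (?P w - ?Q w)
            \<le> (1 + norm t) ^ N * (norm (?P w) + norm (?Q w))"
            by (intro mult_left_mono norm_triangle_ineq4) auto
          also have "\<dots> \<le> W * (1 + norm w) ^ N * (B * 2 ^ N) + W * (1 + norm w) ^ N * (B * 2 ^ N)"
            unfolding distrib_left by (intro add_mono one \<rho>) auto
          also have "\<dots> = W * (1 + norm w) ^ N * K" by (simp add: K_def)
          also have "\<dots> \<le> W * (1 + norm w) ^ N * (e + K)" using W e by (intro mult_left_mono) auto
          finally show ?thesis using False by simp
        qed
        have "norm (?d w)
          = norm (h w) * norm (?P w - ?Q w)"
          by (simp only: right_diff_distrib[symmetric] norm_mult norm_of_real) (simp add: power_abs)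
        then have "(1 + norm t) ^ N * norm (?d w)
          = norm (h w) * ((1 + norm t) ^ N * norm (?P w - ?Q w))"
          by (simp only: mult_ac)
        also have "\<dots> \<le> norm (h w) * (W * (1 + norm w) ^ N * (e + K * indicator ?Z w))"
          by (intro mult_left_mono main) auto
        also have "\<dots> = W * (?m w)"
          by (simp add: b_def algebra_simps)
        finally show "(1 + norm t) ^ N * norm (?d w)
          \<le> W * (?m w)" .
      qed
      also have "\<dots> = W * (e * J + K * (LBINT w. b i w))"
        using hJ b_int by (simp add: J_def)
      finally show "(1 + norm t) ^ N * norm (?E) \<le> W * (e * J + K * (LBINT w. b i w))" .
    qed
    have "norm (u (R i) - conv \<phi> u x - 0) < r" if "i \<ge> n0" for i
    proof -
      have b0: "0 \<le> (LBINT w. b i w)" by (intro integral_nonneg_AE) (auto simp: b_def)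
      have W0: "0 < W" using W by simp
      have p1: "e * J \<le> r / (2 * (C + 1) * W)"
      proof -
        have "e * J \<le> e * (J + 1)" using e by simp
        also have "\<dots> = r / (2 * (C + 1) * W)" using J0 by (simp add: e_def)
        finally show ?thesis .
      qed
      have p2: "K * (LBINT w. b i w) \<le> r / (2 * (C + 1) * W)"
      proof -
        have "K * (LBINT w. b i w) \<le> (K + 1) * e2" using n0[OF that] K b0 e2 by (intro mult_mono) auto
        also have "\<dots> = r / (2 * (C + 1) * W)" using K by (simp add: e2_def)
        finally show ?thesis .
      qed
      have "C * (W * (e * J + K * (LBINT w. b i w))) \<le> C * (W * (r / (2 * (C + 1) * W) + r / (2 * (C + 1) * W)))"
        using C W0 p1 p2 by (intro mult_left_mono add_mono) auto
      also have "r / (2 * (C + 1) * W) + r / (2 * (C + 1) * W) = r / ((C + 1) * W)"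
      proof -
        have half: "r / (2 * X) + r / (2 * X) = r / X" for X :: real by simp
        show ?thesis by (simp only: mult.assoc half)
      qed
      also have "C * (W * (r / ((C + 1) * W))) = C / (C + 1) * r" using W0 by simp
      also have "\<dots> < r" using C r by (simp add: field_simps)
      finally show ?thesis using bound[of i] by simp
    qed
    then show "\<exists>n0. \<forall>i\<ge>n0. norm (u (R i) - conv \<phi> u x - 0) < r" by blast
  qed
  then have "(\<lambda>i. u (R i)) \<longlonglongrightarrow> conv \<phi> u x" by (simp add: LIM_zero_iff)
  with lim1 show ?thesis by (rule LIMSEQ_unique[symmetric])
qed

section \<open>Fourier uniqueness\<close>

lemma gauss_1d:
  "integrable lborel (\<lambda>x. complex_of_real (std_normal_density x) * cis (t * x))"
  "(LBINT x. complex_of_real (std_normal_density x) * cis (t * x)) = of_real (exp (- t\<^sup>2 / 2))"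
proof -
  have i: "integrable lborel std_normal_density" by (rule integrable_normal_density) simp
  have m: "std_normal_density \<in> borel_measurable borel" using borel_measurable_integrable[OF i] by simp
  have m2: "(\<lambda>x. cis (t * x)) \<in> borel_measurable borel"
    by (intro borel_measurable_continuous_onI continuous_intros)
  show "integrable lborel (\<lambda>x. complex_of_real (std_normal_density x) * cis (t * x))"
    by (rule Bochner_Integration.integrable_bound[OF i])
       (use m m2 in \<open>auto simp: norm_mult\<close>)
  have "char std_normal_distribution t = (LBINT x. complex_of_real (std_normal_density x) * cis (t * x))"
    unfolding char_def
    using m m2 by (subst integral_density) (auto simp: scaleR_conv_of_real cis_conv_exp)
  then show "(LBINT x. complex_of_real (std_normal_density x) * cis (t * x)) = of_real (exp (- t\<^sup>2 / 2))"
    by (simp add: char_std_normal_distribution)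
qed

text \<open>A product over coordinates, so that its Fourier transform factors into characteristic
  functions of the standard normal law; \<open>gauss_eq\<close> gives the radial form.\<close>

definition gauss :: "'a::euclidean_space \<Rightarrow> real" where
  "gauss x = (\<Prod>b\<in>Basis. std_normal_density (x \<bullet> b))"

lemma cis_sum: "finite S \<Longrightarrow> cis (\<Sum>b\<in>S. f b) = (\<Prod>b\<in>S. cis (f b))"
  by (induction S rule: finite_induct) (auto simp: cis_mult[symmetric])

lemma sum_square_inner: "(\<Sum>b\<in>Basis. - (x \<bullet> b)\<^sup>2 / 2) = - (norm (x::'a::euclidean_space))\<^sup>2 / 2"
  by (simp add: norm_eq_sqrt_inner euclidean_inner[of x x] power2_eq_square sum_nonneg sum_negf sum_divide_distrib[symmetric])

lemma gauss_eq: "gauss x = (1 / sqrt (2 * pi)) ^ DIM('a) * exp (- (norm x)\<^sup>2 / 2)" for x :: "'a::euclidean_space"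
proof -
  have "gauss x = (\<Prod>b\<in>(Basis::'a set). (1 / sqrt (2 * pi)) * exp (- (x \<bullet> b)\<^sup>2 / 2))"
    by (simp add: gauss_def std_normal_density_def)
  also have "\<dots> = (1 / sqrt (2 * pi)) ^ DIM('a) * exp (\<Sum>b\<in>(Basis::'a set). - (x \<bullet> b)\<^sup>2 / 2)"
    by (simp only: prod.distrib prod_constant exp_sum[OF finite_Basis])
  also have "(\<Sum>b\<in>(Basis::'a set). - (x \<bullet> b)\<^sup>2 / 2) = - (norm x)\<^sup>2 / 2"
    by (rule sum_square_inner)
  finally show ?thesis .
qed

lemma gauss_fourier:
  fixes v :: "'a::euclidean_space"
  shows "integrable lborel (\<lambda>\<xi>. complex_of_real (gauss \<xi>) * cis (v \<bullet> \<xi>))"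
    and "(LBINT \<xi>. complex_of_real (gauss \<xi>) * cis (v \<bullet> \<xi>)) = of_real (exp (- (norm v)\<^sup>2 / 2))"
proof -
  interpret product_sigma_finite "\<lambda>_::'a. lborel :: real measure" ..
  let ?F = "\<lambda>\<xi>::'a. complex_of_real (gauss \<xi>) * cis (v \<bullet> \<xi>)"
  let ?T = "\<lambda>f::'a \<Rightarrow> real. \<Sum>b\<in>Basis. f b *\<^sub>R b"
  have F_eq: "?F (?T f) = (\<Prod>b\<in>Basis. complex_of_real (std_normal_density (f b)) * cis (v \<bullet> b * f b))" for f
  proof -
    have 1: "?T f \<bullet> b = f b" if "b \<in> Basis" for b
      using that by (simp add: inner_sum_left inner_Basis if_distrib sum.delta cong: if_cong)
    have "gauss (?T f) = (\<Prod>b\<in>Basis. std_normal_density (f b))"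
      unfolding gauss_def by (intro prod.cong) (simp_all only: 1)
    moreover have "cis (v \<bullet> ?T f) = (\<Prod>b\<in>Basis. cis (v \<bullet> b * f b))"
      by (simp add: inner_sum_right cis_sum mult.commute)
    ultimately show ?thesis by (simp add: prod.distrib)
  qed
  have meas: "?F \<in> borel_measurable borel"
    unfolding gauss_eq
    by (intro borel_measurable_continuous_onI continuous_intros) auto
  have T: "?T \<in> measurable (\<Pi>\<^sub>M b\<in>Basis. lborel) borel" by measurable
  have int: "integrable (\<Pi>\<^sub>M b\<in>(Basis::'a set). lborel) (\<lambda>f. ?F (?T f))"
    unfolding F_eq by (rule product_integrable_prod) (use gauss_1d(1) in auto)
  show "integrable lborel ?F"
    by (subst lborel_eq, subst integrable_distr_eq[OF T meas]) (rule int)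
  have "(LBINT \<xi>. ?F \<xi>) = (\<integral>f. ?F (?T f) \<partial>(\<Pi>\<^sub>M b\<in>Basis. lborel))"
    by (subst lborel_eq, subst integral_distr[OF T meas]) simp
  also have "\<dots> = (\<Prod>b\<in>Basis. LBINT x. complex_of_real (std_normal_density x) * cis (v \<bullet> b * x))"
    unfolding F_eq by (rule product_integral_prod) (use gauss_1d(1) in auto)
  also have "\<dots> = (\<Prod>b\<in>Basis. of_real (exp (- (v \<bullet> b)\<^sup>2 / 2)))"
    by (simp only: gauss_1d(2))
  also have "\<dots> = of_real (exp (\<Sum>b\<in>Basis. - (v \<bullet> b)\<^sup>2 / 2))"
    by (simp only: exp_sum[OF finite_Basis] of_real_prod)
  also have "(\<Sum>b\<in>(Basis::'a set). - (v \<bullet> b)\<^sup>2 / 2) = - (norm v)\<^sup>2 / 2"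
    by (rule sum_square_inner)
  finally show "(LBINT \<xi>. ?F \<xi>) = of_real (exp (- (norm v)\<^sup>2 / 2))" .
qed

lemma integrable_exp_norm: "integrable lborel (\<lambda>z::'a::euclidean_space. exp (- (norm z)\<^sup>2 / 2))"
  and integral_exp_norm: "(LINT z|(lborel::'a::euclidean_space measure). exp (- (norm z)\<^sup>2 / 2)) > 0"
proof -
  define c where "c = (1 / sqrt (2 * pi)) ^ DIM('a)"
  have c: "0 < c" by (simp add: c_def)
  have eq: "exp (- (norm z)\<^sup>2 / 2) = (1 / c) * gauss z" for z :: 'a using c by (simp add: gauss_eq c_def)
  have i: "integrable lborel (\<lambda>z::'a. complex_of_real (gauss z))"
    and e: "(LINT z|(lborel::'a measure). complex_of_real (gauss z)) = 1"
    using gauss_fourier[of "0::'a"] by auto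
  have i': "integrable lborel (\<lambda>z::'a. gauss z)" using i by (simp add: complex_of_real_integrable_eq)
  then show "integrable lborel (\<lambda>z::'a. exp (- (norm z)\<^sup>2 / 2))" unfolding eq by simp
  have "(LINT z|(lborel::'a measure). gauss z) = 1" using e by (metis integral_complex_of_real of_real_eq_1_iff)
  then show "(LINT z|(lborel::'a measure). exp (- (norm z)\<^sup>2 / 2)) > 0" unfolding eq using c by simp
qed

text \<open>Testing against a Gaussian of width \<open>\<epsilon>\<close> and letting \<open>\<epsilon>\<close> tend to \<open>0\<close> recovers \<open>D a\<close>.\<close>

lemma fourier_injective:
  fixes D :: "'n::finite cfun"
  assumes D: "integrable lborel D" and cont: "continuous_on UNIV D" and bd: "\<And>x. norm (D x) \<le> B"
    and F: "\<And>\<xi>. fourier D \<xi> = 0"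
  shows "D a = 0"
proof -
  have [measurable]: "D \<in> borel_measurable borel" using cont by (rule borel_measurable_continuous_onI)
  let ?E = "\<lambda>z::real^'n. exp (- (norm z)\<^sup>2 / 2)"
  have gm [measurable]: "(gauss :: real^'n \<Rightarrow> real) \<in> borel_measurable borel"
    unfolding gauss_eq[abs_def] by (intro borel_measurable_continuous_onI continuous_intros) auto
  have gi: "integrable lborel (gauss :: real^'n \<Rightarrow> real)"
    using gauss_fourier(1)[of "0::real^'n"] by (simp add: complex_of_real_integrable_eq)
  have g0: "0 \<le> gauss z" for z :: "real^'n" by (simp add: gauss_eq)
  \<comment> \<open>Write the Gaussian as the Fourier integral of a Gaussian and exchange the
    integrals: the inner one becomes a multiple of \<open>fourier D\<close> at \<xi>/(2 pi
    \<epsilon>), which vanishes. An affine substitution then centres the integral at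
    \<open>a\<close>.\<close>
  have zero: "(LBINT z. of_real (?E z) * D (a + \<epsilon> *\<^sub>R z)) = 0" if e: "0 < \<epsilon>" for \<epsilon> :: real
  proof -
    define K where "K = (\<lambda>(\<xi>::real^'n, x::real^'n). cis (((1/\<epsilon>) *\<^sub>R (a - x)) \<bullet> \<xi>))"
    have [measurable]: "K \<in> borel_measurable (borel \<Otimes>\<^sub>M borel)"
      unfolding borel_prod K_def by (intro borel_measurable_continuous_onI) (use e in \<open>auto intro!: continuous_intros simp: case_prod_unfold\<close>)
    define G where "G = (\<lambda>(\<xi>::real^'n, x::real^'n). complex_of_real (gauss \<xi>) * D x * cis (((1/\<epsilon>) *\<^sub>R (a - x)) \<bullet> \<xi>))"
    have [measurable]: "G \<in> borel_measurable (lborel \<Otimes>\<^sub>M lborel)"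
    proof -
      have "G = (\<lambda>p. complex_of_real (gauss (fst p)) * D (snd p) * K p)"
        by (auto simp: G_def K_def fun_eq_iff)
      then show ?thesis by simp
    qed
    have int: "integrable (lborel \<Otimes>\<^sub>M lborel) G"
    proof (rule lborel_pair.Fubini_integrable)
      have "(\<lambda>\<xi>. LBINT x. norm (G (\<xi>, x))) = (\<lambda>\<xi>. gauss \<xi> * (LBINT x. norm (D x)))"
        using g0 by (simp add: G_def norm_mult fun_eq_iff)
      then show "integrable lborel (\<lambda>\<xi>. LBINT x. norm (G (\<xi>, x)))" using gi by simp
      show "AE \<xi> in lborel. integrable lborel (\<lambda>x. G (\<xi>, x))"
      proof (rule AE_I2)
        fix \<xi>
        show "integrable lborel (\<lambda>x. G (\<xi>, x))"
        proof (rule Bochner_Integration.integrable_bound)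
          show "integrable lborel (\<lambda>x. gauss \<xi> * norm (D x))" using D by simp
          show "(\<lambda>x. G (\<xi>, x)) \<in> borel_measurable lborel" by measurable
        qed (use g0 in \<open>auto simp: G_def norm_mult\<close>)
      qed
    qed measurable
    have "(LBINT \<xi>. (LBINT x. G (\<xi>, x))) = 0"
    proof -
      let ?b = "\<lambda>\<xi> x. - 2 * pi * (x \<bullet> ((1 / (2 * pi * \<epsilon>)) *\<^sub>R \<xi>))"
      let ?c = "\<lambda>\<xi> x. cis (?b \<xi> x)"
      have "(LBINT x. G (\<xi>, x)) = 0" for \<xi>
      proof -
        have "(LBINT x. G (\<xi>, x)) = (LBINT x. (of_real (gauss \<xi>) * cis ((1/\<epsilon>) * (a \<bullet> \<xi>))) * (D x * ?c \<xi> x))"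
        proof (rule Bochner_Integration.integral_cong[OF refl])
          fix x
          have "((1/\<epsilon>) *\<^sub>R (a - x)) \<bullet> \<xi> = (1/\<epsilon>) * (a \<bullet> \<xi>) + (?b \<xi> x)"
            using e by (simp add: inner_diff_left diff_divide_distrib)
          then show "G (\<xi>, x) = (of_real (gauss \<xi>) * cis ((1/\<epsilon>) * (a \<bullet> \<xi>))) * (D x * ?c \<xi> x)"
            by (simp only: G_def prod.case cis_mult[symmetric] mult_ac)
        qed
        also have "\<dots> = (of_real (gauss \<xi>) * cis ((1/\<epsilon>) * (a \<bullet> \<xi>))) * fourier D ((1 / (2 * pi * \<epsilon>)) *\<^sub>R \<xi>)"
          unfolding fourier_def by (rule integral_mult_right_zero)
        finally show ?thesis by (simp add: F)
      qed
      then show ?thesis by simp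
    qed
    then have "(LBINT x. (LBINT \<xi>. G (\<xi>, x))) = 0"
      using lborel_pair.Fubini_integral[of "\<lambda>\<xi> x. G (\<xi>, x)"] int by simp
    moreover have "(LBINT \<xi>. G (\<xi>, x)) = of_real (?E ((1/\<epsilon>) *\<^sub>R (a - x))) * D x" for x
    proof -
      have "(LBINT \<xi>. G (\<xi>, x)) = (LBINT \<xi>. D x * (complex_of_real (gauss \<xi>) * cis (((1/\<epsilon>) *\<^sub>R (a - x)) \<bullet> \<xi>)))"
        by (simp add: G_def mult_ac)
      also have "\<dots> = D x * of_real (?E ((1/\<epsilon>) *\<^sub>R (a - x)))"
        by (simp only: integral_mult_right_zero gauss_fourier(2))
      finally show ?thesis by (simp only: mult.commute)
    qed
    ultimately have 0: "(LBINT x. of_real (?E ((1/\<epsilon>) *\<^sub>R (a - x))) * D x) = 0" by simp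
    have m: "(\<lambda>x. of_real (?E ((1/\<epsilon>) *\<^sub>R (a - x))) * D x) \<in> borel_measurable borel" by measurable
    have "(LBINT z. of_real (?E ((1/\<epsilon>) *\<^sub>R (a - (a + \<epsilon> *\<^sub>R z)))) * D (a + \<epsilon> *\<^sub>R z)) = 0"
      using integral_affine[OF m, of \<epsilon> a] e 0 by simp
    then show ?thesis using e by simp
  qed
  \<comment> \<open>Here \<epsilon> runs through 1/(i + 1), and the bound on \<open>D\<close> gives
    the majorant.\<close>
  have "(\<lambda>i. LBINT z. of_real (?E z) * D (a + (1 / real (Suc i)) *\<^sub>R z)) \<longlonglongrightarrow> (LBINT z. of_real (?E z) * D a)"
  proof (rule integral_dominated_convergence[where w="\<lambda>z. B * ?E z"])
    show "integrable lborel (\<lambda>z. B * ?E z)" by (intro integrable_mult_right integrable_exp_norm)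
    show "AE z in lborel. (\<lambda>i. of_real (?E z) * D (a + (1 / real (Suc i)) *\<^sub>R z)) \<longlonglongrightarrow> of_real (?E z) * D a"
    proof (intro AE_I2 tendsto_mult tendsto_const)
      fix z
      have "(\<lambda>i. a + (1 / real (Suc i)) *\<^sub>R z) \<longlonglongrightarrow> a + 0 *\<^sub>R z"
        by (intro tendsto_intros) (rule LIMSEQ_Suc[OF lim_1_over_n])
      then show "(\<lambda>i. D (a + (1 / real (Suc i)) *\<^sub>R z)) \<longlonglongrightarrow> D a"
        using cont by (intro isCont_tendsto_compose[of a D]) (auto simp: continuous_on_eq_continuous_at)
    qed
    show "AE z in lborel. norm (of_real (?E z) * D (a + (1 / real (Suc i)) *\<^sub>R z)) \<le> B * ?E z" for i
      using bd by (intro AE_I2) (simp add: norm_mult mult.commute[of B] mult_left_mono)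
  qed measurable
  then have "(LBINT z. of_real (?E z) * D a) = 0"
    using zero by (simp add: LIMSEQ_const_iff)
  then have "of_real (LBINT z. ?E z) * D a = 0"
    by (simp only: integral_mult_left_zero integral_complex_of_real)
  then show ?thesis using integral_exp_norm[where 'a="real^'n"] by simp
qed

section \<open>Convolutions on the Fourier side and dilations\<close>

lemma conv_fun_props:
  fixes f g :: "'n::finite cfun"
  assumes f: "f \<in> schwartz" and g: "g \<in> schwartz"
  shows conv_fun_continuous: "continuous_on UNIV (\<lambda>x. LBINT w. f w * g (x - w))"
    and conv_fun_bounded: "\<exists>B. \<forall>x. norm (LBINT w. f w * g (x - w)) \<le> B"
    and conv_fun_integrable: "integrable lborel (\<lambda>x. LBINT w. f w * g (x - w))"
    and fourier_conv_fun: "fourier (\<lambda>x. LBINT w. f w * g (x - w)) \<xi> = fourier f \<xi> * fourier g \<xi>"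
proof -
  have fi: "integrable lborel f" and gi: "integrable lborel g"
    using f g by (auto intro: schwartz_integrable0)
  have [measurable]: "f \<in> borel_measurable borel" "g \<in> borel_measurable borel"
    using f g by (auto intro: schwartz_measurable0)
  obtain B where B: "0 \<le> B" "\<And>x. norm (g x) \<le> B"
    using schwartz_bounded[OF g, of 0 "[]"] by auto
  have gc: "continuous_on UNIV g" using schwartz_cont[OF g, of "[]"] by simp
  have ib: "integrable lborel (\<lambda>w. B * norm (f w))" using fi by simp
  have nb: "norm (f w * g z) \<le> B * norm (f w)" for w z
    using B by (simp add: norm_mult mult.commute[of B] mult_left_mono)
  show "continuous_on UNIV (\<lambda>x. LBINT w. f w * g (x - w))"
    unfolding continuous_on_eq_continuous_at[OF open_UNIV] continuous_at_sequentially o_def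
  proof (intro ballI allI impI)
    fix x and X :: "nat \<Rightarrow> real^'n" assume X: "X \<longlonglongrightarrow> x"
    show "(\<lambda>n. LBINT w. f w * g (X n - w)) \<longlonglongrightarrow> (LBINT w. f w * g (x - w))"
    proof (rule integral_dominated_convergence[OF _ _ ib])
      show "AE w in lborel. (\<lambda>n. f w * g (X n - w)) \<longlonglongrightarrow> f w * g (x - w)"
      proof (intro AE_I2 tendsto_mult tendsto_const)
        fix w show "(\<lambda>n. g (X n - w)) \<longlonglongrightarrow> g (x - w)"
          using gc X by (intro isCont_tendsto_compose[of "x - w" g] tendsto_intros) (auto simp: continuous_on_eq_continuous_at)
      qed
    qed (use nb in auto)
  qed
  have "norm (LBINT w. f w * g (x - w)) \<le> (LBINT w. B * norm (f w))" for x
    by (rule Bochner_Integration.integral_norm_bound_integral[OF _ ib nb])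
       (rule Bochner_Integration.integrable_bound[OF ib], auto intro!: AE_I2 order_trans[OF nb])
  then show "\<exists>B. \<forall>x. norm (LBINT w. f w * g (x - w)) \<le> B" by blast
  define G where "G = (\<lambda>(w, x). f w * g (x - w))"
  have [measurable]: "G \<in> borel_measurable (lborel \<Otimes>\<^sub>M lborel)" unfolding G_def by measurable
  have gn: "(LBINT x. norm (g (x - w))) = (LBINT x. norm (g x))" for w
  proof -
    have "(LBINT x. norm (g (- w + 1 *\<^sub>R x))) = (LBINT x. norm (g x))"
      by (subst integral_affine[where f="\<lambda>x. norm (g x)"]) auto
    then show ?thesis by simp
  qed
  have gs: "integrable lborel (\<lambda>x. g (x - w))" for w
    using integrable_affine[OF gi, of 1 "-w"] by simp
  have int: "integrable (lborel \<Otimes>\<^sub>M lborel) G"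
  proof (rule lborel_pair.Fubini_integrable)
    have "(\<lambda>w. LBINT x. norm (G (w, x))) = (\<lambda>w. norm (f w) * (LBINT x. norm (g x)))"
      by (simp add: G_def norm_mult fun_eq_iff gn)
    then show "integrable lborel (\<lambda>w. LBINT x. norm (G (w, x)))" using fi by simp
    show "AE w in lborel. integrable lborel (\<lambda>x. G (w, x))"
      using gs by (auto simp: G_def)
  qed measurable
  show "integrable lborel (\<lambda>x. LBINT w. f w * g (x - w))"
    using lborel_pair.integrable_snd[of "\<lambda>w x. f w * g (x - w)"] int by (simp add: G_def)
  define c where "c x = cis (- 2 * pi * (x \<bullet> \<xi>))" for x :: "real^'n"
  have [measurable]: "c \<in> borel_measurable borel" unfolding c_def
    by (intro borel_measurable_continuous_onI continuous_intros)
  have c1: "norm (c x) = 1" for x by (simp add: c_def)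
  \<comment> \<open>Multiplicativity of the character splits the inner integral into a factor in w
    and the transform of \<open>g\<close>.\<close>
  have cc: "c x = c w * c (x - w)" for x w
    by (simp only: c_def cis_mult) (simp add: inner_diff_left algebra_simps)
  have intc: "integrable (lborel \<Otimes>\<^sub>M lborel) (\<lambda>p. G p * c (snd p))"
    by (rule Bochner_Integration.integrable_bound[OF int]) (auto simp: norm_mult c1)
  have "fourier (\<lambda>x. LBINT w. f w * g (x - w)) \<xi> = (LBINT x. (LBINT w. G (w, x) * c x))"
    unfolding fourier_def c_def[symmetric] G_def by simp
  also have "\<dots> = (LBINT w. (LBINT x. G (w, x) * c x))"
    using lborel_pair.Fubini_integral[of "\<lambda>w x. G (w, x) * c x"] intc by (simp add: case_prod_unfold)
  also have "\<dots> = (LBINT w. (f w * c w) * fourier g \<xi>)"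
  proof (rule Bochner_Integration.integral_cong[OF refl])
    fix w
    have "(LBINT x. G (w, x) * c x) = (LBINT x. (f w * c w) * (g (x - w) * c (x - w)))"
      by (intro Bochner_Integration.integral_cong refl, subst cc[of _ w]) (simp add: G_def)
    also have "\<dots> = (f w * c w) * (LBINT x. g (- w + 1 *\<^sub>R x) * c (- w + 1 *\<^sub>R x))"
      by simp
    also have "(LBINT x. g (- w + 1 *\<^sub>R x) * c (- w + 1 *\<^sub>R x)) = fourier g \<xi>"
    proof -
      have m: "(\<lambda>x. g x * c x) \<in> borel_measurable borel" by measurable
      show ?thesis unfolding integral_affine[OF m one_neq_zero] by (simp add: fourier_def c_def)
    qed
    finally show "(LBINT x. G (w, x) * c x) = (f w * c w) * fourier g \<xi>" .
  qed
  also have "\<dots> = fourier f \<xi> * fourier g \<xi>"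
    unfolding fourier_def[of f] c_def[symmetric] by (rule integral_mult_left_zero)
  finally show "fourier (\<lambda>x. LBINT w. f w * g (x - w)) \<xi> = fourier f \<xi> * fourier g \<xi>" .
qed

text \<open>Both sides have the same Fourier transform. Their difference is continuous, bounded and
  integrable, which is all that \<open>fourier_injective\<close> asks, so this avoids showing that
  the convolution is Schwartz.\<close>

lemma conv_fun_eqI:
  fixes f g h :: "'n::finite cfun"
  assumes f: "f \<in> schwartz" and g: "g \<in> schwartz" and h: "h \<in> schwartz"
    and F: "\<And>\<xi>. fourier f \<xi> * fourier g \<xi> = fourier h \<xi>"
  shows "(LBINT w. f w * g (x - w)) = h x"
proof -
  let ?D = "\<lambda>x. (LBINT w. f w * g (x - w)) - h x"
  obtain B where B: "\<And>x. norm (LBINT w. f w * g (x - w)) \<le> B" using conv_fun_bounded[OF f g] by blast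
  obtain B' where B': "\<And>x. norm (h x) \<le> B'" using schwartz_bounded[OF h, of 0 "[]"] by auto
  have hi: "integrable lborel h" by (rule schwartz_integrable0[OF h])
  have [measurable]: "h \<in> borel_measurable borel" by (rule schwartz_measurable0[OF h])
  have ci: "integrable lborel (\<lambda>x. F x * cis (- 2 * pi * (x \<bullet> \<xi>)))" if "integrable lborel F" for F and \<xi> :: "real^'n"
  proof -
    have "(\<lambda>x. cis (- 2 * pi * (x \<bullet> \<xi>))) \<in> borel_measurable borel"
      by (intro borel_measurable_continuous_onI continuous_intros)
    then show ?thesis using that
      by (intro Bochner_Integration.integrable_bound[OF that]) (auto simp: norm_mult)
  qed
  have "?D x = 0"
  proof (rule fourier_injective[where B="B + B'"])
    show "integrable lborel ?D" by (intro Bochner_Integration.integrable_diff conv_fun_integrable f g hi)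
    show "continuous_on UNIV ?D" using schwartz_cont[OF h, of "[]"] by (intro continuous_intros conv_fun_continuous f g) auto
    show "norm (?D x) \<le> B + B'" for x by (rule order_trans[OF norm_triangle_ineq4 add_mono[OF B B']])
    show "fourier ?D \<xi> = 0" for \<xi>
    proof -
      have "fourier ?D \<xi> = fourier (\<lambda>x. LBINT w. f w * g (x - w)) \<xi> - fourier h \<xi>"
        unfolding fourier_def left_diff_distrib
        by (intro Bochner_Integration.integral_diff ci conv_fun_integrable f g hi)
      then show ?thesis by (simp add: fourier_conv_fun[OF f g] F)
    qed
  qed
  then show ?thesis by simp
qed

abbreviation (input) low_pass :: "'n::finite cfun \<Rightarrow> bool" where
  "low_pass \<phi> \<equiv> \<forall>\<xi>. norm \<xi> > 2 \<longrightarrow> fourier \<phi> \<xi> = 0"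

abbreviation (input) unit_symbol :: "'n::finite cfun \<Rightarrow> bool" where
  "unit_symbol \<phi> \<equiv> \<forall>\<xi>. norm \<xi> \<le> 1 \<longrightarrow> fourier \<phi> \<xi> = 1"

text \<open>The summand 0 brings the dilation into the form of
  \<open>schwartz_affine\<close>.\<close>

lemma dil_eq: "dil \<phi> k = (\<lambda>x. of_real ((scl k) ^ CARD('n)) * \<phi> ((scl k) *\<^sub>R x + 0))"
  for \<phi> :: "'n::finite cfun"
  by (simp add: dil_def fun_eq_iff powr_powr[symmetric] powr_realpow)

lemma dil_schwartz: "\<phi> \<in> schwartz \<Longrightarrow> dil \<phi> k \<in> (schwartz :: 'n::finite cfun set)"
  unfolding dil_eq by (rule schwartz_affine) auto

lemma fourier_dil:
  fixes \<phi> :: "'n::finite cfun"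
  assumes "\<phi> \<in> schwartz"
  shows "fourier (dil \<phi> k) \<xi> = fourier \<phi> ((1 / scl k) *\<^sub>R \<xi>)"
proof -
  define s where "s = scl k"
  have s: "0 < s" by (simp add: s_def)
  define F where "F y = \<phi> y * cis (- 2 * pi * (y \<bullet> ((1 / s) *\<^sub>R \<xi>)))" for y
  have [measurable]: "\<phi> \<in> borel_measurable borel" using assms by (rule schwartz_measurable0)
  have [measurable]: "(\<lambda>y. cis (- 2 * pi * (y \<bullet> ((1 / s) *\<^sub>R \<xi>)))) \<in> borel_measurable borel"
    by (intro borel_measurable_continuous_onI continuous_intros)
  have m: "F \<in> borel_measurable borel" unfolding F_def by measurable
  have "fourier (dil \<phi> k) \<xi> = (LBINT x. of_real (s ^ CARD('n)) * F (0 + s *\<^sub>R x))"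
    unfolding fourier_def dil_eq s_def[symmetric] F_def using s by (simp add: mult_ac)
  also have "\<dots> = of_real (s ^ CARD('n)) * ((1 / \<bar>s\<bar> ^ DIM(real^'n)) *\<^sub>R (LBINT x. F x))"
    using s by (simp only: integral_mult_right_zero integral_affine[OF m, of s 0])
  also have "\<dots> = (LBINT x. F x)" using s by (simp add: scaleR_conv_of_real)
  finally show ?thesis by (simp add: fourier_def F_def s_def)
qed

text \<open>The symbol of \<open>dil \<phi> j\<close> is 1 up to radius 2^j, and that of
  \<open>dil \<phi> k\<close> vanishes beyond 2^(k+1), which is at most 2^j. So at each frequency
  the first symbol is 1 or the second is 0.\<close>

lemma dil_conv_dil:
  fixes \<phi> :: "'n::finite cfun"
  assumes \<phi>: "\<phi> \<in> schwartz" and "low_pass \<phi>" and "unit_symbol \<phi>"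
    and jk: "k < j"
  shows "(LBINT w. dil \<phi> j w * dil \<phi> k (x - w)) = dil \<phi> k x"
proof (rule conv_fun_eqI[OF dil_schwartz dil_schwartz dil_schwartz, OF \<phi> \<phi> \<phi>])
  fix \<xi> :: "real^'n"
  show "fourier (dil \<phi> j) \<xi> * fourier (dil \<phi> k) \<xi> = fourier (dil \<phi> k) \<xi>"
  proof (cases "norm \<xi> \<le> scl j")
    case True
    then have "norm ((1 / scl j) *\<^sub>R \<xi>) \<le> 1" by simp
    then show ?thesis using assms(3) by (simp add: fourier_dil[OF \<phi>])
  next
    case False
    have "2 * scl k = 2 powr (real_of_int k + 1)" by (simp add: powr_add)
    also have "\<dots> \<le> scl j" using jk by (intro powr_mono) auto
    finally have "2 < norm ((1 / scl k) *\<^sub>R \<xi>)" using False by (simp add: field_simps)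
    then show ?thesis using assms(2) by (simp add: fourier_dil[OF \<phi>])
  qed
qed

section \<open>The upper bound\<close>

lemma norm_le_card:
  fixes v :: "real^'n::finite"
  assumes "\<And>i. \<bar>v $ i\<bar> \<le> 1"
  shows "norm v \<le> real CARD('n)"
proof -
  have "norm v \<le> (\<Sum>i\<in>UNIV. \<bar>v $ i\<bar>)" by (rule norm_le_l1_cart)
  also have "\<dots> \<le> (\<Sum>i\<in>(UNIV::'n set). 1)" using assms by (intro sum_mono) auto
  finally show ?thesis by simp
qed

text \<open>Indices are written \<open>l + m\<close> so that cubes can be counted from the one
  containing a given point.\<close>

lemma nn_integral_cubes:
  fixes F :: "real^'n::finite \<Rightarrow> ennreal"
  assumes [measurable]: "F \<in> borel_measurable borel"
  shows "(\<integral>\<^sup>+ w. F w \<partial>lborel) = (\<integral>\<^sup>+ m. (\<integral>\<^sup>+ w. F w * indicator (cube k (l + m)) w \<partial>lborel) \<partial>count_space UNIV)"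
proof -
  let ?\<nu> = "density lborel F"
  have U: "(\<Union>m. cube k (l + m)) = (UNIV :: (real^'n) set)"
  proof -
    have "x \<in> cube k (l + (cell k x - l))" for x by (simp add: cube_def)
    then show ?thesis by blast
  qed
  have "(\<integral>\<^sup>+ w. F w \<partial>lborel) = emeasure ?\<nu> (\<Union>m. cube k (l + m))"
    unfolding U by (subst emeasure_density) auto
  also have "\<dots> = (\<integral>\<^sup>+ m. emeasure ?\<nu> (cube k (l + m)) \<partial>count_space UNIV)"
    by (rule emeasure_UN_countable) (auto simp: disjoint_family_on_def cube_def)
  also have "\<dots> = (\<integral>\<^sup>+ m. (\<integral>\<^sup>+ w. F w * indicator (cube k (l + m)) w \<partial>lborel) \<partial>count_space UNIV)"
    by (intro nn_integral_cong) (simp add: emeasure_density)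
  finally show ?thesis .
qed

lemma cell_scale: "cell 0 ((scl k) *\<^sub>R x) = cell k x"
  by (simp add: cell_def)

lemma cell_0_bounds: "0 \<le> w $ i - real_of_int (cell 0 w $ i)" "w $ i - real_of_int (cell 0 w $ i) \<le> 1"
  by (simp_all add: cell_def) linarith

lemma norm_diff_cell: "norm (w - ivec (cell 0 w)) \<le> real CARD('n)" for w :: "real^'n::finite"
proof (rule norm_le_card)
  fix i show "\<bar>(w - ivec (cell 0 w)) $ i\<bar> \<le> 1" using cell_0_bounds[of w i] by (simp add: ivec_def)
qed

text \<open>A unit cube in the variable multiplied by 2^k is a cube of generation \<open>k\<close>,
  and the Jacobian is the normalisation of the average.\<close>

lemma cube_avg_scale:
  fixes H :: "real^'n::finite \<Rightarrow> ennreal"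
  assumes [measurable]: "H \<in> borel_measurable borel"
  shows "(\<integral>\<^sup>+ w. H ((1 / scl k) *\<^sub>R w) * indicator (cube 0 l) w \<partial>lborel) = cube_avg H k l"
proof -
  define s where "s = scl k"
  have s: "0 < s" by (simp add: s_def)
  have "indicator (cube 0 l) w = (indicator (cube k l) ((1 / s) *\<^sub>R w) :: ennreal)" for w
    using cell_scale[of k "(1 / s) *\<^sub>R w"] s by (simp add: cube_def indicator_def s_def[symmetric])
  then have "(\<integral>\<^sup>+ w. H ((1 / s) *\<^sub>R w) * indicator (cube 0 l) w \<partial>lborel)
    = (\<integral>\<^sup>+ w. (\<lambda>x. H x * indicator (cube k l) x) (0 + (1 / s) *\<^sub>R w) \<partial>lborel)" by simp
  also have "\<dots> = cube_avg H k l"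
    using s by (subst nn_integral_affine) (auto simp: cube_avg_def s_def[symmetric] power_one_over)
  finally show ?thesis by (simp add: s_def)
qed

lemma one_add_le_mult:
  assumes "a \<le> b + n" "0 \<le> n" "0 \<le> (b::real)"
  shows "1 + a \<le> (1 + n) * (1 + b)"
proof -
  have "0 \<le> n * b" using assms by simp
  then show ?thesis using assms(1) by (simp add: algebra_simps)
qed

text \<open>On a unit cube the weight varies by at most a factor (1 + n)^(2n), so the sum is
  dominated by an integral over the whole space, which by translation invariance does not see
  \<open>y\<close>. The summand 1 in the constant makes it positive.\<close>

lemma lattice_sum:
  obtains C where "0 < C" "\<And>(y::real^'n::finite) (a::real). 2 * CARD('n) \<le> a \<Longrightarrow>
    (\<integral>\<^sup>+ m. ennreal ((1 + norm (ivec m + y)) powr (- a)) \<partial>count_space UNIV) \<le> ennreal C"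
proof -
  define n where "n = real CARD('n)"
  have n0: "0 \<le> n" by (simp add: n_def)
  have "(\<integral>\<^sup>+ (x::real^'n). ennreal ((1 + norm x) powr (- (2 * n))) \<partial>lborel) < \<infinity>"
    by (rule nn_integral_weight_finite) (simp add: n_def)
  then obtain c where c: "0 \<le> c" "(\<integral>\<^sup>+ (x::real^'n). ennreal ((1 + norm x) powr (- (2 * n))) \<partial>lborel) = ennreal c"
    by (cases "\<integral>\<^sup>+ (x::real^'n). ennreal ((1 + norm x) powr (- (2 * n))) \<partial>lborel") auto
  show ?thesis
  proof (rule that[of "(1 + n) powr (2 * n) * c + 1"])
    show "0 < (1 + n) powr (2 * n) * c + 1" using c by (intro add_nonneg_pos) auto
    fix y :: "real^'n" and a :: real assume a: "2 * CARD('n) \<le> a"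
    let ?f = "\<lambda>w. ennreal ((1 + n) powr (2 * n)) * ennreal ((1 + norm (w + y)) powr (- (2 * n)))"
    have W: "1 \<le> 1 + norm x" "0 < 1 + norm x" for x :: "real^'n" by (auto simp: add_pos_nonneg)
    have "(\<integral>\<^sup>+ m. ennreal ((1 + norm (ivec m + y)) powr (- a)) \<partial>count_space UNIV)
      \<le> (\<integral>\<^sup>+ m. (\<integral>\<^sup>+ w. ?f w * indicator (cube 0 (0 + m)) w \<partial>lborel) \<partial>count_space UNIV)"
    proof (rule nn_integral_mono)
      fix m :: "int^'n"
      have "ennreal ((1 + norm (ivec m + y)) powr (- a)) = (\<integral>\<^sup>+ w. ennreal ((1 + norm (ivec m + y)) powr (- a)) * indicator (cube 0 m) w \<partial>lborel)"
        by (subst nn_integral_cmult_indicator) (auto simp: emeasure_cube)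
      also have "\<dots> \<le> (\<integral>\<^sup>+ w. ?f w * indicator (cube 0 (0 + m)) w \<partial>lborel)"
      proof (rule nn_integral_mono)
        fix w :: "real^'n"
        show "ennreal ((1 + norm (ivec m + y)) powr (- a)) * indicator (cube 0 m) w
          \<le> ?f w * indicator (cube 0 (0 + m)) w"
        proof (cases "w \<in> cube 0 m")
          case True
          then have m: "cell 0 w = m" by (simp add: cube_def)
          have "norm (w + y) \<le> norm (w - ivec m) + norm (ivec m + y)"
            using norm_triangle_ineq[of "w - ivec m" "ivec m + y"] by simp
          also have "norm (w - ivec m) \<le> n" using norm_diff_cell[of w] by (simp add: m n_def)
          finally have "1 + norm (w + y) \<le> (1 + n) * (1 + norm (ivec m + y))"
            by (intro one_add_le_mult n0 norm_ge_zero) (simp only: add.commute)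
          then have "(1 + norm (w + y)) powr (2 * n) \<le> ((1 + n) * (1 + norm (ivec m + y))) powr (2 * n)"
            using n0 by (intro powr_mono2) auto
          also have "\<dots> = (1 + n) powr (2 * n) * (1 + norm (ivec m + y)) powr (2 * n)"
            by (rule powr_mult)
          finally have "(1 + norm (ivec m + y)) powr (- (2 * n)) \<le> (1 + n) powr (2 * n) * (1 + norm (w + y)) powr (- (2 * n))"
            using W[of "ivec m + y"] W[of "w + y"] by (simp add: powr_minus field_simps)
          moreover have "(1 + norm (ivec m + y)) powr (- a) \<le> (1 + norm (ivec m + y)) powr (- (2 * n))"
            using a by (intro powr_mono) (auto simp: n_def)
          ultimately show ?thesis using True by (simp add: ennreal_mult[symmetric] ennreal_leI)
        qed (simp add: cube_def)
      qed
      finally show "ennreal ((1 + norm (ivec m + y)) powr (- a)) \<le> (\<integral>\<^sup>+ w. ?f w * indicator (cube 0 (0 + m)) w \<partial>lborel)" .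
    qed
    also have "\<dots> = (\<integral>\<^sup>+ w. ?f w \<partial>lborel)"
      by (rule nn_integral_cubes[symmetric]) measurable
    also have "\<dots> = ennreal ((1 + n) powr (2 * n)) * (\<integral>\<^sup>+ w. ennreal ((1 + norm (w + y)) powr (- (2 * n))) \<partial>lborel)"
      by (rule nn_integral_cmult) measurable
    also have "(\<integral>\<^sup>+ w. ennreal ((1 + norm (w + y)) powr (- (2 * n))) \<partial>lborel)
       = (\<integral>\<^sup>+ w. (\<lambda>w. ennreal ((1 + norm w) powr (- (2 * n)))) (y + 1 *\<^sub>R w) \<partial>lborel)" by (simp add: add.commute)
    also have "\<dots> = ennreal c" by (subst nn_integral_affine) (auto simp: c(2))
    also have "ennreal ((1 + n) powr (2 * n)) * ennreal c \<le> ennreal ((1 + n) powr (2 * n) * c + 1)"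
      using c by (simp add: ennreal_mult[symmetric] ennreal_leI)
    finally show "(\<integral>\<^sup>+ m. ennreal ((1 + norm (ivec m + y)) powr (- a)) \<partial>count_space UNIV) \<le> ennreal ((1 + n) powr (2 * n) * c + 1)" .
  qed
qed

text \<open>From ln(e + a) <= ln(e + c) + ln(1 + b/(e + c)) <= ln(e + c) + b and ln(e + c) >= 1. It
  exchanges ln(e + |m|) for ln(e + |y|) at the cost of a factor 1 + |m + y|.\<close>

lemma ln_shift_le:
  assumes "a \<le> b + c" "0 \<le> b" "0 \<le> c" "0 \<le> a"
  shows "ln (exp 1 + a) \<le> (1 + b) * ln (exp 1 + (c::real))"
proof -
  have e: "1 \<le> exp (1::real)" by simp
  have p: "0 < exp 1 + c" using assms by (simp add: add_pos_nonneg)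
  have l1: "1 \<le> ln (exp 1 + c)" using assms p by (subst ln_ge_iff) auto
  have eq: "(exp 1 + c) * (1 + b / (exp 1 + c)) = exp 1 + c + b"
    using p by (simp add: distrib_left less_imp_neq[OF p, symmetric])
  have "ln (exp 1 + a) \<le> ln ((exp 1 + c) * (1 + b / (exp 1 + c)))"
    unfolding eq using assms by (subst ln_le_cancel_iff) (auto simp: add_pos_nonneg)
  also have "\<dots> = ln (exp 1 + c) + ln (1 + b / (exp 1 + c))"
    using assms p by (intro ln_mult_pos) (auto simp: add_pos_nonneg)
  also have "ln (1 + b / (exp 1 + c)) \<le> b / (exp 1 + c)"
    using assms p by (intro ln_add_one_self_le_self) auto
  also have "b / (exp 1 + c) \<le> b"
  proof -
    have "b * 1 \<le> b * (exp 1 + c)" using assms(2,3) e by (intro mult_left_mono add_increasing2)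
    then show ?thesis using p by (simp add: pos_divide_le_eq)
  qed
  also have "b \<le> b * ln (exp 1 + c)" using mult_left_mono[OF l1 assms(2)] by (simp only: mult_1_right)
  finally show ?thesis by (simp add: algebra_simps)
qed

section \<open>Peetre's inequality at every scale and the passage to shifted maximal
  functions\<close>

lemma conv_dil_shift:
  "conv (dil_shift \<phi> k y) u x = conv (dil \<phi> k) u (x - (1 / scl k) *\<^sub>R y)"
proof -
  define s where "s = scl k"
  have s: "s \<noteq> 0" by (simp add: s_def)
  have "s *\<^sub>R (x - t) - y = s *\<^sub>R (x - (1 / s) *\<^sub>R y - t)" for t
    using s by (simp add: scaleR_diff_right)
  then show ?thesis by (simp add: conv_def dil_def dil_shift_def s_def[symmetric])
qed

text \<open>Measuring lengths in units of 2^-k makes the kernel and the constants in Peetre's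
  inequality the same for all \<open>k\<close>.\<close>

abbreviation (input) rescaled :: "'n::finite cfun \<Rightarrow> ('n cfun \<Rightarrow> complex) \<Rightarrow> int \<Rightarrow> real^'n \<Rightarrow> real" where
  "rescaled \<phi> u k z \<equiv> norm (conv (dil \<phi> k) u ((1 / scl k) *\<^sub>R z))"

text \<open>This is \<open>dil_conv_dil\<close> for the pair k + 1, k, carried through the
  distribution and rescaled: at every scale the kernel becomes \<open>dil \<phi> 1\<close>.\<close>

lemma conv_rep:
  fixes \<phi> :: "'n::finite cfun"
  assumes \<phi>: "\<phi> \<in> schwartz" "low_pass \<phi>" "unit_symbol \<phi>"
    and u: "u \<in> tempered"
  defines "g k z \<equiv> rescaled \<phi> u k z"
  shows "ennreal (g k z) \<le> (\<integral>\<^sup>+ w. ennreal (norm (dil \<phi> 1 (z - w)) * g k w) \<partial>lborel)"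
proof -
  define s where "s = scl k"
  have s: "0 < s" by (simp add: s_def)
  define f where "f = conv (dil \<phi> k) u"
  have [measurable]: "f \<in> borel_measurable borel"
    unfolding f_def by (intro borel_measurable_continuous_onI conv_continuous dil_schwartz \<phi> u)
  have [measurable]: "dil \<phi> j \<in> borel_measurable borel" for j
    by (intro schwartz_measurable0 dil_schwartz \<phi>)
  have eq: "f x = (LBINT w. dil \<phi> (k + 1) w * f (x - w))" for x
    unfolding f_def
    by (rule tempered_conv_commute[OF dil_schwartz dil_schwartz dil_schwartz _ u, OF \<phi>(1) \<phi>(1) \<phi>(1)])
       (rule dil_conv_dil[OF \<phi>, symmetric], simp)
  have "ennreal (g k z) = ennreal (norm (f ((1/s) *\<^sub>R z)))" by (simp add: g_def f_def s_def)
  also have "\<dots> \<le> (\<integral>\<^sup>+ w. ennreal (norm (dil \<phi> (k + 1) w * f ((1/s) *\<^sub>R z - w))) \<partial>lborel)"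
  \<comment> \<open>The integral in \<open>eq\<close> is 0 by convention if the integrand is not
    integrable, and the bound is then trivial.\<close>
  proof (cases "integrable lborel (\<lambda>w. dil \<phi> (k + 1) w * f ((1/s) *\<^sub>R z - w))")
    case True
    then show ?thesis by (subst eq) (rule integral_norm_bound_ennreal)
  next
    case False
    then show ?thesis by (subst eq) (simp add: not_integrable_integral_eq)
  qed
  also have "\<dots> = ennreal (1 / s ^ CARD('n)) * (\<integral>\<^sup>+ w. (\<lambda>w. ennreal (norm (dil \<phi> (k + 1) w * f ((1/s) *\<^sub>R z - w)))) ((1/s) *\<^sub>R z + (- (1/s)) *\<^sub>R w) \<partial>lborel)"
    using s by (subst nn_integral_affine) (auto simp: power_one_over mult.assoc[symmetric] ennreal_mult[symmetric])
  also have "\<dots> = (\<integral>\<^sup>+ w. ennreal (1 / s ^ CARD('n)) * ennreal (norm (dil \<phi> (k + 1) ((1/s) *\<^sub>R z + (- (1/s)) *\<^sub>R w) * f ((1/s) *\<^sub>R w))) \<partial>lborel)"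
    by (subst nn_integral_cmult) auto
  also have "\<dots> = (\<integral>\<^sup>+ w. ennreal (norm (dil \<phi> 1 (z - w)) * g k w) \<partial>lborel)"
  proof (rule nn_integral_cong)
    fix w
    have "(1/s) *\<^sub>R z + (- (1/s)) *\<^sub>R w = (1/s) *\<^sub>R (z - w)" by (simp add: scaleR_diff_right)
    moreover have "scl (k + 1) = s * 2" by (simp add: s_def powr_add)
    ultimately have "norm (dil \<phi> (k + 1) ((1/s) *\<^sub>R z + (- (1/s)) *\<^sub>R w)) = s ^ CARD('n) * norm (dil \<phi> 1 (z - w))"
      using s unfolding dil_eq by (simp add: norm_mult norm_power power_mult_distrib)
    then show "ennreal (1 / s ^ CARD('n)) * ennreal (norm (dil \<phi> (k + 1) ((1/s) *\<^sub>R z + (- (1/s)) *\<^sub>R w) * f ((1/s) *\<^sub>R w)))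
       = ennreal (norm (dil \<phi> 1 (z - w)) * g k w)"
      using s by (simp add: ennreal_mult[symmetric] norm_mult g_def f_def s_def)
  qed
  finally show ?thesis .
qed

text \<open>\<open>peetre\<close> is applied with N = M / r, because its weight has exponent N r.
  The growth bound for the rescaled function depends on \<open>u\<close> and \<open>k\<close>, but
  only its existence is asked for, so \<open>C\<close> is uniform in both.\<close>

lemma peetre_dil:
  fixes \<phi> :: "'n::finite cfun"
  assumes \<phi>: "\<phi> \<in> schwartz" "low_pass \<phi>" "unit_symbol \<phi>"
    and r: "0 < r" "r < 1" and M: "0 \<le> M"
  obtains C where "0 < C" "\<And>u k z. u \<in> tempered \<Longrightarrow>
    ennreal (rescaled \<phi> u k z powr r)
     \<le> ennreal C * (\<integral>\<^sup>+ w. ennreal (rescaled \<phi> u k w powr r * (1 + norm (z - w)) powr (- M)) \<partial>lborel)"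
proof -
  have K: "\<exists>C. \<forall>v. norm (dil \<phi> 1 v) \<le> C * (1 + norm v) powr (- N)" for N
    using schwartz_decay[OF dil_schwartz[OF \<phi>(1), of 1], of "[]" N] by auto
  have "0 \<le> M / r" using M r by simp
  from peetre[OF r this K] obtain C where C: "0 < C" "\<And>g x. g \<in> borel_measurable borel \<Longrightarrow> (\<And>z. 0 \<le> g z) \<Longrightarrow>
     (\<And>z. ennreal (g z) \<le> (\<integral>\<^sup>+ w. ennreal (norm (dil \<phi> 1 (z - w)) * g w) \<partial>lborel)) \<Longrightarrow>
     (\<exists>B M. \<forall>z. g z \<le> B * (1 + norm z) powr M) \<Longrightarrow>
     ennreal (g x powr r) \<le> ennreal C * (\<integral>\<^sup>+ w. ennreal (g w powr r * (1 + norm (x - w)) powr (- (M / r) * r)) \<partial>lborel)"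
    by blast
  show ?thesis
  proof (rule that[OF C(1)])
    fix u :: "'n cfun \<Rightarrow> complex" and k z assume u: "u \<in> tempered"
    define s where "s = scl k"
    have s: "0 < s" by (simp add: s_def)
    define g where "g z = norm (conv (dil \<phi> k) u ((1 / s) *\<^sub>R z))" for z
    have "continuous_on UNIV g" unfolding g_def
      by (intro continuous_intros continuous_on_compose2[OF conv_continuous[OF dil_schwartz[OF \<phi>(1)] u]]) auto
    then have gm: "g \<in> borel_measurable borel" by (rule borel_measurable_continuous_onI)
    obtain B N where B: "0 \<le> B" "\<And>x. norm (conv (dil \<phi> k) u x) \<le> B * (1 + norm x) ^ N"
      using conv_growth[OF dil_schwartz[OF \<phi>(1)] u] by blast
    have "g z \<le> (B * (1 + 1 / s) ^ N) * (1 + norm z) powr real N" for z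
    proof -
      have p: "(1 + norm z) powr real N = (1 + norm z) ^ N" by (rule powr_realpow) (simp add: add_pos_nonneg)
      have "norm ((1/s) *\<^sub>R z) = (1/s) * norm z" using s by simp
      then have "1 + norm ((1/s) *\<^sub>R z) \<le> (1 + 1 / s) * (1 + norm z)" using s by (simp add: algebra_simps)
      then have "g z \<le> B * ((1 + 1 / s) * (1 + norm z)) ^ N"
        unfolding g_def by (intro order_trans[OF B(2)] mult_left_mono power_mono B) auto
      then show ?thesis by (simp only: p power_mult_distrib mult.assoc)
    qed
    then have "\<exists>B M. \<forall>z. g z \<le> B * (1 + norm z) powr M" by blast
    from C(2)[OF gm _ _ this, of z] conv_rep[OF \<phi> u, of k]
    have "ennreal (g z powr r) \<le> ennreal C * (\<integral>\<^sup>+ w. ennreal (g w powr r * (1 + norm (z - w)) powr (- (M / r) * r)) \<partial>lborel)"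
      by (simp add: g_def s_def)
    then show "ennreal (rescaled \<phi> u k z powr r)
     \<le> ennreal C * (\<integral>\<^sup>+ w. ennreal (rescaled \<phi> u k w powr r * (1 + norm (z - w)) powr (- M)) \<partial>lborel)"
      using r by (simp add: g_def s_def)
  qed
qed

text \<open>The exponent M + b is split: decay of order M stays with the shifted maximal functions
  under the supremum, and decay of order b makes the sum over the cubes converge.\<close>

lemma lattice_maximal_bound:
  fixes h H :: "real^'n::finite \<Rightarrow> ennreal"
  assumes [measurable]: "h \<in> borel_measurable borel" "H \<in> borel_measurable borel"
    and hH: "\<And>w. h w \<le> H ((1 / scl k) *\<^sub>R w)" and M: "0 \<le> M" "0 \<le> b"
    and C: "0 < C" "\<And>y::real^'n. (\<integral>\<^sup>+ m. ennreal ((1 + norm (ivec m + y)) powr (- b)) \<partial>count_space UNIV) \<le> ennreal C"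
  shows "(\<integral>\<^sup>+ w. h w * ennreal ((1 + norm ((scl k) *\<^sub>R x - y - w)) powr (- (M + b))) \<partial>lborel)
    \<le> ennreal ((1 + CARD('n)) powr (M + b) * C) * (SUP m. ennreal ((1 + norm (ivec m + y)) powr (- M)) * shifted_max m H x)"
proof -
  define s where "s = scl k"
  define n where "n = real CARD('n)"
  have n0: "0 \<le> n" by (simp add: n_def)
  define z where "z = s *\<^sub>R x - y"
  let ?S = "SUP m. ennreal ((1 + norm (ivec m + y)) powr (- M)) * shifted_max m H x"
  have W: "1 \<le> 1 + norm x" "0 < 1 + norm x" for x :: "real^'n" by (auto simp: add_pos_nonneg)
  have l0: "cell 0 (s *\<^sub>R x) = cell k x" unfolding s_def by (rule cell_scale)
  let ?Z = "count_space (UNIV :: (int^'n) set)" and ?Q = "\<lambda>m. cube 0 (cell k x + m)"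
  let ?f = "\<lambda>w. h w * ennreal ((1 + norm (z - w)) powr (- (M + b)))"
  have "(\<integral>\<^sup>+ w. ?f w \<partial>lborel)
    = (\<integral>\<^sup>+ m. (\<integral>\<^sup>+ w. ?f w * indicator (?Q m) w \<partial>lborel) \<partial>?Z)"
    by (rule nn_integral_cubes) measurable
  also have "\<dots> \<le> (\<integral>\<^sup>+ m. (ennreal ((1 + n) powr (M + b)) * ?S) * ennreal ((1 + norm (ivec m + y)) powr (- b)) \<partial>?Z)"
  proof (rule nn_integral_mono)
    fix m :: "int^'n"
    let ?d = "1 + norm (ivec m + y)"
    let ?a = "\<lambda>m. ennreal ((1 + n) powr (M + b) * ?d powr (- (M + b)))"
    have "(\<integral>\<^sup>+ w. ?f w * indicator (?Q m) w \<partial>lborel)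
      \<le> (\<integral>\<^sup>+ w. ?a m * (H ((1 / s) *\<^sub>R w) * indicator (?Q m) w) \<partial>lborel)"
    proof (rule nn_integral_mono)
      fix w
      show "?f w * indicator (?Q m) w
        \<le> ?a m * (H ((1 / s) *\<^sub>R w) * indicator (?Q m) w)"
      proof (cases "w \<in> ?Q m")
        case True
        then have w: "cell 0 w = cell k x + m" by (simp add: cube_def)
        \<comment> \<open>Both points are compared with the corners of their unit cubes. The
          difference of two fractional parts has coordinates in [-1, 1], so |m + y| exceeds |z - w|
          by at most n.\<close>
        have "ivec m + y = - (z - w) + ((s *\<^sub>R x - ivec (cell 0 (s *\<^sub>R x))) - (w - ivec (cell 0 w)))"
          by (simp add: w l0 z_def vec_eq_iff ivec_def)
        then have "norm (ivec m + y) \<le> norm (- (z - w)) + norm ((s *\<^sub>R x - ivec (cell 0 (s *\<^sub>R x))) - (w - ivec (cell 0 w)))"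
          by (metis norm_triangle_ineq)
        also have "norm ((s *\<^sub>R x - ivec (cell 0 (s *\<^sub>R x))) - (w - ivec (cell 0 w))) \<le> n"
          unfolding n_def
        proof (rule norm_le_card)
          fix i show "\<bar>((s *\<^sub>R x - ivec (cell 0 (s *\<^sub>R x))) - (w - ivec (cell 0 w))) $ i\<bar> \<le> 1"
            using cell_0_bounds[of w i] cell_0_bounds[of "s *\<^sub>R x" i] by (simp add: ivec_def abs_le_iff)
        qed
        finally have "norm (ivec m + y) \<le> norm (z - w) + n" by (simp only: norm_minus_cancel)
        then have "?d \<le> (1 + n) * (1 + norm (z - w))"
          by (intro one_add_le_mult n0 norm_ge_zero)
        then have "?d powr (M + b) \<le> ((1 + n) * (1 + norm (z - w))) powr (M + b)"
          using M by (intro powr_mono2) auto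
        also have "\<dots> = (1 + n) powr (M + b) * (1 + norm (z - w)) powr (M + b)" by (rule powr_mult)
        finally have "(1 + norm (z - w)) powr (- (M + b)) \<le> (1 + n) powr (M + b) * ?d powr (- (M + b))"
          unfolding powr_minus using W[of "ivec m + y"] W[of "z - w"] by (simp add: field_simps)
        then show ?thesis using True hH[of w]
          by (simp add: s_def mult.commute[of "h w"] mult_mono ennreal_leI)
      qed simp
    qed
    also have "\<dots> = ?a m * cube_avg H k (cell k x + m)"
      unfolding s_def by (subst nn_integral_cmult) (auto simp: cube_avg_scale)
    also have "\<dots> \<le> ?a m * shifted_max m H x"
      unfolding shifted_max_def by (intro mult_left_mono SUP_upper) auto
    also have "\<dots> = ennreal ((1 + n) powr (M + b)) * (ennreal (?d powr (- M)) * shifted_max m H x) * ennreal (?d powr (- b))"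
    proof -
      have "?d powr (- (M + b)) = ?d powr (- M) * ?d powr (- b)" by (simp add: powr_add[symmetric])
      then show ?thesis by (simp add: ennreal_mult mult_ac)
    qed
    also have "\<dots> \<le> ennreal ((1 + n) powr (M + b)) * ?S * ennreal (?d powr (- b))"
      by (intro mult_right_mono mult_left_mono SUP_upper) auto
    finally show "(\<integral>\<^sup>+ w. ?f w * indicator (?Q m) w \<partial>lborel)
       \<le> (ennreal ((1 + n) powr (M + b)) * ?S) * ennreal (?d powr (- b))" .
  qed
  also have "\<dots> = (ennreal ((1 + n) powr (M + b)) * ?S) * (\<integral>\<^sup>+ m. ennreal ((1 + norm (ivec m + y)) powr (- b)) \<partial>?Z)"
    by (rule nn_integral_cmult) simp
  also have "\<dots> \<le> (ennreal ((1 + n) powr (M + b)) * ?S) * ennreal C"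
    by (intro mult_left_mono C) auto
  also have "\<dots> = ennreal ((1 + n) powr (M + b) * C) * ?S"
    using C by (simp add: ennreal_mult mult_ac)
  finally show ?thesis by (simp add: z_def s_def n_def)
qed

lemma measurable_maxfun_dil:
  fixes \<phi> :: "'n::finite cfun"
  assumes "\<phi> \<in> schwartz" "u \<in> tempered"
  shows "maxfun (dil \<phi>) u \<in> borel_measurable borel"
proof -
  have "conv (dil \<phi> k) u \<in> borel_measurable borel" for k
    by (intro borel_measurable_continuous_onI conv_continuous dil_schwartz assms)
  then show ?thesis unfolding maxfun_def[abs_def] by (intro borel_measurable_SUP) auto
qed

lemma shifted_maximal_bound:
  fixes p :: real and \<phi> :: "'n::finite cfun"
  assumes p: "0 < p"
    and \<phi>: "\<phi> \<in> schwartz" "low_pass \<phi>" "unit_symbol \<phi>"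
  shows "\<exists>C::real. \<forall>y f. f \<in> Hp p \<phi> \<longrightarrow>
            Lp_norm p (maxfun (\<lambda>k. dil_shift \<phi> k y) f)
              \<le> ennreal C * ennreal (ln (exp 1 + norm y) powr (1 / p)) * Hp_norm p \<phi> f"
proof -
  \<comment> \<open>The strong type bound asks for q > 2, Peetre's inequality for r < 1, and q r = p
    leads back to the integral of F^p.\<close>
  define q where "q = p + 2"
  define r where "r = p / q"
  define b where "b = 2 * real CARD('n)"
  \<comment> \<open>\<open>b\<close> is an order at which the lattice sum converges; the extra 1
    pays for the factor 1 + |m + y| from \<open>ln_shift_le\<close>.\<close>
  define M where "M = b + 1"
  have q: "2 < q" "0 < q" and r: "0 < r" "r < 1" "q * r = p" and bM: "0 \<le> b" "0 \<le> M"
    using p by (auto simp: q_def r_def b_def M_def)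
  obtain C1 where C1: "0 < C1" "\<And>u k z. u \<in> tempered \<Longrightarrow>
    ennreal (rescaled \<phi> u k z powr r)
     \<le> ennreal C1 * (\<integral>\<^sup>+ w. ennreal (rescaled \<phi> u k w powr r * (1 + norm (z - w)) powr (- (M + b))) \<partial>lborel)"
    using peetre_dil[OF \<phi> r(1,2) add_nonneg_nonneg[OF bM(2,1)]] by blast
  obtain C2 where C2: "0 < C2" "\<And>(y::real^'n) (a::real). 2 * CARD('n) \<le> a \<Longrightarrow>
    (\<integral>\<^sup>+ m. ennreal ((1 + norm (ivec m + y)) powr (- a)) \<partial>count_space UNIV) \<le> ennreal C2"
    using lattice_sum[where 'n='n] by blast
  obtain C3 where C3: "0 \<le> C3" "\<And>(H :: real^'n \<Rightarrow> ennreal) m. H \<in> borel_measurable borel \<Longrightarrow>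
    (\<integral>\<^sup>+ x. epowr q (shifted_max m H x) \<partial>lborel) \<le> ennreal (C3 * ln (exp 1 + norm (ivec m))) * (\<integral>\<^sup>+ x. epowr q (H x) \<partial>lborel)"
    using shifted_max_strong_type[OF q(1), where 'n='n] by blast
  define K where "K = C1 * ((1 + CARD('n)) powr (M + b) * C2)"
  have K: "0 \<le> K" using C1 C2 by (simp add: K_def)
  define C where "C = K powr q * C3 * C2"
  have C: "0 \<le> C" using C2 C3 by (simp add: C_def)
  show ?thesis
  proof (intro exI allI impI)
    fix y :: "real^'n" and u assume "u \<in> Hp p \<phi>"
    then have u: "u \<in> tempered" by (simp add: Hp_def)
    define F where "F = maxfun (dil \<phi>) u"
    define H where "H x = epowr r (F x)" for x
    have Fm [measurable]: "F \<in> borel_measurable borel" unfolding F_def by (rule measurable_maxfun_dil[OF \<phi>(1) u])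
    have Hm [measurable]: "H \<in> borel_measurable borel" unfolding H_def[abs_def] by measurable
    define G where "G = maxfun (\<lambda>k. dil_shift \<phi> k y) u"
    define om where "om m = 1 + norm (ivec m + y)" for m
    have om: "1 \<le> om m" for m by (simp add: om_def)
    let ?o = "\<lambda>m. om m powr (- M * q)" and ?Z = "count_space (UNIV :: (int^'n) set)"
    let ?t = "\<lambda>m x. ennreal (?o m) * epowr q (shifted_max m H x)"
    let ?S = "\<lambda>x. SUP m. ennreal (om m powr (- M)) * shifted_max m H x"
    have G_r: "epowr r (G x) \<le> ennreal K * ?S x" for x
      unfolding G_def maxfun_def epowr_SUP[OF r(1)]
    proof (rule SUP_least)
      fix k
      define s where "s = scl k"
      have s: "0 < s" by (simp add: s_def)
      define g where "g w = ennreal (norm (conv (dil \<phi> k) u ((1 / s) *\<^sub>R w)) powr r)" for w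
      have [measurable]: "conv (dil \<phi> k) u \<in> borel_measurable borel"
        by (intro borel_measurable_continuous_onI conv_continuous dil_schwartz \<phi> u)
      have gm: "g \<in> borel_measurable borel" unfolding g_def[abs_def] by measurable
      have gH: "g w \<le> H ((1 / scl k) *\<^sub>R w)" for w
      proof -
        have "g w = epowr r (ennreal (norm (conv (dil \<phi> k) u ((1 / s) *\<^sub>R w))))"
          by (simp add: g_def epowr_ennreal)
        also have "\<dots> \<le> H ((1 / s) *\<^sub>R w)"
          unfolding H_def F_def maxfun_def using r by (intro epowr_mono SUP_upper) auto
        finally show ?thesis by (simp add: s_def)
      qed
      have "x - (1 / s) *\<^sub>R y = (1 / s) *\<^sub>R (s *\<^sub>R x - y)" using s by (simp add: scaleR_diff_right)
      then have "epowr r (ennreal (norm (conv (dil_shift \<phi> k y) u x))) = ennreal (norm (conv (dil \<phi> k) u ((1 / s) *\<^sub>R (s *\<^sub>R x - y))) powr r)"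
        by (simp add: epowr_ennreal conv_dil_shift s_def)
      also have "\<dots> \<le> ennreal C1 * (\<integral>\<^sup>+ w. ennreal (norm (conv (dil \<phi> k) u ((1 / s) *\<^sub>R w)) powr r * (1 + norm (s *\<^sub>R x - y - w)) powr (- (M + b))) \<partial>lborel)"
        unfolding s_def by (rule C1(2)[OF u])
      also have "\<dots> = ennreal C1 * (\<integral>\<^sup>+ w. g w * ennreal ((1 + norm (s *\<^sub>R x - y - w)) powr (- (M + b))) \<partial>lborel)"
        by (simp add: g_def ennreal_mult)
      also have "\<dots> \<le> ennreal C1 * (ennreal ((1 + CARD('n)) powr (M + b) * C2) * (SUP m. ennreal ((1 + norm (ivec m + y)) powr (- M)) * shifted_max m H x))"
        unfolding s_def using C2(2)[of b]
        by (intro mult_left_mono lattice_maximal_bound gm Hm gH bM C2(1)) (auto simp: b_def)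
      also have "\<dots> = ennreal K * ?S x"
        using C1 C2 by (simp add: K_def om_def ennreal_mult mult.assoc)
      finally show "epowr r (ennreal (norm (conv (dil_shift \<phi> k y) u x))) \<le> ennreal K * ?S x" .
    qed
    have G_p: "epowr p (G x) \<le> (\<integral>\<^sup>+ m. ennreal (K powr q) * (?t m x) \<partial>?Z)" for x
    proof -
      have "epowr p (G x) = epowr q (epowr r (G x))" by (simp add: epowr_epowr r)
      also have "\<dots> \<le> epowr q (ennreal K * ?S x)"
        using q by (intro epowr_mono G_r) auto
      also have "\<dots> = ennreal (K powr q) * (SUP m. ?t m x)"
        using K q by (simp add: epowr_mult epowr_ennreal epowr_SUP powr_powr)
      \<comment> \<open>The supremum over m gives way to a sum, which can be exchanged with the
        integral over x.\<close>
      also have "\<dots> \<le> ennreal (K powr q) * (\<integral>\<^sup>+ m. ?t m x \<partial>?Z)"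
        by (intro mult_left_mono SUP_least nn_integral_ge_point) auto
      also have "\<dots> = (\<integral>\<^sup>+ m. ennreal (K powr q) * (?t m x) \<partial>?Z)"
        by (rule nn_integral_cmult[symmetric]) simp
      finally show ?thesis .
    qed
    let ?I = "\<integral>\<^sup>+ x. epowr p (F x) \<partial>lborel"
    let ?L = "ln (exp 1 + norm y)"
    have L: "0 \<le> ?L" by (intro ln_ge_zero) (simp add: add_increasing2)
    have qH: "epowr q (H x) = epowr p (F x)" for x by (simp add: H_def epowr_epowr r)
    have "(\<integral>\<^sup>+ x. epowr p (G x) \<partial>lborel)
       \<le> (\<integral>\<^sup>+ x. (\<integral>\<^sup>+ m. ennreal (K powr q) * (?t m x) \<partial>?Z) \<partial>lborel)"
      by (intro nn_integral_mono G_p)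
    also have "\<dots> = (\<integral>\<^sup>+ m. (\<integral>\<^sup>+ x. ennreal (K powr q) * (?t m x) \<partial>lborel) \<partial>?Z)"
      by (rule nn_integral_count_space_nn_integral) auto
    also have "\<dots> = (\<integral>\<^sup>+ m. ennreal (K powr q) * (\<integral>\<^sup>+ x. ?t m x \<partial>lborel) \<partial>?Z)"
      by (intro nn_integral_cong nn_integral_cmult) measurable
    also have "\<dots> = ennreal (K powr q) * (\<integral>\<^sup>+ m. (\<integral>\<^sup>+ x. ?t m x \<partial>lborel) \<partial>?Z)"
      by (rule nn_integral_cmult) simp
    also have "(\<integral>\<^sup>+ m. (\<integral>\<^sup>+ x. ?t m x \<partial>lborel) \<partial>?Z)
       \<le> (\<integral>\<^sup>+ m. ennreal (om m powr (- b)) * (ennreal (C3 * ?L) * ?I) \<partial>?Z)"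
    proof (rule nn_integral_mono)
      fix m :: "int^'n"
      have "(\<integral>\<^sup>+ x. ?t m x \<partial>lborel)
        = ennreal (?o m) * (\<integral>\<^sup>+ x. epowr q (shifted_max m H x) \<partial>lborel)"
        by (rule nn_integral_cmult) measurable
      also have "\<dots> \<le> ennreal (?o m) * (ennreal (C3 * ln (exp 1 + norm (ivec m))) * ?I)"
        using C3(2)[OF Hm, of m] by (intro mult_left_mono) (auto simp: qH)
      also have "\<dots> = ennreal (?o m * (C3 * ln (exp 1 + norm (ivec m)))) * ?I"
        by (simp add: ennreal_mult' mult.assoc)
      also have "\<dots> \<le> ennreal (om m powr (- b) * (C3 * ?L)) * ?I"
      proof (intro mult_right_mono ennreal_leI)
        have "norm (ivec m) \<le> norm (ivec m + y) + norm y" using norm_triangle_ineq4[of "ivec m + y" y] by simp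
        then have "ln (exp 1 + norm (ivec m)) \<le> om m * ?L" unfolding om_def by (intro ln_shift_le) auto
        then have "C3 * ln (exp 1 + norm (ivec m)) \<le> C3 * (om m * ?L)" using C3 by (intro mult_left_mono) auto
        then have "?o m * (C3 * ln (exp 1 + norm (ivec m))) \<le> ?o m * (C3 * (om m * ?L))"
          by (rule mult_left_mono) simp
        also have "\<dots> = (?o m * om m powr 1) * (C3 * ?L)" using om[of m] by simp
        also have "?o m * om m powr 1 = om m powr (1 - M * q)"
          by (simp only: powr_add[symmetric] add.commute[of _ 1]) simp
        also have "om m powr (1 - M * q) * (C3 * ?L) \<le> om m powr (- b) * (C3 * ?L)"
        proof (intro mult_right_mono powr_mono om)
          have "M * 1 \<le> M * q" using q bM by (intro mult_left_mono) auto
          then show "1 - M * q \<le> - b" by (simp add: M_def)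
        qed (use C3 L in auto)
        finally show "?o m * (C3 * ln (exp 1 + norm (ivec m))) \<le> om m powr (- b) * (C3 * ?L)" .
      qed auto
      also have "\<dots> = ennreal (om m powr (- b)) * (ennreal (C3 * ?L) * ?I)"
        by (simp add: ennreal_mult' mult.assoc)
      finally show "(\<integral>\<^sup>+ x. ?t m x \<partial>lborel)
        \<le> ennreal (om m powr (- b)) * (ennreal (C3 * ?L) * ?I)" .
    qed
    also have "\<dots> = (\<integral>\<^sup>+ m. ennreal (om m powr (- b)) \<partial>?Z) * (ennreal (C3 * ?L) * ?I)"
      by (rule nn_integral_multc) simp
    also have "\<dots> \<le> ennreal C2 * (ennreal (C3 * ?L) * ?I)"
      unfolding om_def using C2(2)[of b y] by (intro mult_right_mono) (auto simp: b_def)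
    finally have "(\<integral>\<^sup>+ x. epowr p (G x) \<partial>lborel) \<le> ennreal (K powr q) * (ennreal C2 * (ennreal (C3 * ?L) * ?I))"
      by (simp add: mult_left_mono)
    also have "\<dots> = ennreal C * ennreal ?L * ?I"
      using C2 C3 L by (simp add: C_def ennreal_mult mult_ac)
    finally have main: "(\<integral>\<^sup>+ x. epowr p (G x) \<partial>lborel) \<le> ennreal C * ennreal ?L * ?I" .
    have "Lp_norm p G \<le> epowr (1 / p) (ennreal C * ennreal ?L * ?I)"
      unfolding Lp_norm_epowr using p by (intro epowr_mono main) auto
    also have "\<dots> = ennreal (C powr (1 / p)) * ennreal (?L powr (1 / p)) * Hp_norm p \<phi> u"
      using C L by (simp add: epowr_mult epowr_ennreal Hp_norm_def Lp_norm_epowr F_def)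
    finally show "Lp_norm p (maxfun (\<lambda>k. dil_shift \<phi> k y) u)
       \<le> ennreal (C powr (1 / p)) * ennreal (?L powr (1 / p)) * Hp_norm p \<phi> u" by (simp add: G_def)
  qed
qed

section \<open>Sharpness of the exponent\<close>

text \<open>The seminorm of order 0 dominates the supremum norm, and this controls the pairing with
  an integrable function.\<close>

lemma schwartz_pairing_tempered:
  fixes f :: "'n::finite cfun"
  assumes f: "f \<in> schwartz"
  shows "(\<lambda>g. LBINT t. f t * g t) \<in> tempered"
proof -
  have fm [measurable]: "f \<in> borel_measurable borel" by (rule schwartz_measurable0[OF f])
  have fi: "integrable lborel (\<lambda>t. norm (f t))" using schwartz_integrable0[OF f] by simp
  have bd: "norm (g t) \<le> sch_seminorm 0 g" if g: "g \<in> schwartz" for g :: "'n cfun" and t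
  proof -
    obtain B where B: "\<And>x is. length is \<le> (0::nat) \<Longrightarrow> (1 + norm x) ^ 0 * norm (pderivs is g x) \<le> B"
      using schwartz_bounded_all[OF g, of 0 0] by blast
    have "(\<lambda>(x, is). (1 + norm x) ^ 0 * norm (pderivs is g x)) (t, []) \<le> sch_seminorm 0 g"
      unfolding sch_seminorm_def using B by (intro cSUP_upper bdd_aboveI2[of _ _ B]) auto
    then show ?thesis by simp
  qed
  have int: "integrable lborel (\<lambda>t. f t * g t)" if g: "g \<in> schwartz" for g :: "'n cfun"
  proof (rule Bochner_Integration.integrable_bound)
    have [measurable]: "g \<in> borel_measurable borel" by (rule schwartz_measurable0[OF g])
    show "(\<lambda>t. f t * g t) \<in> borel_measurable lborel" by simp
    show "integrable lborel (\<lambda>t. sch_seminorm 0 g * norm (f t))" using fi by simp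
    show "AE t in lborel. norm (f t * g t) \<le> norm (sch_seminorm 0 g * norm (f t))"
    proof (rule AE_I2)
      fix t
      have "norm (f t * g t) \<le> sch_seminorm 0 g * norm (f t)"
        unfolding norm_mult by (subst mult.commute) (intro mult_right_mono bd g norm_ge_zero)
      then show "norm (f t * g t) \<le> norm (sch_seminorm 0 g * norm (f t))" by simp
    qed
  qed
  have "norm (LBINT t. f t * g t) \<le> (LBINT t. norm (f t)) * sch_seminorm 0 g" if g: "g \<in> schwartz" for g :: "'n cfun"
  proof -
    have "norm (LBINT t. f t * g t) \<le> (LBINT t. norm (f t) * sch_seminorm 0 g)"
      using fi by (intro Bochner_Integration.integral_norm_bound_integral int g)
         (auto simp: norm_mult intro!: mult_left_mono bd g)
    then show ?thesis by simp
  qed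
  moreover have "(LBINT t. f t * (a * g t + b * h t)) = a * (LBINT t. f t * g t) + b * (LBINT t. f t * h t)"
    if "g \<in> schwartz" "h \<in> schwartz" for g h :: "'n cfun" and a b
  proof -
    have "(LBINT t. f t * (a * g t + b * h t)) = (LBINT t. a * (f t * g t) + b * (f t * h t))"
      by (simp add: algebra_simps)
    then show ?thesis using int[OF that(1)] int[OF that(2)] by simp
  qed
  ultimately show ?thesis unfolding tempered_def by blast
qed

text \<open>Submultiplicativity of the weight takes (1 + |x|)^-N out of the integral; the 2 DIM
  further powers of decay of \<open>f\<close> leave an integrable function of t.\<close>

lemma conv_fun_decay:
  fixes f g :: "'n::finite cfun"
  assumes f: "f \<in> schwartz" and g: "g \<in> schwartz" and N: "0 \<le> N"
  obtains C where "0 \<le> C" "\<And>x. norm (LBINT t. f t * g (x - t)) \<le> C * (1 + norm x) powr (- N)"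
proof -
  obtain B where B: "0 \<le> B" "\<And>x. norm (g x) \<le> B * (1 + norm x) powr (- N)"
    using schwartz_decay[OF g, of "[]" N] by auto
  obtain D where D: "0 \<le> D" "\<And>x. norm (f x) \<le> D * (1 + norm x) powr (- (N + 2 * DIM(real^'n)))"
    using schwartz_decay[OF f, of "[]" "N + 2 * DIM(real^'n)"] by auto
  define w where "w x = (1 + norm x) powr (- real (2 * DIM(real^'n)))" for x :: "real^'n"
  have wi: "integrable lborel w"
    unfolding w_def[abs_def] by (rule integrable_bound_weight[where C=1]) auto
  have W: "0 < 1 + norm x" for x :: "real^'n" by (simp add: add_pos_nonneg)
  have le: "norm (f t * g (x - t)) \<le> (D * B * (1 + norm x) powr (- N)) * w t" for x t
  proof -
    have "(1 + norm x) powr N \<le> ((1 + norm t) * (1 + norm (x - t))) powr N"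
      using N weight_submult[of t "x - t"] by (intro powr_mono2) auto
    also have "\<dots> = (1 + norm t) powr N * (1 + norm (x - t)) powr N" by (rule powr_mult)
    finally have *: "(1 + norm t) powr (- N) * (1 + norm (x - t)) powr (- N) \<le> (1 + norm x) powr (- N)"
      using W[of x] W[of t] W[of "x - t"] by (simp add: powr_minus field_simps)
    have "norm (f t * g (x - t)) \<le> (D * (1 + norm t) powr (- (N + 2 * DIM(real^'n)))) * (B * (1 + norm (x - t)) powr (- N))"
      unfolding norm_mult using D B by (intro mult_mono) auto
    also have "(1 + norm t) powr (- (N + 2 * DIM(real^'n))) = (1 + norm t) powr (- N) * w t"
      by (simp add: w_def powr_add[symmetric])
    also have "D * ((1 + norm t) powr (- N) * w t) * (B * (1 + norm (x - t)) powr (- N))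
      = (D * B * w t) * ((1 + norm t) powr (- N) * (1 + norm (x - t)) powr (- N))" by simp
    also have "\<dots> \<le> (D * B * w t) * (1 + norm x) powr (- N)"
      using * D B by (intro mult_left_mono) (auto simp: w_def)
    finally show ?thesis by (simp add: mult_ac)
  qed
  have w0: "0 \<le> (LBINT t. w t)" by (intro integral_nonneg_AE) (auto simp: w_def)
  have "norm (LBINT t. f t * g (x - t)) \<le> (D * B * (LBINT t. w t)) * (1 + norm x) powr (- N)" for x
  proof -
    have "norm (LBINT t. f t * g (x - t)) \<le> (LBINT t. (D * B * (1 + norm x) powr (- N)) * w t)"
      using le wi integrable_conv_pderivs[OF g f, of "[]" x] by (intro Bochner_Integration.integral_norm_bound_integral) auto
    also have "\<dots> = (D * B * (LBINT t. w t)) * (1 + norm x) powr (- N)" by simp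
    finally show ?thesis .
  qed
  then show ?thesis using that[of "D * B * (LBINT t. w t)"] D B w0 by simp
qed

text \<open>The offset of index k is 2 \<rho> 2^(L-k). Each is twice the next and the smallest is 2
  \<rho>, so any two differ by at least 2 \<rho>.\<close>

lemma disjoint_translates:
  fixes v :: "'a::euclidean_space"
  assumes v: "norm v = 1" and \<rho>: "0 < \<rho>"
  shows "disjoint_family_on (\<lambda>k. ball (x0 + (2 ^ L * (2 * \<rho>) / 2 ^ k) *\<^sub>R v) \<rho>) {1..L}"
  unfolding disjoint_family_on_def
proof (intro ballI impI)
  let ?c = "\<lambda>k. 2 ^ L * (2 * \<rho>) / 2 ^ k"
  have *: "ball (x0 + ?c k *\<^sub>R v) \<rho> \<inter> ball (x0 + ?c j *\<^sub>R v) \<rho> = {}"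
    if kj: "k < j" "j \<le> L" for k j
  proof (rule disjoint_ballI)
    have "dist (x0 + ?c k *\<^sub>R v) (x0 + ?c j *\<^sub>R v)
      = \<bar>?c k - ?c j\<bar>"
      by (simp add: dist_norm scaleR_diff_left[symmetric] v)
    moreover have "2 * \<rho> \<le> ?c k - ?c j"
    proof -
      have 1: "?c k = (2 ^ (j - k) * 2 ^ (L - j)) * (2 * \<rho>)"
      proof -
        have "(2::real) ^ L = 2 ^ (j - k) * 2 ^ (L - j) * 2 ^ k" using kj by (simp add: power_add[symmetric])
        then show ?thesis by simp
      qed
      have 2: "?c j = 2 ^ (L - j) * (2 * \<rho>)"
      proof -
        have "(2::real) ^ L = 2 ^ (L - j) * 2 ^ j" using kj by (simp add: power_add[symmetric])
        then show ?thesis by simp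
      qed
      have "(2::real) ^ 1 \<le> 2 ^ (j - k)" using kj by (intro power_increasing) auto
      then have "1 * 1 \<le> (2 ^ (j - k) - 1) * (2::real) ^ (L - j)" by (intro mult_mono) auto
      then have "1 * (2 * \<rho>) \<le> ((2 ^ (j - k) - 1) * 2 ^ (L - j)) * (2 * \<rho>)"
        using \<rho> by (intro mult_right_mono) auto
      then show ?thesis unfolding 1 2 by (simp add: algebra_simps)
    qed
    ultimately show "\<rho> + \<rho> \<le> dist (x0 + ?c k *\<^sub>R v) (x0 + ?c j *\<^sub>R v)"
      using abs_ge_self[of "?c k - ?c j"] by linarith
  qed
  fix m n assume "m \<in> {1..L}" "n \<in> {1..L}" "m \<noteq> n"
  then show "ball (x0 + ?c m *\<^sub>R v) \<rho> \<inter> ball (x0 + ?c n *\<^sub>R v) \<rho> = {}"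
    using *[of m n] *[of n m] by (cases "m < n") (auto simp: Int_commute)
qed

lemma emeasure_ball_translate:
  fixes x :: "'a::euclidean_space"
  shows "emeasure lborel (ball x r) = emeasure lborel (ball (0::'a) r)"
proof -
  have eq: "ball (0::'a) r = {z. z + x \<in> ball x r}" by (auto simp: dist_norm)
  show ?thesis unfolding eq by (rule emeasure_translate[symmetric]) auto
qed

text \<open>Divide by B + L: if r p < 1, the right side tends to 0, while the left side is at least
  A/2 as soon as L >= B.\<close>

lemma log_growth_exponent:
  fixes r p A B C :: real
  assumes p: "0 < p" and r: "0 \<le> r" and A: "0 < A"
    and le: "\<And>L::nat. A * real L \<le> C * (B + real L) powr (r * p)" and B: "1 \<le> B"
  shows "1 / p \<le> r"
proof (rule ccontr)
  assume "\<not> 1 / p \<le> r"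
  then have rp: "r * p < 1" using p by (simp add: field_simps)
  have C: "0 \<le> C"
  proof (rule ccontr)
    assume "\<not> 0 \<le> C"
    then have "C * (B + real 0) powr (r * p) < 0" using B by (intro mult_neg_pos) auto
    then show False using le[of 0] by simp
  qed
  have upper: "A * real L / (B + real L) \<le> C * (B + real L) powr (r * p - 1)" for L
    using le[of L] B by (simp add: powr_diff divide_right_mono)
  have "(\<lambda>L. C * (B + real L) powr (r * p - 1)) \<longlonglongrightarrow> C * 0"
    using rp by (intro tendsto_mult tendsto_const tendsto_neg_powr filterlim_tendsto_add_at_top[OF tendsto_const] filterlim_real_sequentially) auto
  moreover have "A / 2 \<le> C * (B + real L) powr (r * p - 1)" if "nat \<lceil>B\<rceil> \<le> L" for L
  proof -
    have "B \<le> real L" using that by linarith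
    then have "A * (B + real L) \<le> A * (2 * real L)" using A by (intro mult_left_mono) auto
    then have "A / 2 \<le> A * real L / (B + real L)" using B by (simp add: field_simps)
    then show ?thesis using upper[of L] by linarith
  qed
  ultimately have "A / 2 \<le> C * 0"
    by (intro LIMSEQ_le_const[of "\<lambda>L. C * (B + real L) powr (r * p - 1)"] exI[of _ "nat \<lceil>B\<rceil>"]) blast+
  then show False using A by simp
qed

section \<open>The test function and the lower bound\<close>

lemma conv_fun_commute:
  fixes f g :: "'n::finite cfun"
  assumes "f \<in> schwartz" "g \<in> schwartz"
  shows "(LBINT w. f w * g (x - w)) = (LBINT w. g w * f (x - w))"
proof -
  have [measurable]: "f \<in> borel_measurable borel" "g \<in> borel_measurable borel"
    using assms by (auto intro: schwartz_measurable0)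
  have m: "(\<lambda>w. f w * g (x - w)) \<in> borel_measurable borel" by measurable
  show ?thesis using integral_affine[OF m, of "-1" x] by (simp add: mult.commute)
qed

text \<open>The generations are two apart so that at a unit frequency the first symbol is 1 and the
  second, which is the symbol of \<phi> at radius 4, is 0. One generation apart it would be
  evaluated at radius 2, where the hypotheses give no value directly. The coefficients 1 and -1 fit
  \<open>schwartz_lincomb\<close>.\<close>

definition test_fun :: "'n::finite cfun \<Rightarrow> 'n cfun" where
  "test_fun \<phi> = (\<lambda>x. 1 * dil \<phi> 0 x + (-1) * dil \<phi> (-2) x)"

lemma test_fun_schwartz: "\<phi> \<in> schwartz \<Longrightarrow> test_fun \<phi> \<in> schwartz"
  unfolding test_fun_def by (intro schwartz_lincomb dil_schwartz)

text \<open>For k >= 1, \<open>dil \<phi> k\<close> reproduces both terms. For k <= -3 the roles are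
  reversed: both terms reproduce \<open>dil \<phi> k\<close>, and the difference cancels.\<close>

lemma test_fun_conv:
  fixes \<phi> :: "'n::finite cfun"
  assumes \<phi>: "\<phi> \<in> schwartz" "low_pass \<phi>" "unit_symbol \<phi>"
  shows "1 \<le> k \<Longrightarrow> (LBINT t. test_fun \<phi> t * dil \<phi> k (x - t)) = test_fun \<phi> x"
    and "k \<le> -3 \<Longrightarrow> (LBINT t. test_fun \<phi> t * dil \<phi> k (x - t)) = 0"
proof -
  note d = dil_schwartz[OF \<phi>(1)]
  have split: "(LBINT t. test_fun \<phi> t * dil \<phi> k (x - t))
    = (LBINT t. dil \<phi> 0 t * dil \<phi> k (x - t)) - (LBINT t. dil \<phi> (-2) t * dil \<phi> k (x - t))" for k
    using integrable_conv_pderivs[OF d[of k] d[of 0], of "[]" x] integrable_conv_pderivs[OF d[of k] d[of "-2"], of "[]" x]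
    by (simp add: test_fun_def left_diff_distrib)
  show "(LBINT t. test_fun \<phi> t * dil \<phi> k (x - t)) = test_fun \<phi> x" if "1 \<le> k"
    using that unfolding split conv_fun_commute[OF d[of 0] d[of k]] conv_fun_commute[OF d[of "-2"] d[of k]]
    by (simp add: dil_conv_dil[OF \<phi>] test_fun_def)
  show "(LBINT t. test_fun \<phi> t * dil \<phi> k (x - t)) = 0" if "k \<le> -3"
    using that unfolding split by (simp add: dil_conv_dil[OF \<phi>])
qed

lemma test_fun_nonzero:
  fixes \<phi> :: "'n::finite cfun"
  assumes \<phi>: "\<phi> \<in> schwartz" "low_pass \<phi>" "unit_symbol \<phi>"
  obtains x where "test_fun \<phi> x \<noteq> 0"
proof (rule ccontr)
  assume "\<not> thesis"
  then have z: "test_fun \<phi> x = 0" for x using that by blast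
  obtain i :: 'n where True by blast
  define \<xi> :: "real^'n" where "\<xi> = axis i 1"
  have n: "norm \<xi> = 1" by (simp add: \<xi>_def)
  have "dil \<phi> 0 = dil \<phi> (-2)" using z by (simp add: test_fun_def fun_eq_iff)
  then have "fourier (dil \<phi> 0) \<xi> = fourier (dil \<phi> (-2)) \<xi>" by simp
  then have "fourier \<phi> \<xi> = fourier \<phi> (4 *\<^sub>R \<xi>)"
    by (simp add: fourier_dil[OF \<phi>(1)] powr_minus)
  then show False using \<phi>(2)[rule_format, of "4 *\<^sub>R \<xi>"] \<phi>(3)[rule_format, of \<xi>] n by simp
qed

text \<open>By \<open>test_fun_conv\<close> the indices -2, ..., 1 account for all nonzero
  convolutions, so the supremum is over finitely many decaying functions. Decay of order 2 DIM / p
  makes its p-th power integrable, however small p is.\<close>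

lemma test_fun_Hp:
  fixes \<phi> :: "'n::finite cfun"
  assumes p: "0 < p"
    and \<phi>: "\<phi> \<in> schwartz" "low_pass \<phi>" "unit_symbol \<phi>"
  defines "u \<equiv> (\<lambda>g. LBINT t. test_fun \<phi> t * g t)"
  shows "(\<integral>\<^sup>+ x. epowr p (maxfun (dil \<phi>) u x) \<partial>lborel) < \<infinity>" and "u \<in> Hp p \<phi>"
proof -
  note f = test_fun_schwartz[OF \<phi>(1)]
  define N where "N = real (2 * DIM(real^'n)) / p"
  have N: "0 \<le> N" using p by (simp add: N_def)
  have "\<exists>C\<ge>0. \<forall>x. norm (conv (dil \<phi> k) u x) \<le> C * (1 + norm x) powr (- N)" for k
    using conv_fun_decay[OF f dil_schwartz[OF \<phi>(1)] N, of k] unfolding conv_def u_def by metis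
  then obtain C where C: "\<And>k. 0 \<le> C k" "\<And>k x. norm (conv (dil \<phi> k) u x) \<le> C k * (1 + norm x) powr (- N)"
    by metis
  define D where "D = (\<Sum>k\<in>{-2..1}. C k)"
  have D: "0 \<le> D" using C by (simp add: D_def sum_nonneg)
  have bound: "norm (conv (dil \<phi> k) u x) \<le> D * (1 + norm x) powr (- N)" for k x
  proof -
    have CD: "C k \<le> D" if "k \<in> {-2..1}" for k
      unfolding D_def using that C by (intro member_le_sum) auto
    have le: "norm (conv (dil \<phi> k) u x) \<le> D * (1 + norm x) powr (- N)" if "k \<in> {-2..1}" for k
      using CD[OF that] by (intro order_trans[OF C(2)] mult_right_mono) auto
    consider "k \<le> -3" | "k \<in> {-2..1}" | "1 \<le> k" by fastforce
    then show ?thesis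
    proof cases
      case 1
      then show ?thesis using D by (simp add: conv_def u_def test_fun_conv(2)[OF \<phi>])
    next
      case 2
      then show ?thesis by (rule le)
    next
      case 3
      then have "conv (dil \<phi> k) u x = conv (dil \<phi> 1) u x"
        by (simp add: conv_def u_def test_fun_conv(1)[OF \<phi>])
      then show ?thesis using le[of 1] by simp
    qed
  qed
  have "(\<integral>\<^sup>+ x. epowr p (maxfun (dil \<phi>) u x) \<partial>lborel)
    \<le> (\<integral>\<^sup>+ (x::real^'n). ennreal (D powr p) * ennreal ((1 + norm x) powr (- real (2 * DIM(real^'n)))) \<partial>lborel)"
  proof (rule nn_integral_mono)
    fix x :: "real^'n"
    have "maxfun (dil \<phi>) u x \<le> ennreal (D * (1 + norm x) powr (- N))"
      unfolding maxfun_def by (intro SUP_least ennreal_leI bound)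
    then have "epowr p (maxfun (dil \<phi>) u x) \<le> epowr p (ennreal (D * (1 + norm x) powr (- N)))"
      using p by (intro epowr_mono) auto
    also have "\<dots> = ennreal (D powr p) * ennreal ((1 + norm x) powr (- N * p))"
      using D by (simp add: epowr_mult epowr_ennreal powr_powr ennreal_mult)
    also have "- N * p = - real (2 * DIM(real^'n))" using p by (simp add: N_def)
    finally show "epowr p (maxfun (dil \<phi>) u x) \<le> ennreal (D powr p) * ennreal ((1 + norm x) powr (- real (2 * DIM(real^'n))))" .
  qed
  also have "\<dots> = ennreal (D powr p) * (\<integral>\<^sup>+ (x::real^'n). ennreal ((1 + norm x) powr (- real (2 * DIM(real^'n)))) \<partial>lborel)"
    by (rule nn_integral_cmult) measurable
  also have "\<dots> < \<infinity>"
    using nn_integral_weight_finite[where 'a="real^'n", of "real (2 * DIM(real^'n))"] by (simp add: ennreal_mult_less_top)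
  finally show fin: "(\<integral>\<^sup>+ x. epowr p (maxfun (dil \<phi>) u x) \<partial>lborel) < \<infinity>" .
  have "u \<in> tempered" unfolding u_def by (rule schwartz_pairing_tempered[OF f])
  moreover have "Hp_norm p \<phi> u < \<infinity>"
    using fin by (auto simp: Hp_norm_def Lp_norm_epowr epowr_def)
  ultimately show "u \<in> Hp p \<phi>" by (simp add: Hp_def)
qed

lemma shifted_maximal_exponent:
  fixes p r C :: real and \<phi> :: "'n::finite cfun"
  assumes p: "0 < p"
    and \<phi>: "\<phi> \<in> schwartz" "low_pass \<phi>" "unit_symbol \<phi>"
    and r: "0 \<le> r"
    and bd: "\<And>y f. f \<in> Hp p \<phi> \<Longrightarrow> Lp_norm p (maxfun (\<lambda>k. dil_shift \<phi> k y) f)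
              \<le> ennreal C * ennreal (ln (exp 1 + norm y) powr r) * Hp_norm p \<phi> f"
  shows "1 / p \<le> r"
proof -
  note f = test_fun_schwartz[OF \<phi>(1)]
  define u where "u = (\<lambda>g. LBINT t. test_fun \<phi> t * g t)"
  have u: "u \<in> Hp p \<phi>" and J: "(\<integral>\<^sup>+ x. epowr p (maxfun (dil \<phi>) u x) \<partial>lborel) < \<infinity>"
    using test_fun_Hp[OF p \<phi>] by (simp_all add: u_def)
  obtain j where j: "0 \<le> j" "(\<integral>\<^sup>+ x. epowr p (maxfun (dil \<phi>) u x) \<partial>lborel) = ennreal j"
    using J by (cases "\<integral>\<^sup>+ x. epowr p (maxfun (dil \<phi>) u x) \<partial>lborel") auto
  obtain x0 where x0: "test_fun \<phi> x0 \<noteq> 0" using test_fun_nonzero[OF \<phi>] by blast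
  \<comment> \<open>Half the value at \<open>x0\<close>, so that by continuity the test function
    stays above \<open>c\<close> on a ball.\<close>
  define c where "c = norm (test_fun \<phi> x0) / 2"
  have c: "0 < c" using x0 by (simp add: c_def)
  have "isCont (test_fun \<phi>) x0" using schwartz_cont[OF f, of "[]"] by (simp add: continuous_on_eq_continuous_at)
  then obtain \<rho> where \<rho>: "0 < \<rho>" "\<And>x. dist x x0 < \<rho> \<Longrightarrow> dist (test_fun \<phi> x) (test_fun \<phi> x0) < c"
    using c unfolding continuous_at_eps_delta by blast
  have ge: "c \<le> norm (test_fun \<phi> x)" if "dist x x0 < \<rho>" for x
  proof -
    have "norm (test_fun \<phi> x0) \<le> norm (test_fun \<phi> x) + dist (test_fun \<phi> x) (test_fun \<phi> x0)"
      unfolding dist_norm by (metis norm_triangle_sub norm_minus_commute)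
    then show ?thesis using \<rho>(2)[OF that] by (simp add: c_def)
  qed
  obtain i :: 'n where True by blast
  define v :: "real^'n" where "v = axis i 1"
  have v: "norm v = 1" by (simp add: v_def)
  obtain \<beta> where \<beta>: "0 < \<beta>" "emeasure lborel (ball (0::real^'n) \<rho>) = ennreal \<beta>"
  proof -
    have "emeasure lborel (ball (0::real^'n) \<rho>) < \<infinity>" by (rule emeasure_lborel_ball_finite)
    moreover have "emeasure lborel (ball (0::real^'n) \<rho>) \<noteq> 0"
    proof
      assume "emeasure lborel (ball (0::real^'n) \<rho>) = 0"
      then have "negligible (ball (0::real^'n) \<rho>)"
        by (simp add: negligible_iff_null_sets null_sets_completionI null_setsI)
      then show False using \<rho>(1) by (simp add: open_not_negligible)
    qed
    ultimately show ?thesis using that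
      by (cases "emeasure lborel (ball (0::real^'n) \<rho>)") (auto simp: less_le)
  qed
  \<comment> \<open>Chosen so that ln(e + |y|) is at most B + L for the vectors \<open>y\<close>
    used below.\<close>
  define B where "B = ln (exp 1 + 2 * \<rho>)"
  have B: "1 \<le> B" unfolding B_def using \<rho>(1) by (subst ln_ge_iff) (auto simp: add_pos_pos)
  have "(c powr p * \<beta>) * real L \<le> (\<bar>C\<bar> powr p * j) * (B + real L) powr (r * p)" for L
  proof -
    \<comment> \<open>With this length the shift 2^-k y is the k-th offset in
      \<open>disjoint_translates\<close>, and the k-th shifted convolution is at least
      \<open>c\<close> in modulus on the ball \<open>U k\<close>.\<close>
    define y where "y = (2 ^ L * (2 * \<rho>)) *\<^sub>R v"
    let ?c = "\<lambda>k. 2 ^ L * (2 * \<rho>) / 2 ^ k" and ?l = "ln (exp 1 + norm y)"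
    define U where "U k = ball (x0 + ?c k *\<^sub>R v) \<rho>" for k :: nat
    let ?U = "\<Union>k\<in>{1..L}. U k"
    define G where "G = maxfun (\<lambda>k. dil_shift \<phi> k y) u"
    have GU: "ennreal c \<le> G x" if x: "x \<in> U k" "1 \<le> k" for x k
    proof -
      have s: "(1 / scl (int k)) *\<^sub>R y = ?c k *\<^sub>R v"
        by (simp add: y_def powr_realpow)
      have "conv (dil_shift \<phi> (int k) y) u x = test_fun \<phi> (x - ?c k *\<^sub>R v)"
        unfolding conv_dil_shift s using x(2) by (simp add: conv_def u_def test_fun_conv(1)[OF \<phi>])
      moreover have "dist (x - ?c k *\<^sub>R v) x0 < \<rho>"
        using x(1) by (simp add: U_def dist_norm norm_minus_commute algebra_simps)
      ultimately have "ennreal c \<le> ennreal (norm (conv (dil_shift \<phi> (int k) y) u x))"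
        using ge by (intro ennreal_leI) simp
      also have "\<dots> \<le> G x" unfolding G_def maxfun_def by (rule SUP_upper) simp
      finally show ?thesis .
    qed
    have U: "emeasure lborel (U k) = ennreal \<beta>" for k
      unfolding U_def by (subst emeasure_ball_translate) (rule \<beta>(2))
    have "ennreal (c powr p * \<beta> * real L) = ennreal (c powr p) * (\<Sum>k\<in>{1..L}. emeasure lborel (U k))"
      using \<beta>(1) by (simp add: U ennreal_mult ennreal_of_nat_eq_real_of_nat mult_ac)
    also have "(\<Sum>k\<in>{1..L}. emeasure lborel (U k)) = emeasure lborel ?U"
      using disjoint_translates[OF v \<rho>(1), of x0 L] by (intro sum_emeasure) (auto simp: U_def)
    also have "ennreal (c powr p) * emeasure lborel ?U
      = (\<integral>\<^sup>+ x. ennreal (c powr p) * indicator ?U x \<partial>lborel)"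
      by (rule nn_integral_cmult_indicator[symmetric]) (auto simp: U_def)
    also have "\<dots> \<le> (\<integral>\<^sup>+ x. epowr p (G x) \<partial>lborel)"
    proof (rule nn_integral_mono)
      fix x
      show "ennreal (c powr p) * indicator ?U x \<le> epowr p (G x)"
      proof (cases "x \<in> ?U")
        case True
        then have "ennreal c \<le> G x" using GU by auto
        then have "epowr p (ennreal c) \<le> epowr p (G x)" using p by (intro epowr_mono) auto
        then show ?thesis using True c by (simp add: epowr_ennreal)
      qed simp
    qed
    also have "\<dots> = epowr p (Lp_norm p G)" using p by (simp add: Lp_norm_epowr epowr_epowr)
    also have "\<dots> \<le> epowr p (ennreal \<bar>C\<bar> * ennreal (?l powr r) * Hp_norm p \<phi> u)"
    proof (rule epowr_mono)
      \<comment> \<open>\<open>ennreal\<close> reads a negative C as 0; passing to |C| gives a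
        constant that can be raised to a real power.\<close>
      have "ennreal C * ennreal (?l powr r) * Hp_norm p \<phi> u
        \<le> ennreal \<bar>C\<bar> * ennreal (?l powr r) * Hp_norm p \<phi> u"
        by (intro mult_right_mono ennreal_leI) auto
      then show "Lp_norm p G \<le> ennreal \<bar>C\<bar> * ennreal (?l powr r) * Hp_norm p \<phi> u"
        using bd[OF u, of y] unfolding G_def by (rule order_trans[rotated])
    qed (use p in auto)
    also have "\<dots> = ennreal (\<bar>C\<bar> powr p * ?l powr (r * p) * j)"
      using p j by (simp add: epowr_mult epowr_ennreal Hp_norm_def Lp_norm_epowr epowr_epowr powr_powr ennreal_mult)
    finally have "c powr p * \<beta> * real L \<le> \<bar>C\<bar> powr p * ?l powr (r * p) * j"
      using j by (subst (asm) ennreal_le_iff) auto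
    also have "\<dots> \<le> \<bar>C\<bar> powr p * (B + real L) powr (r * p) * j"
    proof (intro mult_right_mono mult_left_mono powr_mono2)
      \<comment> \<open>Taking 2^L out of the logarithm leaves L ln 2, which is at most L.\<close>
      have "exp 1 + norm y \<le> 2 ^ L * (exp 1 + 2 * \<rho>)"
      proof -
        have "1 * exp 1 \<le> 2 ^ L * exp (1::real)" by (intro mult_right_mono) auto
        then show ?thesis using \<rho>(1) by (simp add: y_def v algebra_simps)
      qed
      then have "?l \<le> ln (2 ^ L * (exp 1 + 2 * \<rho>))"
        by (intro ln_mono) (auto simp: add_pos_nonneg)
      also have "\<dots> = real L * ln 2 + B"
        unfolding B_def using \<rho>(1) by (subst ln_mult_pos) (auto simp: ln_realpow add_pos_pos)
      also have "\<dots> \<le> B + real L" using ln_2_less_1 by (simp add: mult_left_le)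
      finally show "?l \<le> B + real L" .
      show "0 \<le> ?l" by (intro ln_ge_zero) (simp add: add_increasing2)
    qed (use p r j in auto)
    finally show ?thesis by (simp add: mult_ac)
  qed
  from log_growth_exponent[OF p r _ this B] show ?thesis using c \<beta> by simp
qed

theorem theorem1p5:
  fixes p :: real and \<phi> :: "real^'n::finite \<Rightarrow> complex"
  assumes "0 < p"
    and "\<phi> \<in> schwartz"
    and "\<forall>\<xi>. norm \<xi> > 2 \<longrightarrow> fourier \<phi> \<xi> = 0"
    and "\<forall>\<xi>. norm \<xi> \<le> 1 \<longrightarrow> fourier \<phi> \<xi> = 1"
  shows "(\<exists>C::real. \<forall>y f. f \<in> Hp p \<phi> \<longrightarrow>
            Lp_norm p (maxfun (\<lambda>k. dil_shift \<phi> k y) f)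
              \<le> ennreal C * ennreal (ln (exp 1 + norm y) powr (1 / p)) * Hp_norm p \<phi> f)
       \<and> (\<forall>r::real. r \<ge> 0 \<longrightarrow>
            (\<exists>C::real. \<forall>y f. f \<in> Hp p \<phi> \<longrightarrow>
               Lp_norm p (maxfun (\<lambda>k. dil_shift \<phi> k y) f)
                 \<le> ennreal C * ennreal (ln (exp 1 + norm y) powr r) * Hp_norm p \<phi> f)
            \<longrightarrow> r \<ge> 1 / p)"
  using shifted_maximal_bound[OF assms] shifted_maximal_exponent[OF assms] by blast

end
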